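(* Let $f_1,f_2,f_3\in\mathbb{C}[z_1,z_2]$ be non-constant linear polynomials (i.e. polynomials of total degree one, possibly with non-zero constant term). Let $$A:=\mathbb{C}\big[z_1,z_2,\overline{z_1},\overline{z_2},f_1^{-1},f_2^{-1},f_3^{-1},(\overline{f_1})^{-1},(\overline{f_2})^{-1},(\overline{f_3})^{-1}\big]$$ and let $B:=\{a\in A: a^*=a\}$ be its hermitean part, a real unital algebra. Then neither $B$ nor $A$ has the moment property.
   Context: $\mathbb{C}[z_1,z_2,\overline{z_1},\overline{z_2}]$ is the unital commutative complex $*$-algebra of polynomials in the four independent variables $z_1,z_2,\overline{z_1},\overline{z_2}$, with (conjugate-linear) involution $p\mapsto p^*$ determined by $z_j^*=\overline{z_j}$; for a polynomial $f$ in it write $\overline{f}:=f^*$. The algebra $A$ is the subalgebra of its field of fractions generated by it and by the listed inverses, with the extended involution. For a finitely generated commutative unital complex $*$-algebra $A$, a character is a unital $*$-homomorphism $A\to\mathbb{C}$; for a finitely generated commutative unital real algebra $B$, a character is a unital algebra homomorphism $B\to\mathbb{R}$. The sets of characters are denoted $\widehat A$, $\widehat B$. A finite set of generators identifies them with closed subsets of some $\mathbb{C}^N$, resp. $\mathbb{R}^N$ (a character being identified with its values on the generators), so they are locally compact Hausdorff spaces and algebra elements are continuous functions on them, $f(\chi):=\chi(f)$. Complex case: a linear functional $L:A\to\mathbb{C}$ is positive if $L(a^*a)\geq 0$ for all $a\in A$; it is a moment functional if there is a (positive) Radon measure $\mu$ on $\widehat A$ with $L(f)=\int_{\widehat A}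 f\,d\mu$ for all $f\in A$ (all $f\in A$ being $\mu$-integrable); $A$ has the moment property if every positive linear functional on $A$ is a moment functional. Real case: a linear functional $L:B\to\mathbb{R}$ is a moment functional if there is a (positive) Radon measure $\mu$ on $\widehat B$ with $L(f)=\int_{\widehat B} f\,d\mu$ for all $f\in B$; $B$ has the moment property if every linear functional $L:B\to\mathbb{R}$ with $L(f^2)\geq 0$ for all $f\in B$ is a moment functional. *)

theory Defs
  imports
    "HOL-Analysis.Analysis"
    "HOL-Library.Poly_Mapping"
    "HOL-Computational_Algebra.Fraction_Field"
begin

section \<open>Commutative algebras, characters and the moment property\<close>

text \<open>
  A commutative unital algebra over a field \<open>'k\<close> is given by a carrier \<open>A\<close> inside an ambient
  commutative ring \<open>'a\<close>, together with the scalar multiplication \<open>s\<close>; a complex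
  $*$-algebra comes with an involution \<open>star\<close> in addition.
\<close>

inductive_set generated_algebra :: "('k \<Rightarrow> 'a \<Rightarrow> 'a) \<Rightarrow> 'a set \<Rightarrow> 'a::comm_ring_1 set"
  for s :: "'k \<Rightarrow> 'a \<Rightarrow> 'a" and G :: "'a set" where
  one: "1 \<in> generated_algebra s G"
| gen: "g \<in> G \<Longrightarrow> g \<in> generated_algebra s G"
| add: "a \<in> generated_algebra s G \<Longrightarrow> b \<in> generated_algebra s G \<Longrightarrow> a + b \<in> generated_algebra s G"
| mult: "a \<in> generated_algebra s G \<Longrightarrow> b \<in> generated_algebra s G \<Longrightarrow> a * b \<in> generated_algebra s G"
| scale: "a \<in> generated_algebra s G \<Longrightarrow> s c a \<in> generated_algebra s G"

definition linear_functional ::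
    "('k \<Rightarrow> 'a \<Rightarrow> 'a) \<Rightarrow> 'a set \<Rightarrow> ('a::comm_ring_1 \<Rightarrow> 'k::field) \<Rightarrow> bool" where
  "linear_functional s A L \<longleftrightarrow>
     (\<forall>a\<in>A. \<forall>b\<in>A. L (a + b) = L a + L b) \<and> (\<forall>c. \<forall>a\<in>A. L (s c a) = c * L a)"

text \<open>
  Characters are made extensional (\<open>undefined\<close> off \<open>A\<close>), so that distinct functions are
  distinct characters.
\<close>

definition characters ::
    "('k \<Rightarrow> 'a \<Rightarrow> 'a) \<Rightarrow> 'a set \<Rightarrow> ('a::comm_ring_1 \<Rightarrow> 'k::field) set" where
  "characters s A =
     {\<phi> \<in> extensional A. linear_functional s A \<phi> \<and> \<phi> 1 = 1 \<and>
        (\<forall>a\<in>A. \<forall>b\<in>A. \<phi> (a * b) = \<phi> a * \<phi> b)}"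

definition star_characters ::
    "(complex \<Rightarrow> 'a \<Rightarrow> 'a) \<Rightarrow> ('a \<Rightarrow> 'a) \<Rightarrow> 'a set \<Rightarrow> ('a::comm_ring_1 \<Rightarrow> complex) set" where
  "star_characters s star A = {\<phi> \<in> characters s A. \<forall>a\<in>A. \<phi> (star a) = cnj (\<phi> a)}"

text \<open>
  The topology of pointwise convergence on a set \<open>X\<close> of characters of \<open>A\<close>. By
  \<open>character_topology_generators\<close> below it is the topology obtained by identifying characters
  with their values on any set of generators of \<open>A\<close>.
\<close>

definition character_topology ::
    "'a set \<Rightarrow> ('a \<Rightarrow> 'k::topological_space) set \<Rightarrow> ('a \<Rightarrow> 'k) topology" where
  "character_topology A X = subtopology (product_topology (\<lambda>_. euclidean) A) X"

text \<open>
  A Radon measure on a (locally compact) Hausdorff space: a Borel measure which is finite on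
  compact sets and inner regular with respect to compact sets.
\<close>

definition radon_measure :: "'x topology \<Rightarrow> 'x measure \<Rightarrow> bool" where
  "radon_measure T M \<longleftrightarrow>
     space M = topspace T \<and>
     sets M = sigma_sets (topspace T) {U. openin T U} \<and>
     (\<forall>K. compactin T K \<longrightarrow> emeasure M K < \<infinity>) \<and>
     (\<forall>E\<in>sets M. emeasure M E = (SUP K\<in>{K. compactin T K \<and> K \<subseteq> E}. emeasure M K))"

definition moment_functional ::
    "'a set \<Rightarrow> ('a \<Rightarrow> 'k) set \<Rightarrow> ('a \<Rightarrow> 'k::{banach, second_countable_topology}) \<Rightarrow> bool" where
  "moment_functional A X L \<longleftrightarrow>
     (\<exists>M. radon_measure (character_topology A X) M \<and>
        (\<forall>a\<in>A. integrable M (\<lambda>\<phi>. \<phi> a) \<and> L a = (\<integral>\<phi>. \<phi> a \<partial>M)))"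

definition complex_moment_property ::
    "(complex \<Rightarrow> 'a \<Rightarrow> 'a) \<Rightarrow> ('a \<Rightarrow> 'a) \<Rightarrow> 'a::comm_ring_1 set \<Rightarrow> bool" where
  "complex_moment_property s star A \<longleftrightarrow>
     (\<forall>L. linear_functional s A L \<and> (\<forall>a\<in>A. L (star a * a) \<in> \<real>\<^sub>\<ge>\<^sub>0) \<longrightarrow>
          moment_functional A (star_characters s star A) L)"

definition real_moment_property ::
    "(real \<Rightarrow> 'a \<Rightarrow> 'a) \<Rightarrow> 'a::comm_ring_1 set \<Rightarrow> bool" where
  "real_moment_property s B \<longleftrightarrow>
     (\<forall>L. linear_functional s B L \<and> (\<forall>b\<in>B. L (b\<^sup>2) \<ge> 0) \<longrightarrow>
          moment_functional B (characters s B) L)"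

lemma continuous_map_mult_euclidean:
  fixes f g :: "'x \<Rightarrow> 'k::real_normed_algebra"
  assumes "continuous_map T euclidean f" and "continuous_map T euclidean g"
  shows "continuous_map T euclidean (\<lambda>x. f x * g x)"
  using assms by (simp add: continuous_map_atin tendsto_mult)

lemma character_topology_generators:
  fixes s :: "'k::real_normed_field \<Rightarrow> 'a \<Rightarrow> 'a::comm_ring_1" and X :: "('a \<Rightarrow> 'k) set"
  assumes A: "A = generated_algebra s G" and X: "X \<subseteq> characters s A"
  shows "character_topology A X =
    pullback_topology X (\<lambda>\<phi>. restrict \<phi> G) (product_topology (\<lambda>_. euclidean) G)"
proof -
  let ?P = "pullback_topology X (\<lambda>\<phi>. restrict \<phi> G) (product_topology (\<lambda>_. euclidean :: 'k topology) G)"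
  let ?T = "character_topology A X"
  have GA: "G \<subseteq> A" using A by (auto intro: generated_algebra.gen)
  have ext: "\<phi> \<in> extensional A" if "\<phi> \<in> X" for \<phi> using X that by (auto simp: characters_def)
  have topP: "topspace ?P = X" by (auto simp: topspace_pullback_topology)
  have topT: "topspace ?T = X"
    using ext by (auto simp: character_topology_def PiE_def)
  have evT: "continuous_map ?T euclidean (\<lambda>\<phi>. \<phi> a)" if "a \<in> A" for a
    unfolding character_topology_def
    by (rule continuous_map_from_subtopology)
       (use that in \<open>auto intro: continuous_map_product_projection\<close>)
  have evG: "continuous_map ?P euclidean (\<lambda>\<phi>. \<phi> g)" if "g \<in> G" for g
  proof -
    have "continuous_map ?P (product_topology (\<lambda>_. euclidean) G) (\<lambda>\<phi>. restrict \<phi> G)"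
      by (rule continuous_map_pullback[where g = id, unfolded id_comp]) simp
    from continuous_map_compose[OF this continuous_map_product_projection[OF that]]
    show ?thesis using that by (simp add: comp_def)
  qed
  have evP: "continuous_map ?P euclidean (\<lambda>\<phi>. \<phi> a)" if "a \<in> A" for a
    using that unfolding A
  proof (induction rule: generated_algebra.induct)
    case one
    have "continuous_map ?P euclidean (\<lambda>\<phi>. 1 :: 'k)" by simp
    then show ?case
      by (rule continuous_map_eq) (use X topP in \<open>auto simp: characters_def\<close>)
  next
    case (gen g)
    then show ?case by (rule evG)
  next
    case (add a b)
    have "continuous_map ?P euclidean (\<lambda>\<phi>. \<phi> a + \<phi> b)"
      using add by (intro continuous_map_add)
    then show ?case
      by (rule continuous_map_eq)
         (use X topP add A in \<open>auto simp: characters_def linear_functional_def\<close>)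
  next
    case (mult a b)
    have "continuous_map ?P euclidean (\<lambda>\<phi>. \<phi> a * \<phi> b)"
      by (rule continuous_map_mult_euclidean[OF mult.IH])
    then show ?case
      by (rule continuous_map_eq)
         (use X topP mult A in \<open>auto simp: characters_def\<close>)
  next
    case (scale a c)
    have "continuous_map ?P euclidean (\<lambda>\<phi>. c * \<phi> a)"
      by (rule continuous_map_mult_euclidean[OF _ scale.IH]) simp
    then show ?case
      by (rule continuous_map_eq)
         (use X topP scale A in \<open>auto simp: characters_def linear_functional_def\<close>)
  qed
  have "continuous_map ?P ?T id"
    unfolding character_topology_def
    by (rule continuous_map_into_subtopology)
       (use evP ext topP in \<open>auto simp: continuous_map_componentwise id_def\<close>)
  moreover have "continuous_map ?T ?P id"
    by (rule continuous_map_pullback')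
       (use evT GA topT in \<open>auto simp: continuous_map_componentwise\<close>)
  ultimately show ?thesis
    using topology_finer_continuous_id topP topT by (metis topology_eq)
qed


section \<open>Polynomials in $z_1, z_2$ and their conjugates\<close>

datatype var = Z1 | Z2 | Z1_bar | Z2_bar

primrec conj_var :: "var \<Rightarrow> var" where
  "conj_var Z1 = Z1_bar"
| "conj_var Z2 = Z2_bar"
| "conj_var Z1_bar = Z1"
| "conj_var Z2_bar = Z2"

text \<open>The (immaterial) order on the variables only serves to make the polynomials an \<open>idom\<close>.\<close>

primrec var_index :: "var \<Rightarrow> nat" where
  "var_index Z1 = 0"
| "var_index Z2 = 1"
| "var_index Z1_bar = 2"
| "var_index Z2_bar = 3"

lemma var_index_inject [simp]: "var_index v = var_index w \<longleftrightarrow> v = w"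
  by (cases v; cases w) auto

instantiation var :: linorder
begin

definition less_eq_var :: "var \<Rightarrow> var \<Rightarrow> bool" where
  "v \<le> w \<longleftrightarrow> var_index v \<le> var_index w"

definition less_var :: "var \<Rightarrow> var \<Rightarrow> bool" where
  "v < w \<longleftrightarrow> var_index v < var_index w"

instance
  by standard (auto simp: less_eq_var_def less_var_def)

end

lemma conj_var_conj_var [simp]: "conj_var (conj_var v) = v"
  by (cases v) auto

lemma inj_conj_var [simp]: "inj conj_var"
  by (metis conj_var_conj_var injI)

type_synonym mono = "var \<Rightarrow>\<^sub>0 nat"
type_synonym cpoly = "mono \<Rightarrow>\<^sub>0 complex"

definition pconst :: "complex \<Rightarrow> cpoly" where
  "pconst c = Poly_Mapping.single 0 c"

definition pvar :: "var \<Rightarrow> cpoly" where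
  "pvar v = Poly_Mapping.single (Poly_Mapping.single v 1) 1"

definition mono_star :: "mono \<Rightarrow> mono" where
  "mono_star = Poly_Mapping.map_key conj_var"

text \<open>The coefficient of \<open>m\<close> in \<open>pstar p\<close> is the conjugate of that of \<open>mono_star m\<close> in \<open>p\<close>.\<close>

definition pstar :: "cpoly \<Rightarrow> cpoly" where
  "pstar p = Poly_Mapping.map cnj (Poly_Mapping.map_key mono_star p)"

definition poly_vars :: "cpoly \<Rightarrow> var set" where
  "poly_vars p = (\<Union>m\<in>Poly_Mapping.keys p. Poly_Mapping.keys m)"

definition total_degree :: "cpoly \<Rightarrow> nat" where
  "total_degree p =
     Max (insert 0 ((\<lambda>m. \<Sum>v\<in>Poly_Mapping.keys m. Poly_Mapping.lookup m v) ` Poly_Mapping.keys p))"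

definition linear_poly :: "cpoly \<Rightarrow> bool" where
  "linear_poly f \<longleftrightarrow> poly_vars f \<subseteq> {Z1, Z2} \<and> total_degree f = 1"

lemma mono_star_mono_star [simp]: "mono_star (mono_star m) = m"
  by (rule poly_mapping_eqI) (simp add: mono_star_def map_key.rep_eq)

lemma inj_mono_star [simp]: "inj mono_star"
  by (metis mono_star_mono_star injI)

lemma mono_star_add: "mono_star (m + n) = mono_star m + mono_star n"
  by (simp add: mono_star_def map_key_plus)

lemma mono_star_zero [simp]: "mono_star 0 = 0"
  by (simp add: mono_star_def)

lemma lookup_pstar: "Poly_Mapping.lookup (pstar p) m = cnj (Poly_Mapping.lookup p (mono_star m))"
  by (simp add: pstar_def map.rep_eq map_key.rep_eq when_def)

lemma pstar_pstar [simp]: "pstar (pstar p) = p"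
  by (rule poly_mapping_eqI) (simp add: lookup_pstar)

lemma pstar_zero [simp]: "pstar 0 = 0"
  by (rule poly_mapping_eqI) (simp add: lookup_pstar)

lemma pstar_eq_0_iff [simp]: "pstar p = 0 \<longleftrightarrow> p = 0"
  by (metis pstar_pstar pstar_zero)

lemma pstar_add: "pstar (p + q) = pstar p + pstar q"
  by (rule poly_mapping_eqI) (simp add: lookup_pstar lookup_add)

lemma pstar_single: "pstar (Poly_Mapping.single m c) = Poly_Mapping.single (mono_star m) (cnj c)"
  using map_key_single[OF inj_mono_star, of "mono_star m" c] by (simp add: pstar_def)

lemma pstar_pconst [simp]: "pstar (pconst c) = pconst (cnj c)"
  by (simp add: pconst_def pstar_single)

lemma pstar_pvar [simp]: "pstar (pvar v) = pvar (conj_var v)"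
proof -
  have "mono_star (Poly_Mapping.single v 1) = Poly_Mapping.single (conj_var v) 1"
    using map_key_single[OF inj_conj_var, of "conj_var v" "1 :: nat"]
    by (simp only: mono_star_def conj_var_conj_var)
  then show ?thesis by (simp add: pvar_def pstar_single)
qed

lemma cpoly_induct [case_names zero add_single]:
  assumes "P 0" "\<And>m c p. P p \<Longrightarrow> P (Poly_Mapping.single m c + p)"
  shows "P (p :: cpoly)"
proof (induction p rule: update_induct)
  case const
  then show ?case using assms(1) by simp
next
  case (update p m c)
  have "Poly_Mapping.update m c p = Poly_Mapping.single m c + p"
    using update.hyps
    by (intro poly_mapping_eqI)
       (auto simp add: lookup_update lookup_add lookup_single when_def in_keys_iff split: if_splits)
  then show ?case using assms(2)[OF update.IH] by simp
qed

lemma pstar_mult: "pstar (p * q) = pstar p * pstar q"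
proof (induction p rule: cpoly_induct)
  case zero
  show ?case by simp
next
  case (add_single m c p)
  have "pstar (Poly_Mapping.single m c * q) = pstar (Poly_Mapping.single m c) * pstar q"
  proof (induction q rule: cpoly_induct)
    case zero
    show ?case by simp
  next
    case (add_single n d q)
    then show ?case
      by (simp add: distrib_left pstar_add mult_single pstar_single mono_star_add)
  qed
  with add_single show ?case by (simp add: distrib_right pstar_add)
qed

lemma pstar_one [simp]: "pstar 1 = 1"
  using pstar_pconst[of 1] by (simp add: pconst_def)


section \<open>The field of fractions and the algebra $A$\<close>

type_synonym crat = "cpoly fract"

definition rat_of_poly :: "cpoly \<Rightarrow> crat" where
  "rat_of_poly p = Fract p 1"

definition crat_scale :: "complex \<Rightarrow> crat \<Rightarrow> crat" where
  "crat_scale c q = rat_of_poly (pconst c) * q"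

lift_definition crat_star :: "crat \<Rightarrow> crat" is "map_prod pstar pstar"
  by (auto simp flip: pstar_mult)

lemma crat_star_Fract: "crat_star (Fract p q) = Fract (pstar p) (pstar q)"
  by transfer auto

lemma crat_star_crat_star [simp]: "crat_star (crat_star q) = q"
  by (cases q) (simp add: crat_star_Fract)

lemma crat_star_add: "crat_star (a + b) = crat_star a + crat_star b"
  by (cases a; cases b) (simp add: crat_star_Fract pstar_add pstar_mult)

lemma crat_star_mult: "crat_star (a * b) = crat_star a * crat_star b"
  by (cases a; cases b) (simp add: crat_star_Fract pstar_mult)

lemma crat_star_rat_of_poly [simp]: "crat_star (rat_of_poly p) = rat_of_poly (pstar p)"
  by (simp add: rat_of_poly_def crat_star_Fract)

lemma crat_star_inverse [simp]: "crat_star (inverse q) = inverse (crat_star q)"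
  by (cases q) (simp add: crat_star_Fract)

lemma crat_star_scale: "crat_star (crat_scale c q) = crat_scale (cnj c) (crat_star q)"
  by (simp add: crat_scale_def crat_star_mult)

definition localized_algebra :: "cpoly \<Rightarrow> cpoly \<Rightarrow> cpoly \<Rightarrow> crat set" where
  "localized_algebra f1 f2 f3 =
     generated_algebra crat_scale
       (rat_of_poly ` {pvar Z1, pvar Z2, pvar Z1_bar, pvar Z2_bar} \<union>
        (\<lambda>f. inverse (rat_of_poly f)) ` {f1, f2, f3, pstar f1, pstar f2, pstar f3})"

definition hermitean_part :: "crat set \<Rightarrow> crat set" where
  "hermitean_part A = {a \<in> A. crat_star a = a}"

lemma crat_star_localized_algebra:
  assumes "a \<in> localized_algebra f1 f2 f3"
  shows "crat_star a \<in> localized_algebra f1 f2 f3"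
  using assms unfolding localized_algebra_def
proof (induction rule: generated_algebra.induct)
  case one
  then show ?case
    by (simp add: One_fract_def crat_star_Fract) (simp flip: One_fract_def add: generated_algebra.one)
next
  case (gen g)
  then show ?case by (auto intro!: generated_algebra.gen)
qed (auto simp: crat_star_add crat_star_mult crat_star_scale
       intro: generated_algebra.add generated_algebra.mult generated_algebra.scale)

end

theory Submission
  imports Defs "HOL-Library.Function_Algebras"
begin

text \<open>
  There is a real affine plane in \<open>\<complex>\<^sup>2\<close> on which \<open>f1\<close>, \<open>f2\<close>, \<open>f3\<close> are complex multiples of
  real affine functions \<open>1 + a x + b y\<close>: any two independent ones can serve as coordinates of
  \<open>\<complex>\<^sup>2\<close>, and after rescaling the coefficients of the third are real. Evaluation on this plane maps
  \<open>A\<close> to the polynomials in \<open>x, y\<close> with the inverses of real affine functions adjoined.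

  The Motzkin polynomial in \<open>x, y\<close> is nonnegative on all characters, so it suffices to find a positive
  functional that is negative on it. Half the sum over the points \<open>(\<plusminus>1, \<plusminus>1)\<close> minus the value at the
  origin is negative on it, but positive only on squares from the span of \<open>1\<close>, \<open>x\<^sup>2 y\<close>,
  \<open>x y\<^sup>2\<close>, \<open>x y\<close>. All the rational functions are exhausted by a sequence extending these four in which
  each function is, at suitable points going to infinity or to one of the lines, much larger
  than all its predecessors. Adding successively one small point mass at such a point
  makes the functional positive on all squares, and the total contribution to the Motzkin
  polynomial is as small as desired. No cancellation is possible because the boundary divisors
  (the lines and the line at infinity) have dense real points.
\<close>

section \<open>Dominating functions and point masses\<close>

text \<open>The functional is written down explicitly instead of being separated from the cone of
  squares by a closedness argument. It is integration against a signed measure whose only negative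
  mass sits at the origin, and it makes sense on \<open>A\<close> only because the weights are
  chosen so small that every function of the algebra is summable. Two requirements shape the plane.
  The corners and the origin must be regular points of all functions, so the lines have to miss the
  square \<open>[-1,1]^2\<close>; the scale of the coordinates achieves this. And \<open>x\<close>,
  \<open>y\<close> must be restrictions of hermitean polynomials on the whole of complex two-space:
  these are real at every character, so the Motzkin element is nonnegative at all characters,
  although the functional sees only the plane. The starting functional has the value
  \<open>-1\<close> on the Motzkin polynomial; the added masses contribute at most
  \<open>1/2\<close>, because the polynomial is bounded by the squares of the first three functions
  of the sequence. One functional serves both algebras: its real part is used on the hermitean
  part.\<close>

interpretation fn: vector_space "\<lambda>(c::real) (f :: 'p \<Rightarrow> real) p. c * f p"
  by unfold_locales (auto simp: algebra_simps)

lemma span_mult_closed: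
  assumes "f \<in> fn.span S" "g \<in> fn.span T"
    and ST: "\<And>s t. s \<in> S \<Longrightarrow> t \<in> T \<Longrightarrow> s * t \<in> fn.span U"
  shows "f * g \<in> fn.span U"
  using assms(1)
proof (induction rule: fn.span_induct_alt)
  case base
  show ?case by (metis fn.span_zero mult_zero_left)
next
  case (step c s f)
  have "s * g \<in> fn.span U"
    using assms(2)
  proof (induction rule: fn.span_induct_alt)
    case base
    show ?case by (metis fn.span_zero mult_zero_right)
  next
    case (step d t g)
    have "s * ((\<lambda>p. d * t p) + g) = (\<lambda>p. d * (s * t) p) + s * g"
      by (auto simp: fun_eq_iff algebra_simps)
    then show ?case
      using step ST \<open>s \<in> S\<close> by (metis fn.span_add fn.span_scale)
  qed
  moreover have "((\<lambda>p. c * s p) + f) * g = (\<lambda>p. c * (s * g) p) + f * g"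
    by (auto simp: fun_eq_iff algebra_simps)
  ultimately show ?case
    using step by (metis fn.span_add fn.span_scale)
qed

lemma span_Un_cong:
  assumes "fn.span A = fn.span B"
  shows "fn.span (A \<union> C) = fn.span (B \<union> C)"
  using assms by (simp add: fn.span_Un)

text \<open>The coefficients are continued by zero, so a single sequence \<open>c\<close> serves all
  large \<open>n\<close>. The number of terms can then be matched to any stage of the
  construction.\<close>

lemma span_range_sum:
  assumes "g \<in> fn.span (range (e :: nat \<Rightarrow> 'p \<Rightarrow> real))"
  shows "\<exists>N c. \<forall>n\<ge>N. \<forall>p. g p = (\<Sum>i<n. c i * e i p)"
  using assms
proof (induction rule: fn.span_induct_alt)
  case base
  show ?case by (rule exI[of _ 0], rule exI[of _ "\<lambda>_. 0"]) simp
next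
  case (step a f g)
  then obtain k where k: "f = e k" by auto
  from step obtain N c where Nc: "\<forall>n\<ge>N. \<forall>p. g p = (\<Sum>i<n. c i * e i p)" by blast
  have "((\<lambda>p. a * f p) + g) p = (\<Sum>i<n. (c i + (if i = k then a else 0)) * e i p)"
    if "n \<ge> max N (Suc k)" for n p
  proof -
    have "(\<Sum>i<n. (c i + (if i = k then a else 0)) * e i p)
        = (\<Sum>i<n. c i * e i p + (if i = k then a * e i p else 0))"
      by (intro sum.cong) (auto simp: algebra_simps)
    also have "\<dots> = (\<Sum>i<n. c i * e i p) + a * e k p"
      using that by (simp add: sum.distrib)
    finally show ?thesis using that Nc k by simp
  qed
  then show ?case
    by (intro exI[of _ "max N (Suc k)"] exI[of _ "\<lambda>i. c i + (if i = k then a else 0)"]) blast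
qed

text \<open>One filter serves all of \<open>S\<close>, so finitely many functions can be made small
  relative to \<open>e\<close> at a single point. Filters cover curves to infinity and curves to a
  line alike.\<close>

definition dominates :: "'p set \<Rightarrow> ('p \<Rightarrow> real) \<Rightarrow> ('p \<Rightarrow> real) set \<Rightarrow> bool" where
  "dominates X e S \<longleftrightarrow> (\<exists>F. F \<noteq> bot \<and> (\<forall>\<^sub>F p in F. p \<in> X \<and> e p \<noteq> 0) \<and>
     (\<forall>f\<in>S. ((\<lambda>p. f p / e p) \<longlongrightarrow> 0) F))"

text \<open>Lets the earlier members of a sequence be replaced by monomials with the same span,
  whose growth along a curve is explicit.\<close>

lemma dominates_span:
  assumes "dominates X e S" "T \<subseteq> fn.span S"
  shows "dominates X e T"
proof -
  from assms(1) obtain F where F: "F \<noteq> bot" "\<forall>\<^sub>F p in F. p \<in> X \<and> e p \<noteq> 0"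
    "\<And>f. f \<in> S \<Longrightarrow> ((\<lambda>p. f p / e p) \<longlongrightarrow> 0) F"
    unfolding dominates_def by blast
  have "((\<lambda>p. f p / e p) \<longlongrightarrow> 0) F" if "f \<in> fn.span S" for f
    using that
  proof (induction rule: fn.span_induct_alt)
    case base
    show ?case by simp
  next
    case (step c f g)
    have "((\<lambda>p. c * (f p / e p) + g p / e p) \<longlongrightarrow> c * 0 + 0) F"
      by (intro tendsto_intros F step)
    then show ?case by (simp add: add_divide_distrib)
  qed
  then show ?thesis using F assms(2) unfolding dominates_def by blast
qed

lemma dominates_point:
  assumes "dominates X e S" "finite S" "\<delta> > 0"
  obtains p where "p \<in> X" "e p \<noteq> 0" "\<And>f. f \<in> S \<Longrightarrow> \<bar>f p\<bar> \<le> \<delta> * \<bar>e p\<bar>"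
proof -
  from assms(1) obtain F where F: "F \<noteq> bot" "\<forall>\<^sub>F p in F. p \<in> X \<and> e p \<noteq> 0"
    "\<And>f. f \<in> S \<Longrightarrow> ((\<lambda>p. f p / e p) \<longlongrightarrow> 0) F"
    unfolding dominates_def by blast
  have "\<forall>f\<in>S. \<forall>\<^sub>F p in F. \<bar>f p / e p\<bar> < \<delta>"
    using F(3) \<open>\<delta> > 0\<close> by (auto simp: tendsto_iff)
  then have "\<forall>\<^sub>F p in F. \<forall>f\<in>S. \<bar>f p / e p\<bar> < \<delta>"
    using \<open>finite S\<close> by (simp add: eventually_ball_finite_distrib)
  with F(2) have "\<forall>\<^sub>F p in F. (p \<in> X \<and> e p \<noteq> 0) \<and> (\<forall>f\<in>S. \<bar>f p / e p\<bar> < \<delta>)"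
    by (rule eventually_conj)
  then obtain p where p: "p \<in> X" "e p \<noteq> 0" "\<forall>f\<in>S. \<bar>f p / e p\<bar> < \<delta>"
    using F(1) eventually_happens by blast
  then have "\<bar>f p\<bar> \<le> \<delta> * \<bar>e p\<bar>" if "f \<in> S" for f
    using that by (auto simp: abs_divide divide_less_eq intro: less_imp_le)
  with p that show ?thesis by blast
qed

section \<open>Making a functional positive by adding point masses\<close>

definition fn_linear :: "(('p \<Rightarrow> real) \<Rightarrow> real) \<Rightarrow> bool" where
  "fn_linear \<Lambda> \<longleftrightarrow> (\<forall>f g. \<Lambda> (\<lambda>p. f p + g p) = \<Lambda> f + \<Lambda> g) \<and> (\<forall>c f. \<Lambda> (\<lambda>p. c * f p) = c * \<Lambda> f)"

lemma fn_linear_sum: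
  assumes "fn_linear \<Lambda>"
  shows "\<Lambda> (\<lambda>p. \<Sum>i<(n::nat). c i * f i p) = (\<Sum>i<n. c i * \<Lambda> (f i))"
proof (induction n)
  case 0
  have "\<Lambda> (\<lambda>p. c * f p) = c * \<Lambda> f" for c f using assms unfolding fn_linear_def by blast
  from this[of 0 "\<lambda>_. 0"] show ?case by simp
next
  case (Suc n)
  then show ?case using assms by (simp add: fn_linear_def)
qed

text \<open>Where \<open>e n\<close> dominates, a point mass can be so heavy on \<open>e n\<close> that it outweighs all the
  mixed terms, and at the same time so light on the earlier functions that it hardly affects them.\<close>

lemma extend_positive:
  fixes \<Lambda> :: "('p \<Rightarrow> real) \<Rightarrow> real" and e :: "nat \<Rightarrow> 'p \<Rightarrow> real"
  assumes lin: "fn_linear \<Lambda>"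
    and pos: "\<And>c. \<Lambda> (\<lambda>p. (\<Sum>i<n. c i * e i p)\<^sup>2) \<ge> \<kappa> * (\<Sum>i<n. (c i)\<^sup>2)" and \<kappa>: "\<kappa> > 0"
    and dom: "dominates X (e n) (e ` {..<n})" and \<epsilon>: "\<epsilon> > 0"
  shows "\<exists>p\<in>X. \<exists>w\<ge>0. \<exists>\<kappa>'>0. (\<forall>i<n. w * (e i p)\<^sup>2 \<le> \<epsilon>) \<and>
    (\<forall>c. \<Lambda> (\<lambda>p. (\<Sum>i<Suc n. c i * e i p)\<^sup>2) + w * (\<Sum>i<Suc n. c i * e i p)\<^sup>2
       \<ge> \<kappa>' * (\<Sum>i<Suc n. (c i)\<^sup>2))"
proof -
  define b where "b i = \<Lambda> (\<lambda>p. e i p * e n p)" for i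
  \<comment> \<open>\<open>B\<close> bounds what the terms with \<open>e n\<close> can cost per unit
    of \<open>(c n)^2\<close>. \<open>K\<close> is the value \<open>w * (e n p)^2\<close> of the new
    mass; half of it survives the cross terms at \<open>p\<close>, which pays for \<open>B\<close>
    and leaves \<open>\<kappa>\<close>.\<close>
  define B where "B = 2 / \<kappa> * (\<Sum>i<n. (b i)\<^sup>2) + \<bar>b n\<bar>"
  define K where "K = 2 * (B + \<kappa>)"
  have "B \<ge> 0" using \<kappa> by (auto simp: B_def sum_nonneg)
  then have K: "K > 0" using \<kappa> by (simp add: K_def)
  \<comment> \<open>\<open>\<mu>\<close> bounds the squared ratios of the earlier functions to
    \<open>e n\<close> at \<open>p\<close>. The first bound limits their joint effect to
    \<open>\<kappa> / 4\<close>, the second limits each one to \<open>\<epsilon>\<close>.\<close>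
  define \<mu> where "\<mu> = min (\<kappa> / (4 * (real n + 1) * K)) (\<epsilon> / K)"
  have \<mu>: "\<mu> > 0" using \<kappa> K \<epsilon> by (simp add: \<mu>_def)
  have \<mu>1: "K * \<mu> \<le> \<epsilon>"
    using K by (simp add: \<mu>_def min_def field_simps)
  have "\<mu> \<le> \<kappa> / (4 * (real n + 1) * K)" by (simp add: \<mu>_def)
  then have "\<mu> * (4 * (real n + 1) * K) \<le> \<kappa>"
    using K by (simp add: pos_le_divide_eq)
  moreover have "0 \<le> K * \<mu>" using K \<mu> by simp
  ultimately have \<mu>2: "K * \<mu> * real n \<le> \<kappa> / 4"
    by (simp add: algebra_simps)
  obtain p where p: "p \<in> X" "e n p \<noteq> 0" "\<And>i. i < n \<Longrightarrow> \<bar>e i p\<bar> \<le> sqrt \<mu> * \<bar>e n p\<bar>"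
    using dominates_point[OF dom _ , of "sqrt \<mu>"] \<mu> by (metis finite_imageI finite_lessThan
        image_eqI lessThan_iff real_sqrt_gt_zero)
  define w where "w = K / (e n p)\<^sup>2"
  have w: "w \<ge> 0" using K by (simp add: w_def)
  have sq: "(e i p)\<^sup>2 \<le> \<mu> * (e n p)\<^sup>2" if "i < n" for i
  proof -
    have "\<bar>e i p\<bar>\<^sup>2 \<le> (sqrt \<mu> * \<bar>e n p\<bar>)\<^sup>2"
      using p(3)[OF that] by (intro power_mono) auto
    then show ?thesis using \<mu> by (simp add: power_mult_distrib)
  qed
  have small: "w * (e i p)\<^sup>2 \<le> K * \<mu>" if "i < n" for i
    using mult_left_mono[OF sq[OF that] w] p(2) by (simp add: w_def)
  have main: "\<Lambda> (\<lambda>p. (\<Sum>i<Suc n. c i * e i p)\<^sup>2) + w * (\<Sum>i<Suc n. c i * e i p)\<^sup>2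
       \<ge> \<kappa> / 4 * (\<Sum>i<Suc n. (c i)\<^sup>2)" for c
  proof -
    define v where "v q = (\<Sum>i<n. c i * e i q)" for q
    define s where "s = (\<Sum>i<n. (c i)\<^sup>2)"
    have s: "s \<ge> 0" by (simp add: s_def sum_nonneg)
    have mixed: "v q * e n q = (\<Sum>i<n. c i * (e i q * e n q))" for q
      by (simp add: v_def sum_distrib_right mult.assoc)
    have "\<Lambda> (\<lambda>p. (\<Sum>i<Suc n. c i * e i p)\<^sup>2)
      = \<Lambda> (\<lambda>p. ((v p)\<^sup>2 + (2 * c n) * (\<Sum>i<n. c i * (e i p * e n p))) + (c n)\<^sup>2 * (e n p * e n p))"
      by (rule arg_cong[of _ _ \<Lambda>])
         (simp add: fun_eq_iff power2_eq_square algebra_simps flip: v_def mixed)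
    also have "\<dots> = \<Lambda> (\<lambda>p. (v p)\<^sup>2) + 2 * c n * (\<Sum>i<n. c i * b i) + (c n)\<^sup>2 * b n"
      using lin fn_linear_sum[OF lin, of c "\<lambda>i p. e i p * e n p"] by (simp add: fn_linear_def b_def)
    finally have eq: "\<Lambda> (\<lambda>p. (\<Sum>i<Suc n. c i * e i p)\<^sup>2)
      = \<Lambda> (\<lambda>p. (v p)\<^sup>2) + (\<Sum>i<n. 2 * c n * c i * b i) + (c n)\<^sup>2 * b n"
      by (simp add: sum_distrib_left mult.assoc)
    have "(\<Sum>i<n. 2 * c n * c i * b i) \<ge> (\<Sum>i<n. - (\<kappa> / 2 * (c i)\<^sup>2) - 2 / \<kappa> * (c n)\<^sup>2 * (b i)\<^sup>2)"
    proof (rule sum_mono)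
      fix i
      \<comment> \<open>Completing the square charges half of \<open>\<kappa>\<close> to
        \<open>c i\<close> and the rest to \<open>c n\<close>, where it becomes the first part of
        \<open>B\<close>.\<close>
      have "0 \<le> \<kappa> / 2 * (c i + 2 / \<kappa> * (c n * b i))\<^sup>2" using \<kappa> by simp
      also have "\<dots> = \<kappa> / 2 * (c i)\<^sup>2 + 2 * c n * c i * b i + 2 / \<kappa> * (c n)\<^sup>2 * (b i)\<^sup>2"
        using \<kappa> by (simp add: power2_eq_square field_simps)
      finally show "- (\<kappa> / 2 * (c i)\<^sup>2) - 2 / \<kappa> * (c n)\<^sup>2 * (b i)\<^sup>2 \<le> 2 * c n * c i * b i" by simp
    qed
    also have "(\<Sum>i<n. - (\<kappa> / 2 * (c i)\<^sup>2) - 2 / \<kappa> * (c n)\<^sup>2 * (b i)\<^sup>2)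
      = - (\<kappa> / 2 * s) - (c n)\<^sup>2 * (2 / \<kappa> * (\<Sum>i<n. (b i)\<^sup>2))"
      by (simp add: s_def sum_subtractf sum_negf sum_distrib_left algebra_simps)
    finally have cross: "- (\<kappa> / 2 * s) - (c n)\<^sup>2 * (2 / \<kappa> * (\<Sum>i<n. (b i)\<^sup>2)) \<le> (\<Sum>i<n. 2 * c n * c i * b i)" .
    have "(c n)\<^sup>2 * b n \<ge> - ((c n)\<^sup>2 * \<bar>b n\<bar>)"
      using mult_left_mono[of "- \<bar>b n\<bar>" "b n" "(c n)\<^sup>2"] by simp
    with cross eq pos[of c] have 1: "\<Lambda> (\<lambda>p. (\<Sum>i<Suc n. c i * e i p)\<^sup>2) \<ge> \<kappa> / 2 * s - (c n)\<^sup>2 * B"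
      by (simp add: v_def s_def B_def algebra_simps)
    have "(v p)\<^sup>2 \<le> s * (\<Sum>i<n. (e i p)\<^sup>2)"
      unfolding v_def s_def by (rule Cauchy_Schwarz_ineq_sum)
    then have "w * (v p)\<^sup>2 \<le> w * (s * (\<Sum>i<n. (e i p)\<^sup>2))"
      using w by (rule mult_left_mono)
    also have "\<dots> = s * (\<Sum>i<n. w * (e i p)\<^sup>2)" by (simp add: sum_distrib_left algebra_simps)
    also have "\<dots> \<le> s * (\<Sum>i<n. K * \<mu>)"
      using small s by (intro mult_left_mono sum_mono) auto
    also have "\<dots> \<le> s * (\<kappa> / 4)" using \<mu>2 s by (intro mult_left_mono) (auto simp: algebra_simps)
    finally have 2: "w * (v p)\<^sup>2 \<le> s * (\<kappa> / 4)" .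
    \<comment> \<open>With \<open>u = c n * e n p\<close>, half of this square is
      \<open>(v + u)^2 - u^2 / 2 + v^2\<close>: half of the new square survives at the price of
      \<open>v^2\<close>.\<close>
    have "0 \<le> (2 * v p + c n * e n p)\<^sup>2" by simp
    then have "(v p + c n * e n p)\<^sup>2 \<ge> (c n * e n p)\<^sup>2 / 2 - (v p)\<^sup>2"
      by (simp add: power2_eq_square algebra_simps)
    from mult_left_mono[OF this w] have "w * (v p + c n * e n p)\<^sup>2 \<ge> (c n)\<^sup>2 * (w * (e n p)\<^sup>2) / 2 - w * (v p)\<^sup>2"
      by (simp add: power_mult_distrib algebra_simps)
    moreover have "w * (e n p)\<^sup>2 = K" using p by (simp add: w_def)
    ultimately have 3: "w * (v p + c n * e n p)\<^sup>2 \<ge> (c n)\<^sup>2 * (B + \<kappa>) - s * (\<kappa> / 4)"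
      using 2 by (auto simp: K_def algebra_simps)
    have "(c n)\<^sup>2 * \<kappa> \<ge> (c n)\<^sup>2 * (\<kappa> / 4)" using \<kappa> by (intro mult_left_mono) auto
    with 1 3 have "\<Lambda> (\<lambda>p. (\<Sum>i<Suc n. c i * e i p)\<^sup>2) + w * (v p + c n * e n p)\<^sup>2 \<ge> \<kappa> / 4 * (s + (c n)\<^sup>2)"
      by (simp add: algebra_simps)
    then show ?thesis by (simp add: v_def s_def)
  qed
  have "\<forall>i<n. w * (e i p)\<^sup>2 \<le> \<epsilon>" using small \<mu>1 by force
  with main \<kappa> w p(1) show ?thesis
    by (intro bexI[of _ p] exI[of _ w] exI[of _ "\<kappa> / 4"] conjI) auto
qed

text \<open>The recursion carries a strict lower bound, because each step spends part of it on the
  mixed terms. The bounds may tend to zero, so only nonnegativity remains in the end. The factor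
  \<open>2 ^ n\<close> makes the masses summable against every fixed \<open>(e i)^2\<close>.\<close>

lemma positive_point_masses:
  fixes \<Lambda> :: "('p \<Rightarrow> real) \<Rightarrow> real" and e :: "nat \<Rightarrow> 'p \<Rightarrow> real"
  assumes lin: "fn_linear \<Lambda>"
    and pos: "\<And>c. \<Lambda> (\<lambda>p. (\<Sum>i<m. c i * e i p)\<^sup>2) \<ge> \<kappa> * (\<Sum>i<m. (c i)\<^sup>2)" and \<kappa>: "\<kappa> > 0"
    and dom: "\<And>n. n \<ge> m \<Longrightarrow> dominates X (e n) (e ` {..<n})" and \<epsilon>: "\<epsilon> > 0"
  obtains p w where "\<And>n. p n \<in> X" "\<And>n. w n \<ge> 0"
    "\<And>n i. i < m + n \<Longrightarrow> w n * (e i (p n))\<^sup>2 \<le> \<epsilon> / 2 ^ n"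
    "\<And>N c. \<Lambda> (\<lambda>x. (\<Sum>i<m+N. c i * e i x)\<^sup>2) + (\<Sum>k<N. w k * (\<Sum>i<m+N. c i * e i (p k))\<^sup>2) \<ge> 0"
proof -
  \<comment> \<open>The state is a functional together with its current positivity constant. The new
    point and weight are recorded only in the relation \<open>R\<close> and are recovered from it by
    choice afterwards.\<close>
  define P where "P n x \<longleftrightarrow> fn_linear (fst x) \<and> snd x > 0 \<and> (n = 0 \<longrightarrow> fst x = \<Lambda>) \<and>
     (\<forall>c. fst x (\<lambda>p. (\<Sum>i<m+n. c i * e i p)\<^sup>2) \<ge> snd x * (\<Sum>i<m+n. (c i)\<^sup>2))"
    for n and x :: "(('p \<Rightarrow> real) \<Rightarrow> real) \<times> real"
  define R where "R n x y \<longleftrightarrow> (\<exists>p\<in>X. \<exists>w\<ge>0. fst y = (\<lambda>f. fst x f + w * f p) \<and>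
     (\<forall>i<m+n. w * (e i p)\<^sup>2 \<le> \<epsilon> / 2 ^ n))"
    for n and x y :: "(('p \<Rightarrow> real) \<Rightarrow> real) \<times> real"
  have "\<exists>f. \<forall>n. P n (f n) \<and> R n (f n) (f (Suc n))"
  proof (rule dependent_nat_choice)
    show "\<exists>x. P 0 x" using lin pos \<kappa> by (intro exI[of _ "(\<Lambda>, \<kappa>)"]) (auto simp: P_def)
  next
    fix x n assume "P n x"
    then have x: "fn_linear (fst x)" "snd x > 0"
      "\<And>c. fst x (\<lambda>p. (\<Sum>i<m+n. c i * e i p)\<^sup>2) \<ge> snd x * (\<Sum>i<m+n. (c i)\<^sup>2)"
      by (auto simp: P_def)
    have "\<epsilon> / 2 ^ n > 0" using \<epsilon> by simp
    from extend_positive[OF x(1) x(3) x(2) dom this]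
    obtain p w \<kappa>' where *: "p \<in> X" "w \<ge> 0" "\<kappa>' > 0" "\<forall>i<m+n. w * (e i p)\<^sup>2 \<le> \<epsilon> / 2 ^ n"
      "\<forall>c. fst x (\<lambda>p. (\<Sum>i<Suc (m+n). c i * e i p)\<^sup>2) + w * (\<Sum>i<Suc (m+n). c i * e i p)\<^sup>2
       \<ge> \<kappa>' * (\<Sum>i<Suc (m+n). (c i)\<^sup>2)" by auto
    have "fn_linear (\<lambda>f. fst x f + w * f p)"
      using x(1) by (simp add: fn_linear_def algebra_simps)
    then show "\<exists>y. P (Suc n) y \<and> R n x y"
      using * by (intro exI[of _ "(\<lambda>f. fst x f + w * f p, \<kappa>')"]) (auto simp: P_def R_def)
  qed
  then obtain f where f: "\<And>n. P n (f n)" "\<And>n. R n (f n) (f (Suc n))" by blast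
  have "\<forall>n. \<exists>pw. fst pw \<in> X \<and> snd pw \<ge> 0 \<and>
     fst (f (Suc n)) = (\<lambda>g. fst (f n) g + snd pw * g (fst pw)) \<and>
     (\<forall>i<m+n. snd pw * (e i (fst pw))\<^sup>2 \<le> \<epsilon> / 2 ^ n)"
  proof
    fix n
    from f(2)[of n] obtain p w where "p \<in> X" "w \<ge> 0"
      "fst (f (Suc n)) = (\<lambda>g. fst (f n) g + w * g p)" "\<forall>i<m+n. w * (e i p)\<^sup>2 \<le> \<epsilon> / 2 ^ n"
      unfolding R_def by (elim bexE exE conjE)
    then show "\<exists>pw. fst pw \<in> X \<and> snd pw \<ge> 0 \<and>
      fst (f (Suc n)) = (\<lambda>g. fst (f n) g + snd pw * g (fst pw)) \<and>
      (\<forall>i<m+n. snd pw * (e i (fst pw))\<^sup>2 \<le> \<epsilon> / 2 ^ n)"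
      by (intro exI[of _ "(p, w)"]) (simp only: fst_conv snd_conv simp_thms)
  qed
  from choice[OF this] obtain pw where pw: "\<And>n. fst (pw n) \<in> X" "\<And>n. snd (pw n) \<ge> 0"
    "\<And>n. fst (f (Suc n)) = (\<lambda>g. fst (f n) g + snd (pw n) * g (fst (pw n)))"
    "\<And>n i. i < m+n \<Longrightarrow> snd (pw n) * (e i (fst (pw n)))\<^sup>2 \<le> \<epsilon> / 2 ^ n" by blast
  have f0: "fst (f 0) = \<Lambda>" using f(1)[of 0] by (simp add: P_def)
  have fN: "fst (f N) = (\<lambda>g. \<Lambda> g + (\<Sum>k<N. snd (pw k) * g (fst (pw k))))" for N
    by (induction N) (auto simp: f0 pw(3) add.assoc)
  show thesis
  proof (rule that[of "fst \<circ> pw" "snd \<circ> pw"])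
    fix N c
    have "0 \<le> snd (f N) * (\<Sum>i<m+N. (c i)\<^sup>2)"
      using f(1)[of N] by (simp add: P_def sum_nonneg)
    also have "\<dots> \<le> fst (f N) (\<lambda>p. (\<Sum>i<m+N. c i * e i p)\<^sup>2)"
      using f(1)[of N] by (simp add: P_def)
    finally show "\<Lambda> (\<lambda>x. (\<Sum>i<m+N. c i * e i x)\<^sup>2) +
       (\<Sum>k<N. (snd \<circ> pw) k * (\<Sum>i<m+N. c i * e i ((fst \<circ> pw) k))\<^sup>2) \<ge> 0"
      by (simp add: fN)
  qed (use pw in auto)
qed

section \<open>Rational functions with poles on real lines\<close>

text \<open>The value \<open>0\<close> off \<open>X\<close> makes cancellations such as \<open>l / (q l) = 1 / q\<close>, valid where
  \<open>l\<close> does not vanish, into identities of functions.\<close>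

definition restricted_monomial ::
    "'p set \<Rightarrow> ('p \<Rightarrow> real) \<Rightarrow> ('p \<Rightarrow> real) \<Rightarrow> ('p \<Rightarrow> real) \<Rightarrow> nat \<Rightarrow> nat \<Rightarrow> 'p \<Rightarrow> real" where
  "restricted_monomial X u s q i j = (\<lambda>p. if p \<in> X then u p ^ i * s p ^ j / q p else 0)"

definition bounded_degree ::
    "'p set \<Rightarrow> ('p \<Rightarrow> real) \<Rightarrow> ('p \<Rightarrow> real) \<Rightarrow> ('p \<Rightarrow> real) \<Rightarrow> nat \<Rightarrow> ('p \<Rightarrow> real) set" where
  "bounded_degree X u s q d = fn.span {restricted_monomial X u s q i j | i j. i + j \<le> d}"

lemma restricted_monomial_in_bounded_degree:
  "i + j \<le> d \<Longrightarrow> restricted_monomial X u s q i j \<in> bounded_degree X u s q d"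
  unfolding bounded_degree_def by (rule fn.span_base) blast

lemma bounded_degree_mono:
  assumes "d \<le> d'"
  shows "bounded_degree X u s q d \<subseteq> bounded_degree X u s q d'"
  unfolding bounded_degree_def
proof (intro fn.span_mono subsetI)
  fix f assume "f \<in> {restricted_monomial X u s q i j | i j. i + j \<le> d}"
  then obtain i j where "f = restricted_monomial X u s q i j" "i + j \<le> d" by blast
  then show "f \<in> {restricted_monomial X u s q i j | i j. i + j \<le> d'}"
    using assms by (intro CollectI exI[of _ i] exI[of _ j]) simp
qed

lemma bounded_degree_mult_affine:
  assumes "f \<in> bounded_degree X u s q d" and r: "\<And>p. p \<in> X \<Longrightarrow> r p = \<alpha> + \<beta> * u p + \<gamma> * s p"
  shows "r * f \<in> bounded_degree X u s q (Suc d)"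
  using assms(1) unfolding bounded_degree_def[of X u s q d]
proof (induction rule: fn.span_induct_alt)
  case base
  show ?case unfolding bounded_degree_def mult_zero_right by (rule fn.span_zero)
next
  case (step c f g)
  then obtain i j where ij: "f = restricted_monomial X u s q i j" "i + j \<le> d" by auto
  let ?m = "restricted_monomial X u s q"
  have eq: "r * ((\<lambda>p. c * f p) + g) = ((\<lambda>p. (c * \<alpha>) * ?m i j p) + (\<lambda>p. (c * \<beta>) * ?m (Suc i) j p)
      + (\<lambda>p. (c * \<gamma>) * ?m i (Suc j) p)) + r * g"
  proof
    fix p
    show "(r * ((\<lambda>p. c * f p) + g)) p = (((\<lambda>p. (c * \<alpha>) * ?m i j p) + (\<lambda>p. (c * \<beta>) * ?m (Suc i) j p)
      + (\<lambda>p. (c * \<gamma>) * ?m i (Suc j) p)) + r * g) p"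
    proof (cases "p \<in> X")
      case True
      have m: "?m (Suc i) j p = u p * ?m i j p" "?m i (Suc j) p = s p * ?m i j p"
        using True by (simp_all add: restricted_monomial_def)
      have "(\<alpha> + \<beta> * U + \<gamma> * V) * (c * M + G)
        = c * \<alpha> * M + c * \<beta> * (U * M) + c * \<gamma> * (V * M) + (\<alpha> + \<beta> * U + \<gamma> * V) * G"
        for U V M G :: real by (simp add: algebra_simps)
      then show ?thesis
        unfolding ij(1) plus_fun_apply times_fun_apply m r[OF True] .
    next
      case False
      then show ?thesis by (simp add: ij(1) restricted_monomial_def)
    qed
  qed
  have "?m i j \<in> bounded_degree X u s q (Suc d)" "?m (Suc i) j \<in> bounded_degree X u s q (Suc d)"
    "?m i (Suc j) \<in> bounded_degree X u s q (Suc d)"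
    using ij(2) by (auto intro!: restricted_monomial_in_bounded_degree)
  with step.IH show ?case
    unfolding eq bounded_degree_def by (intro fn.span_add fn.span_scale)
qed

text \<open>Total degree cannot rise under an affine substitution. Applied to a substitution and to
  its inverse, this gives equality, which allows coordinates adapted to one line.\<close>

lemma bounded_degree_change_coordinates:
  assumes u': "\<And>p. p \<in> X \<Longrightarrow> u' p = \<alpha> + \<beta> * u p + \<gamma> * s p"
    and s': "\<And>p. p \<in> X \<Longrightarrow> s' p = \<alpha>' + \<beta>' * u p + \<gamma>' * s p"
  shows "bounded_degree X u' s' q d \<subseteq> bounded_degree X u s q d"
proof -
  have col: "restricted_monomial X u' s' q 0 j \<in> bounded_degree X u s q j" for j
  proof (induction j)
    case 0
    have "restricted_monomial X u' s' q 0 0 = restricted_monomial X u s q 0 0"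
      by (simp add: restricted_monomial_def fun_eq_iff)
    then show ?case by (simp add: restricted_monomial_in_bounded_degree)
  next
    case (Suc j)
    have "restricted_monomial X u' s' q 0 (Suc j) = s' * restricted_monomial X u' s' q 0 j"
      by (auto simp: restricted_monomial_def fun_eq_iff)
    with bounded_degree_mult_affine[OF Suc s'] show ?case by (simp only:)
  qed
  have "restricted_monomial X u' s' q i j \<in> bounded_degree X u s q (i + j)" for i j
  proof (induction i)
    case 0
    then show ?case using col by simp
  next
    case (Suc i)
    have "restricted_monomial X u' s' q (Suc i) j = u' * restricted_monomial X u' s' q i j"
      by (auto simp: restricted_monomial_def fun_eq_iff)
    with bounded_degree_mult_affine[OF Suc u'] show ?case by (simp only: add_Suc)
  qed
  then have "{restricted_monomial X u' s' q i j | i j. i + j \<le> d} \<subseteq> bounded_degree X u s q d"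
    using bounded_degree_mono by blast
  then show ?thesis
    unfolding bounded_degree_def[of X u' s' q d]
    by (rule fn.span_minimal) (simp add: bounded_degree_def fn.subspace_span)
qed

text \<open>Along the curve the common denominator cancels and a quotient of monomials is a power of
  \<open>t\<close>, so domination becomes a comparison of the weights
  \<open>i * a + j * b\<close>.\<close>

lemma dominates_monomials:
  fixes P :: "real \<Rightarrow> 'p"
  assumes P: "\<And>t. t > 0 \<Longrightarrow> u (P t) = t powr a" "\<And>t. t > 0 \<Longrightarrow> s (P t) = t powr b"
    and X: "\<forall>\<^sub>F t in at_top. P t \<in> X" and q: "\<And>p. p \<in> X \<Longrightarrow> q p \<noteq> 0"
    and T: "\<And>f. f \<in> T \<Longrightarrow> \<exists>i j. f = restricted_monomial X u s q i j \<and>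
      real i * a + real j * b < real k * a + real l * b"
  shows "dominates X (restricted_monomial X u s q k l) T"
proof -
  have pos: "\<forall>\<^sub>F t :: real in at_top. t > 0" by (rule eventually_gt_at_top)
  have "\<forall>\<^sub>F p in filtermap P at_top. p \<in> X \<and> restricted_monomial X u s q k l p \<noteq> 0"
    unfolding eventually_filtermap using X pos
    by eventually_elim (auto simp: restricted_monomial_def P q)
  moreover have "((\<lambda>p. f p / restricted_monomial X u s q k l p) \<longlongrightarrow> 0) (filtermap P at_top)"
    if f: "f \<in> T" for f
  proof -
    from T[OF f] obtain i j where ij: "f = restricted_monomial X u s q i j"
      "real i * a + real j * b < real k * a + real l * b" by blast
    define m where "m = real i * a + real j * b - (real k * a + real l * b)"
    have "((\<lambda>t::real. t powr m) \<longlongrightarrow> 0) at_top"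
      by (rule tendsto_neg_powr) (use ij in \<open>auto simp: m_def filterlim_ident\<close>)
    moreover have "\<forall>\<^sub>F t in at_top. t powr m = f (P t) / restricted_monomial X u s q k l (P t)"
      using X pos
    proof eventually_elim
      case (elim t)
      have "t powr m = (t powr (real i * a) * t powr (real j * b)) / (t powr (real k * a) * t powr (real l * b))"
        by (simp add: m_def powr_diff powr_add)
      then show ?case
        using elim by (simp add: ij restricted_monomial_def P q powr_powr mult.commute flip: powr_realpow)
    qed
    ultimately show ?thesis
      unfolding filterlim_filtermap by (rule Lim_transform_eventually)
  qed
  ultimately show ?thesis
    unfolding dominates_def
    by (intro exI[of _ "filtermap P at_top"]) (auto simp: filtermap_bot_iff)
qed

section \<open>Curves that leave finitely many lines\<close>

lemma eventually_powr_sum_nonzero: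
  fixes c :: "real \<Rightarrow> real"
  assumes "finite I" "m \<in> I" "c m \<noteq> 0"
  shows "\<forall>\<^sub>F t in at_top. (\<Sum>\<alpha>\<in>I. c \<alpha> * t powr \<alpha>) \<noteq> 0"
proof -
  define M where "M = Max {\<alpha> \<in> I. c \<alpha> \<noteq> 0}"
  have fin: "finite {\<alpha> \<in> I. c \<alpha> \<noteq> 0}" "{\<alpha> \<in> I. c \<alpha> \<noteq> 0} \<noteq> {}" using assms by auto
  have M: "M \<in> I" "c M \<noteq> 0" using Max_in[OF fin] by (auto simp: M_def)
  have le: "\<alpha> \<le> M" if "\<alpha> \<in> I" "c \<alpha> \<noteq> 0" for \<alpha>
    using that fin by (auto simp: M_def)
  have "((\<lambda>t. \<Sum>\<alpha>\<in>I. c \<alpha> * t powr (\<alpha> - M)) \<longlongrightarrow> (\<Sum>\<alpha>\<in>I. if \<alpha> = M then c \<alpha> else 0)) at_top"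
  proof (rule tendsto_sum)
    fix \<alpha> assume \<alpha>: "\<alpha> \<in> I"
    consider "\<alpha> = M" | "c \<alpha> = 0" | "\<alpha> < M" using le[OF \<alpha>] by force
    then show "((\<lambda>t. c \<alpha> * t powr (\<alpha> - M)) \<longlongrightarrow> (if \<alpha> = M then c \<alpha> else 0)) at_top"
    proof cases
      case 1
      have "\<forall>\<^sub>F t in at_top. c \<alpha> = c \<alpha> * t powr (\<alpha> - M)"
        using eventually_gt_at_top[of 0] by eventually_elim (simp add: 1)
      then show ?thesis using 1 by (auto intro: Lim_transform_eventually tendsto_const)
    next
      case 2
      then show ?thesis using M(2) by auto
    next
      case 3
      then have "((\<lambda>t::real. t powr (\<alpha> - M)) \<longlongrightarrow> 0) at_top"
        by (intro tendsto_neg_powr) (auto simp: filterlim_ident)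
      then show ?thesis using 3 by (auto intro: tendsto_mult_right_zero)
    qed
  qed
  then have "((\<lambda>t. \<Sum>\<alpha>\<in>I. c \<alpha> * t powr (\<alpha> - M)) \<longlongrightarrow> c M) at_top"
    using assms M by simp
  then have "\<forall>\<^sub>F t in at_top. (\<Sum>\<alpha>\<in>I. c \<alpha> * t powr (\<alpha> - M)) \<noteq> 0"
    using M(2) by (rule tendsto_imp_eventually_ne)
  then show ?thesis
    using eventually_gt_at_top[of 0]
  proof eventually_elim
    case (elim t)
    have "(\<Sum>\<alpha>\<in>I. c \<alpha> * t powr \<alpha>) = t powr M * (\<Sum>\<alpha>\<in>I. c \<alpha> * t powr (\<alpha> - M))"
      using elim by (simp add: sum_distrib_left powr_diff)
    then show ?case using elim by simp
  qed
qed

text \<open>An affine form along one of the curves used below is such a trinomial. Distinct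
  exponents exclude cancellation, so the curve eventually stays off every line.\<close>

lemma eventually_powr_trinomial_nonzero:
  fixes A B C :: real
  assumes "\<alpha> \<noteq> 0" "\<beta> \<noteq> 0" "\<alpha> \<noteq> \<beta>" "A \<noteq> 0 \<or> B \<noteq> 0 \<or> C \<noteq> 0"
  shows "\<forall>\<^sub>F t in at_top. A + B * t powr \<alpha> + C * t powr \<beta> \<noteq> 0"
proof -
  define c where "c x = (if x = 0 then A else if x = \<alpha> then B else C)" for x
  have "\<exists>m\<in>{0, \<alpha>, \<beta>}. c m \<noteq> 0" using assms by (auto simp: c_def)
  then obtain m where "m \<in> {0, \<alpha>, \<beta>}" "c m \<noteq> 0" by blast
  then have "\<forall>\<^sub>F t in at_top. (\<Sum>x\<in>{0, \<alpha>, \<beta>}. c x * t powr x) \<noteq> 0"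
    by (intro eventually_powr_sum_nonzero) auto
  then show ?thesis
    using eventually_gt_at_top[of 0]
    by eventually_elim (use assms in \<open>auto simp: c_def algebra_simps\<close>)
qed

text \<open>The constant term \<open>1\<close> keeps the origin, a point of evaluation, off every
  line. The pair \<open>(0, 0)\<close> would encode the constant \<open>1\<close> instead of a line;
  it is excluded by hypothesis.\<close>

definition affine_form :: "real \<times> real \<Rightarrow> real \<times> real \<Rightarrow> real" where
  "affine_form l p = 1 + fst l * fst p + snd l * snd p"

definition off_lines :: "(real \<times> real) set \<Rightarrow> (real \<times> real) set" where
  "off_lines S = {p. \<forall>l\<in>S. affine_form l p \<noteq> 0}"

text \<open>The first four functions will be \<open>1\<close>, \<open>x\<^sup>2 y\<close>, \<open>x y\<^sup>2\<close>, \<open>x y\<close>, whose squares span the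
  Motzkin polynomial; on them positivity comes from elsewhere.\<close>

definition domination_chain :: "'p set \<Rightarrow> ('p \<Rightarrow> real) list \<Rightarrow> bool" where
  "domination_chain X es \<longleftrightarrow>
     (\<forall>n. 4 \<le> n \<and> n < length es \<longrightarrow> dominates X (es ! n) (set (take n es)))"

lemma domination_chain_append:
  assumes "domination_chain X es"
    and "\<And>k. k < length gs \<Longrightarrow> dominates X (gs ! k) (set es \<union> set (take k gs))"
  shows "domination_chain X (es @ gs)"
  unfolding domination_chain_def
proof (intro allI impI)
  fix n assume n: "4 \<le> n \<and> n < length (es @ gs)"
  show "dominates X ((es @ gs) ! n) (set (take n (es @ gs)))"
  proof (cases "n < length es")
    case True
    then show ?thesis using assms(1) n by (simp add: domination_chain_def nth_append)
  next
    case False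
    with assms(2)[of "n - length es"] n show ?thesis by (simp add: nth_append less_diff_conv2)
  qed
qed

lemma set_take_map_upt:
  assumes "k \<le> n"
  shows "set (take k (map f [0..<n])) = f ` {..<k}"
  using assms by (auto simp: take_map atLeast0LessThan)

text \<open>Along the curve \<open>(t\<^sup>N, t\<^sup>N\<^sup>+\<^sup>1)\<close> with \<open>N = d + 1\<close> a monomial of degree \<open>d + 1\<close> beats all
  monomials of lower degree, and among those of degree \<open>d + 1\<close> the power of the second coordinate
  decides.\<close>

lemma chain_raise_degree:
  assumes S: "finite S" "(0, 0) \<notin> S" and X: "X = off_lines S"
    and q: "\<And>p. p \<in> X \<Longrightarrow> q p \<noteq> 0"
    and es: "domination_chain X es" "fn.span (set es) = bounded_degree X fst snd q d"
  shows "\<exists>gs. gs \<noteq> [] \<and> domination_chain X (es @ gs) \<and>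
    fn.span (set (es @ gs)) = bounded_degree X fst snd q (Suc d)"
proof -
  let ?m = "restricted_monomial X fst snd q"
  let ?L = "{?m i j | i j. i + j \<le> d}"
  define g where "g k = ?m (Suc d - k) k" for k
  define gs where "gs = map g [0..<Suc (Suc d)]"
  have set_gs: "set gs = g ` {..<Suc (Suc d)}" by (simp only: gs_def set_map set_upt atLeast0LessThan)
  have span_es: "fn.span (set es) = fn.span ?L" using es(2) by (simp add: bounded_degree_def)
  have dom: "dominates X (g k) (?L \<union> g ` {..<k})" if k: "k \<le> Suc d" for k
    unfolding g_def[of k]
  proof (rule dominates_monomials[where P = "\<lambda>t. (t powr real (Suc d), t powr real (Suc (Suc d)))"])
    have "\<forall>\<^sub>F t in at_top. affine_form l (t powr real (Suc d), t powr real (Suc (Suc d))) \<noteq> 0"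
      if "l \<in> S" for l
      using eventually_powr_trinomial_nonzero[of "real (Suc d)" "real (Suc (Suc d))" 1 "fst l" "snd l"]
      by (simp add: affine_form_def)
    then show "\<forall>\<^sub>F t in at_top. (t powr real (Suc d), t powr real (Suc (Suc d))) \<in> X"
      using S(1) by (simp add: X off_lines_def eventually_ball_finite_distrib)
  next
    fix f assume "f \<in> ?L \<union> g ` {..<k}"
    then show "\<exists>i j. f = ?m i j \<and> real i * real (Suc d) + real j * real (Suc (Suc d)) <
      real (Suc d - k) * real (Suc d) + real k * real (Suc (Suc d))"
    proof
      assume "f \<in> ?L"
      then obtain i j where ij: "f = ?m i j" "i + j \<le> d" by blast
      \<comment> \<open>The weight of the monomial is \<open>(i + j) * Suc d + j\<close>. Since
        \<open>j \<le> d\<close>, the last summand cannot make up for a missing degree, which costs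
        \<open>Suc d\<close>.\<close>
      have "(i + j) * Suc d + j < Suc d * Suc d + k"
        using mult_le_mono1[OF ij(2), of "Suc d"] ij(2) by simp
      then have "i * Suc d + j * Suc (Suc d) < (Suc d - k + k) * Suc d + k"
        using k by (simp add: algebra_simps)
      then have "i * Suc d + j * Suc (Suc d) < (Suc d - k) * Suc d + k * Suc (Suc d)"
        by (simp only: add_mult_distrib mult_Suc_right)
      then show ?thesis
        using ij(1) by (intro exI[of _ i] exI[of _ j]) (simp only: simp_thms flip: of_nat_mult of_nat_add of_nat_less_iff)
    next
      assume "f \<in> g ` {..<k}"
      then obtain j where j: "f = ?m (Suc d - j) j" "j < k" by (auto simp: g_def)
      have "(Suc d - j + j) * Suc d + j < (Suc d - k + k) * Suc d + k"
        using j k by simp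
      then have "(Suc d - j) * Suc d + j * Suc (Suc d) < (Suc d - k) * Suc d + k * Suc (Suc d)"
        by (simp only: add_mult_distrib mult_Suc_right)
      then show ?thesis
        using j(1) by (intro exI[of _ "Suc d - j"] exI[of _ j]) (simp only: simp_thms flip: of_nat_mult of_nat_add of_nat_less_iff)
    qed
  qed (use q in auto)
  have "domination_chain X (es @ gs)"
  proof (rule domination_chain_append[OF es(1)])
    fix k assume "k < length gs"
    then have k: "k \<le> Suc d" by (simp add: gs_def)
    have "set es \<union> set (take k gs) \<subseteq> fn.span (set es \<union> g ` {..<k})"
      using k by (simp add: gs_def set_take_map_upt fn.span_superset del: upt_Suc)
    also have "\<dots> = fn.span (?L \<union> g ` {..<k})" by (rule span_Un_cong[OF span_es])
    finally have "dominates X (g k) (set es \<union> set (take k gs))"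
      by (rule dominates_span[OF dom[OF k]])
    then show "dominates X (gs ! k) (set es \<union> set (take k gs))"
      using k by (simp add: gs_def del: upt_Suc)
  qed
  moreover have "fn.span (set (es @ gs)) = bounded_degree X fst snd q (Suc d)"
  proof -
    have "{?m i j | i j. i + j \<le> Suc d} = ?L \<union> g ` {..<Suc (Suc d)}"
    proof (intro equalityI subsetI)
      fix f assume "f \<in> {?m i j | i j. i + j \<le> Suc d}"
      then obtain i j where ij: "f = ?m i j" "i + j \<le> Suc d" by blast
      show "f \<in> ?L \<union> g ` {..<Suc (Suc d)}"
      proof (cases "i + j \<le> d")
        case False
        then have "i = Suc d - j" "j < Suc (Suc d)" using ij(2) by auto
        then show ?thesis using ij(1) by (auto simp only: g_def)
      qed (use ij in blast)
    next
      fix f assume "f \<in> ?L \<union> g ` {..<Suc (Suc d)}"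
      then show "f \<in> {?m i j | i j. i + j \<le> Suc d}"
      proof
        assume "f \<in> ?L"
        then show ?thesis using le_SucI by blast
      next
        assume "f \<in> g ` {..<Suc (Suc d)}"
        then obtain k where "f = ?m (Suc d - k) k" "k < Suc (Suc d)" by (auto simp only: g_def)
        then show ?thesis by (intro CollectI exI[of _ "Suc d - k"] exI[of _ k]) auto
      qed
    qed
    then show ?thesis
      using span_Un_cong[OF span_es, of "set gs"] by (simp add: bounded_degree_def set_gs)
  qed
  ultimately show ?thesis by (intro exI[of _ gs]) (auto simp: gs_def)
qed


text \<open>In the coordinates \<open>u\<close>, vanishing on the line, and \<open>s\<close>, running along it, the curve is
  \<open>(t\<^sup>-\<^sup>N, t)\<close>: the additional pole beats everything that was there before, and among the
  functions with the additional pole the power of \<open>s\<close> decides.\<close>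

lemma chain_add_pole:
  assumes S: "finite S" "(0, 0) \<notin> S" and X: "X = off_lines S" and l: "l \<in> S"
    and q: "\<And>p. p \<in> X \<Longrightarrow> q p \<noteq> 0"
    and es: "domination_chain X es" "fn.span (set es) = bounded_degree X fst snd q d"
  shows "\<exists>gs. domination_chain X (es @ gs) \<and>
    fn.span (set (es @ gs)) = bounded_degree X fst snd (\<lambda>p. q p * affine_form l p) (Suc d)"
proof -
  obtain a b where ab: "l = (a, b)" by (cases l)
  define D where "D = a\<^sup>2 + b\<^sup>2"
  have D: "D > 0" using l S(2) by (auto simp: D_def ab sum_power2_gt_zero_iff)
  define u where "u = affine_form l"
  define s where "s p = - b * fst p + a * snd p" for p :: "real \<times> real"
  define q' where "q' p = q p * u p" for p
  have u_nz: "u p \<noteq> 0" if "p \<in> X" for p using that l by (auto simp: u_def X off_lines_def)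
  have q': "q' p \<noteq> 0" if "p \<in> X" for p using q u_nz that by (simp add: q'_def)
  have inv: "fst p = - a / D + a / D * u p + - b / D * s p" "snd p = - b / D + b / D * u p + a / D * s p" for p
  proof -
    have "- a + a * u p - b * s p = D * fst p" "- b + b * u p + a * s p = D * snd p"
      by (simp_all add: D_def u_def s_def affine_form_def ab power2_eq_square algebra_simps)
    moreover have "- a / D + a / D * u p + - b / D * s p = (- a + a * u p - b * s p) / D"
      "- b / D + b / D * u p + a / D * s p = (- b + b * u p + a * s p) / D"
      by (simp_all add: add_divide_distrib diff_divide_distrib)
    ultimately show "fst p = - a / D + a / D * u p + - b / D * s p" "snd p = - b / D + b / D * u p + a / D * s p"
      using D by simp_all
  qed
  have coords: "bounded_degree X fst snd r e = bounded_degree X u s r e" for r e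
  proof
    show "bounded_degree X fst snd r e \<subseteq> bounded_degree X u s r e"
      by (rule bounded_degree_change_coordinates[where \<alpha> = "- a / D" and \<beta> = "a / D" and \<gamma> = "- b / D"
            and \<alpha>' = "- b / D" and \<beta>' = "b / D" and \<gamma>' = "a / D"])
         (rule inv)+
    show "bounded_degree X u s r e \<subseteq> bounded_degree X fst snd r e"
      by (rule bounded_degree_change_coordinates[where \<alpha> = 1 and \<beta> = a and \<gamma> = b
            and \<alpha>' = 0 and \<beta>' = "- b" and \<gamma>' = a])
         (auto simp: u_def s_def affine_form_def ab)
  qed
  let ?m = "restricted_monomial X u s q'"
  \<comment> \<open>Over the denominator \<open>q * u\<close> the old functions are exactly the
    monomials with a factor \<open>u\<close>, and the new ones \<open>g k\<close> have none. On the
    curve such a factor costs \<open>Suc d\<close>, more than the at most \<open>d\<close> factors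
    \<open>s\<close> can regain.\<close>
  let ?L = "{?m (Suc i) j | i j. i + j \<le> d}"
  define g where "g k = ?m 0 k" for k
  define gs where "gs = map g [0..<Suc (Suc d)]"
  have set_gs: "set gs = g ` {..<Suc (Suc d)}"
    by (simp only: gs_def set_map set_upt atLeast0LessThan)
  have "restricted_monomial X u s q i j = ?m (Suc i) j" for i j
    by (auto simp: restricted_monomial_def fun_eq_iff q'_def u_nz)
  then have span_es: "fn.span (set es) = fn.span ?L" using es(2) unfolding coords by (simp add: bounded_degree_def)
  \<comment> \<open>The point with coordinates \<open>u = t powr - real (Suc d)\<close> and
    \<open>s = t\<close>, found by inverting the linear change of coordinates of determinant
    \<open>D\<close>.\<close>
  define P where "P t = ((a * (t powr - real (Suc d) - 1) - b * t) / D,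
      (b * (t powr - real (Suc d) - 1) + a * t) / D)" for t
  have split: "x * (X / D) + y * (Y / D) = (x * X + y * Y) / D" for x y X Y
    by (simp add: add_divide_distrib)
  have join: "(X * x + Y * y) / D = X / D * x + Y / D * y" for X Y x y
    by (simp add: add_divide_distrib)
  have P: "a' * fst (P t) + b' * snd (P t)
    = (a' * a + b' * b) / D * (t powr - real (Suc d) - 1) + (b' * a - a' * b) / D * t" for a' b' t
  proof -
    have "a' * ((a * \<tau> - b * t) / D) + b' * ((b * \<tau> + a * t) / D)
      = (a' * a + b' * b) / D * \<tau> + (b' * a - a' * b) / D * t" for \<tau>
    proof -
      have "a' * ((a * \<tau> - b * t) / D) + b' * ((b * \<tau> + a * t) / D)
        = (a' * (a * \<tau> - b * t) + b' * (b * \<tau> + a * t)) / D"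
        by (rule split)
      also have "a' * (a * \<tau> - b * t) + b' * (b * \<tau> + a * t)
        = (a' * a + b' * b) * \<tau> + (b' * a - a' * b) * t"
        by (simp add: algebra_simps)
      finally show ?thesis by (simp only: join)
    qed
    then show ?thesis unfolding P_def by simp
  qed
  have "a * a + b * b = D" by (simp add: D_def power2_eq_square)
  then have D1: "(a * a + b * b) / D = 1" using D by simp
  have uP: "u (P t) = t powr - real (Suc d)" for t
    using P[of a t b] D1 by (simp add: u_def affine_form_def ab)
  have sP: "s (P t) = t" for t
    using P[of "- b" t a] D1 by (simp add: s_def)
  have PX: "\<forall>\<^sub>F t in at_top. P t \<in> X"
  proof -
    have "\<forall>\<^sub>F t in at_top. affine_form k (P t) \<noteq> 0" if "k \<in> S" for k
    proof -
      obtain a' b' where k: "k = (a', b')" by (cases k)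
      \<comment> \<open>\<open>A + C = 1\<close>, so the coefficients never vanish simultaneously,
        not even for a line parallel to \<open>l\<close>.\<close>
      define A B C where "A = 1 - (a' * a + b' * b) / D" and "B = (b' * a - a' * b) / D"
        and "C = (a' * a + b' * b) / D"
      have "\<forall>\<^sub>F t in at_top. A + B * t powr 1 + C * t powr - real (Suc d) \<noteq> 0"
        by (rule eventually_powr_trinomial_nonzero) (auto simp: A_def C_def)
      then show ?thesis
        using eventually_gt_at_top[of 0]
      proof eventually_elim
        case (elim t)
        have "affine_form k (P t) = A + B * t + C * t powr - real (Suc d)"
          using P[of a' t b'] by (simp add: affine_form_def k A_def B_def C_def right_diff_distrib)
        with elim show ?case by simp
      qed
    qed
    then show ?thesis
      using S(1) by (simp add: X off_lines_def eventually_ball_finite_distrib)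
  qed
  have dom: "dominates X (g k) (?L \<union> g ` {..<k})" for k
    unfolding g_def[of k]
  proof (rule dominates_monomials[where P = P and a = "- real (Suc d)" and b = 1])
    fix f assume "f \<in> ?L \<union> g ` {..<k}"
    then show "\<exists>i j. f = ?m i j \<and> real i * - real (Suc d) + real j * 1 < real 0 * - real (Suc d) + real k * 1"
    proof
      assume "f \<in> ?L"
      then obtain i j where ij: "f = ?m (Suc i) j" "i + j \<le> d" by blast
      have "1 * real (Suc d) \<le> real (Suc i) * real (Suc d)" by (intro mult_right_mono) auto
      moreover have "real j < real (Suc d)" using ij(2) by simp
      ultimately have "real (Suc i) * - real (Suc d) + real j * 1 < real 0 * - real (Suc d) + real k * 1"
        by (simp only: mult_minus_right mult_1_right mult_1_left of_nat_0 mult_zero_left)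
      then show ?thesis using ij(1) by blast
    next
      assume "f \<in> g ` {..<k}"
      then obtain j where "f = ?m 0 j" "j < k" by (auto simp: g_def)
      then show ?thesis by (intro exI[of _ 0] exI[of _ j]) simp
    qed
  qed (use q' uP sP PX in auto)
  have "domination_chain X (es @ gs)"
  proof (rule domination_chain_append[OF es(1)])
    fix k assume "k < length gs"
    then have k: "k \<le> Suc d" by (simp add: gs_def)
    have "set es \<union> set (take k gs) \<subseteq> fn.span (set es \<union> g ` {..<k})"
      using k by (simp add: gs_def set_take_map_upt fn.span_superset del: upt_Suc)
    also have "\<dots> = fn.span (?L \<union> g ` {..<k})" by (rule span_Un_cong[OF span_es])
    finally have "dominates X (g k) (set es \<union> set (take k gs))"
      by (rule dominates_span[OF dom])
    then show "dominates X (gs ! k) (set es \<union> set (take k gs))"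
      using k by (simp add: gs_def del: upt_Suc)
  qed
  moreover have "fn.span (set (es @ gs)) = bounded_degree X fst snd q' (Suc d)"
  proof -
    have "{?m i j | i j. i + j \<le> Suc d} = ?L \<union> g ` {..<Suc (Suc d)}"
    proof (intro equalityI subsetI)
      fix f assume "f \<in> {?m i j | i j. i + j \<le> Suc d}"
      then obtain i j where ij: "f = ?m i j" "i + j \<le> Suc d" by blast
      show "f \<in> ?L \<union> g ` {..<Suc (Suc d)}"
      proof (cases i)
        case 0
        then show ?thesis using ij by (auto simp only: g_def)
      next
        case (Suc k)
        then have "k + j \<le> d" using ij(2) by simp
        then show ?thesis using ij(1) Suc by blast
      qed
    next
      fix f assume "f \<in> ?L \<union> g ` {..<Suc (Suc d)}"
      then show "f \<in> {?m i j | i j. i + j \<le> Suc d}"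
      proof
        assume "f \<in> ?L"
        then obtain i j where "f = ?m (Suc i) j" "i + j \<le> d" by blast
        then show ?thesis by (intro CollectI exI[of _ "Suc i"] exI[of _ j]) auto
      next
        assume "f \<in> g ` {..<Suc (Suc d)}"
        then obtain k where "f = ?m 0 k" "k < Suc (Suc d)" by (auto simp only: g_def)
        then show ?thesis by (intro CollectI exI[of _ 0] exI[of _ k]) auto
      qed
    qed
    then show ?thesis
      using span_Un_cong[OF span_es, of "set gs"] unfolding coords
      by (simp add: bounded_degree_def set_gs)
  qed
  moreover have "q' = (\<lambda>p. q p * affine_form l p)" by (simp add: q'_def u_def fun_eq_iff)
  ultimately show ?thesis by blast
qed

lemma chain_add_poles:
  assumes S: "finite S" "(0, 0) \<notin> S" and X: "X = off_lines S" and T: "T \<subseteq> S"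
    and q: "\<And>p. p \<in> X \<Longrightarrow> q p \<noteq> 0"
    and es: "domination_chain X es" "fn.span (set es) = bounded_degree X fst snd q d"
  shows "\<exists>gs. domination_chain X (es @ gs) \<and>
    fn.span (set (es @ gs)) = bounded_degree X fst snd (\<lambda>p. q p * (\<Prod>l\<in>T. affine_form l p)) (d + card T)"
  using finite_subset[OF T S(1)] T
proof (induction T rule: finite_induct)
  case empty
  show ?case by (rule exI[of _ "[]"]) (use es in simp)
next
  case (insert l T)
  then obtain gs where gs: "domination_chain X (es @ gs)"
    "fn.span (set (es @ gs)) = bounded_degree X fst snd (\<lambda>p. q p * (\<Prod>l\<in>T. affine_form l p)) (d + card T)"
    by auto
  have "q p * (\<Prod>l\<in>T. affine_form l p) \<noteq> 0" if "p \<in> X" for p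
    using q that insert by (auto simp: X off_lines_def)
  moreover have "l \<in> S" using insert.prems by simp
  ultimately obtain hs where hs: "domination_chain X ((es @ gs) @ hs)"
    "fn.span (set ((es @ gs) @ hs)) =
      bounded_degree X fst snd (\<lambda>p. q p * (\<Prod>l\<in>T. affine_form l p) * affine_form l p) (Suc (d + card T))"
    using chain_add_pole[OF S X _ _ gs, of l] by blast
  have "(\<lambda>p. q p * (\<Prod>l\<in>T. affine_form l p) * affine_form l p)
    = (\<lambda>p. q p * (\<Prod>l\<in>insert l T. affine_form l p))"
    using insert.hyps by (simp add: fun_eq_iff mult_ac)
  then show ?case
    using hs insert.hyps by (intro exI[of _ "gs @ hs"]) (simp only: append_assoc card_insert_disjoint add_Suc_right simp_thms)
qed

section \<open>Exhausting all localized functions by a single sequence\<close>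

definition line_product :: "(real \<times> real) set \<Rightarrow> real \<times> real \<Rightarrow> real" where
  "line_product S p = (\<Prod>l\<in>S. affine_form l p)"

lemma line_product_nonzero: "finite S \<Longrightarrow> p \<in> off_lines S \<Longrightarrow> line_product S p \<noteq> 0"
  by (auto simp: line_product_def off_lines_def)

text \<open>One more pole along each line costs \<open>card S\<close> degrees merely to keep the old
  functions. The extra degree lets numerators of every degree appear eventually; it also makes the
  list grow when there are no lines.\<close>

lemma chain_next_stage:
  assumes S: "finite S" "(0, 0) \<notin> S" and X: "X = off_lines S"
    and es: "domination_chain X es" "fn.span (set es) = bounded_degree X fst snd (\<lambda>p. line_product S p ^ n) d"
  shows "\<exists>gs. gs \<noteq> [] \<and> domination_chain X (es @ gs) \<and>
    fn.span (set (es @ gs)) = bounded_degree X fst snd (\<lambda>p. line_product S p ^ Suc n) (Suc (d + card S))"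
proof -
  have nz: "line_product S p ^ k \<noteq> 0" if "p \<in> X" for p k
    using line_product_nonzero[OF S(1)] that X by simp
  obtain gs where gs: "domination_chain X (es @ gs)"
    "fn.span (set (es @ gs)) = bounded_degree X fst snd (\<lambda>p. line_product S p ^ n * (\<Prod>l\<in>S. affine_form l p)) (d + card S)"
    using chain_add_poles[OF S X subset_refl nz es] by blast
  have eq: "(\<lambda>p. line_product S p ^ n * (\<Prod>l\<in>S. affine_form l p)) = (\<lambda>p. line_product S p ^ Suc n)"
    by (simp add: line_product_def fun_eq_iff mult_ac)
  obtain hs where "hs \<noteq> []" "domination_chain X ((es @ gs) @ hs)"
    "fn.span (set ((es @ gs) @ hs)) = bounded_degree X fst snd (\<lambda>p. line_product S p ^ Suc n) (Suc (d + card S))"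
    using chain_raise_degree[OF S X nz gs(1) gs(2)[unfolded eq]] by blast
  then show ?thesis by (intro exI[of _ "gs @ hs"]) (simp only: append_assoc append_is_Nil_conv simp_thms)
qed


lemma span_range_prefixes:
  assumes "f \<in> fn.span (set (es :: ('p \<Rightarrow> real) list))" "\<And>i. i < length es \<Longrightarrow> e i = es ! i"
  shows "f \<in> fn.span (range e)"
proof -
  have "set es \<subseteq> range e" using assms(2) by (auto simp: in_set_conv_nth) (metis rangeI)
  then show ?thesis using assms(1) fn.span_mono by blast
qed

text \<open>Expanding a fraction by one line raises the degree of the numerator by one; the
  cancellation is valid because the form has no zero on \<open>X\<close>.\<close>

lemma bounded_degree_next_power:
  assumes "finite T" "T \<subseteq> S" "X = off_lines S"
  shows "bounded_degree X fst snd q d \<subseteq> bounded_degree X fst snd (\<lambda>p. q p * (\<Prod>l\<in>T. affine_form l p)) (d + card T)"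
  using assms(1,2)
proof (induction T rule: finite_induct)
  case empty
  then show ?case by simp
next
  case (insert l T)
  let ?r = "\<lambda>p. q p * (\<Prod>l\<in>T. affine_form l p)"
  let ?r' = "\<lambda>p. q p * (\<Prod>l\<in>insert l T. affine_form l p)"
  have "bounded_degree X fst snd ?r e \<subseteq> bounded_degree X fst snd ?r' (Suc e)" for e
    unfolding bounded_degree_def[of X fst snd ?r]
  proof (rule fn.span_minimal)
    show "{restricted_monomial X fst snd ?r i j |i j. i + j \<le> e} \<subseteq> bounded_degree X fst snd ?r' (Suc e)"
    proof
      fix f assume "f \<in> {restricted_monomial X fst snd ?r i j |i j. i + j \<le> e}"
      then obtain i j where ij: "f = restricted_monomial X fst snd ?r i j" "i + j \<le> e" by blast
      have "affine_form l * restricted_monomial X fst snd ?r' i j \<in> bounded_degree X fst snd ?r' (Suc e)"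
        by (rule bounded_degree_mult_affine[OF restricted_monomial_in_bounded_degree[OF ij(2)]])
           (simp add: affine_form_def)
      moreover have "affine_form l * restricted_monomial X fst snd ?r' i j = f"
      proof
        fix p
        show "(affine_form l * restricted_monomial X fst snd ?r' i j) p = f p"
        proof (cases "p \<in> X")
          case True
          then have "affine_form l p \<noteq> 0" using insert assms(3) by (simp add: off_lines_def)
          then show ?thesis using True insert.hyps by (simp add: ij(1) restricted_monomial_def)
        qed (simp add: ij(1) restricted_monomial_def)
      qed
      ultimately show "f \<in> bounded_degree X fst snd ?r' (Suc e)" by simp
    qed
    show "fn.subspace (bounded_degree X fst snd ?r' (Suc e))"
      by (simp add: bounded_degree_def fn.subspace_span)
  qed
  note step = this
  have "bounded_degree X fst snd q d \<subseteq> bounded_degree X fst snd ?r (d + card T)"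
    using insert by simp
  also note step
  finally show ?case by (simp only: card_insert_disjoint[OF insert.hyps] add_Suc_right)
qed

text \<open>The ring of real polynomials in two variables localized at the affine forms of
  \<open>S\<close>, seen as functions extended by zero. Powers of one common denominator suffice
  because \<open>S\<close> is finite.\<close>

definition localized_functions :: "(real \<times> real) set \<Rightarrow> (real \<times> real \<Rightarrow> real) set" where
  "localized_functions S = fn.span {restricted_monomial (off_lines S) fst snd (\<lambda>p. line_product S p ^ n) i j | n i j. True}"

text \<open>These are all monomials of degree at most \<open>3\<close>, the pure powers last. Along
  \<open>(t, t powr -4)\<close> every listed monomial containing the second variable tends to zero,
  since the exponent of the first is at most \<open>3\<close>; hence a pure power has to beat only
  lower pure powers. The other axis is symmetric.\<close>

lemma motzkin_chain:
  assumes S: "finite S" "(0, 0) \<notin> S" and X: "X = off_lines S"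
    and m: "m = restricted_monomial X fst snd (\<lambda>_. 1)"
  defines "es \<equiv> [m 0 0, m 2 1, m 1 2, m 1 1, m 1 0, m 0 1, m 2 0, m 0 2, m 3 0, m 0 3]"
  shows "domination_chain X es" "fn.span (set es) = bounded_degree X fst snd (\<lambda>_. 1) 3"
proof -
  have ev: "\<forall>\<^sub>F t in at_top. (t powr a, t powr b) \<in> X" if ab: "a \<noteq> 0" "b \<noteq> 0" "a \<noteq> b" for a b
  proof -
    have "\<forall>\<^sub>F t in at_top. affine_form l (t powr a, t powr b) \<noteq> 0" for l
      using eventually_powr_trinomial_nonzero[OF ab, of 1 "fst l" "snd l"] by (simp add: affine_form_def)
    then show ?thesis using S(1) by (simp add: X off_lines_def eventually_ball_finite_distrib)
  qed
  have dom: "dominates X (m k l) T"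
    if "a \<noteq> 0" "b \<noteq> 0" "a \<noteq> b"
      "\<And>f. f \<in> T \<Longrightarrow> \<exists>i j. f = m i j \<and> real i * a + real j * b < real k * a + real l * b" for T a b k l
    unfolding m
    by (rule dominates_monomials[where P = "\<lambda>t. (t powr a, t powr b)" and a = a and b = b])
       (use that ev in \<open>auto simp: m\<close>)
  have x: "dominates X (m k 0) (set (map (\<lambda>(i, j). m i j) T))" if "\<forall>(i,j)\<in>set T. i < k + 4 * j" for k T
  proof (rule dom[of 1 "-4"])
    fix f assume "f \<in> set (map (\<lambda>(i, j). m i j) T)"
    then obtain i j where ij: "f = m i j" "(i, j) \<in> set T" by auto
    then have "real i < real (k + 4 * j)" using that by (subst of_nat_less_iff) auto
    then show "\<exists>i j. f = m i j \<and> real i * 1 + real j * - 4 < real k * 1 + real 0 * - 4"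
      using ij(1) by (intro exI[of _ i] exI[of _ j]) simp
  qed auto
  have y: "dominates X (m 0 k) (set (map (\<lambda>(i, j). m i j) T))" if "\<forall>(i,j)\<in>set T. j < k + 4 * i" for k T
  proof (rule dom[of "-4" 1])
    fix f assume "f \<in> set (map (\<lambda>(i, j). m i j) T)"
    then obtain i j where ij: "f = m i j" "(i, j) \<in> set T" by auto
    then have "real j < real (k + 4 * i)" using that by (subst of_nat_less_iff) auto
    then show "\<exists>i j. f = m i j \<and> real i * - 4 + real j * 1 < real 0 * - 4 + real k * 1"
      using ij(1) by (intro exI[of _ i] exI[of _ j]) simp
  qed auto
  define ps :: "(nat \<times> nat) list" where
    "ps = [(0,0), (2,1), (1,2), (1,1), (1,0), (0,1), (2,0), (0,2), (3,0), (0,3)]"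
  have es: "es = map (\<lambda>(i, j). m i j) ps" by (simp add: es_def ps_def)
  show "domination_chain X es"
    unfolding domination_chain_def
  proof (intro allI impI)
    fix n assume "4 \<le> n \<and> n < length es"
    then have "n \<in> {4, 5, 6, 7, 8, 9}" by (auto simp: es_def)
    moreover have "dominates X (es ! 4) (set (take 4 es))"
      using x[of "take 4 ps" 1] by (simp add: es ps_def)
    moreover have "dominates X (es ! 5) (set (take 5 es))"
      using y[of "take 5 ps" 1] by (simp add: es ps_def)
    moreover have "dominates X (es ! 6) (set (take 6 es))"
      using x[of "take 6 ps" 2] by (simp add: es ps_def)
    moreover have "dominates X (es ! 7) (set (take 7 es))"
      using y[of "take 7 ps" 2] by (simp add: es ps_def)
    moreover have "dominates X (es ! 8) (set (take 8 es))"
      using x[of "take 8 ps" 3] by (simp add: es ps_def)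
    moreover have "dominates X (es ! 9) (set (take 9 es))"
      using y[of "take 9 ps" 3] by (simp add: es ps_def)
    ultimately show "dominates X (es ! n) (set (take n es))" by blast
  qed
  have "{m i j | i j. i + j \<le> 3} = set es"
  proof
    show "set es \<subseteq> {m i j | i j. i + j \<le> 3}"
    proof
      fix f assume "f \<in> set es"
      then obtain i j where "f = m i j" "(i, j) \<in> set ps" by (auto simp only: es set_map)
      then show "f \<in> {m i j | i j. i + j \<le> 3}"
        by (intro CollectI exI[of _ i] exI[of _ j]) (auto simp: ps_def)
    qed
    show "{m i j | i j. i + j \<le> 3} \<subseteq> set es"
    proof
      fix f assume "f \<in> {m i j | i j. i + j \<le> 3}"
      then obtain i j where ij: "f = m i j" "i + j \<le> 3" by blast
      have "(i, j) \<in> {..3} \<times> {..3}" using ij(2) by auto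
      then have "(i, j) \<in> set ps" using ij(2) by (auto simp: ps_def numeral_eq_Suc atMost_Suc)
      then show "f \<in> set es" using ij(1) by (auto simp only: es set_map)
    qed
  qed
  then show "fn.span (set es) = bounded_degree X fst snd (\<lambda>_. 1) 3"
    by (simp only: bounded_degree_def m[symmetric])
qed

lemma dominating_sequence:
  assumes S: "finite S" "(0, 0) \<notin> S"
  defines "X \<equiv> off_lines S" and "m \<equiv> restricted_monomial (off_lines S) fst snd (\<lambda>_. 1)"
  obtains e :: "nat \<Rightarrow> real \<times> real \<Rightarrow> real" where "e 0 = m 0 0" "e 1 = m 2 1" "e 2 = m 1 2" "e 3 = m 1 1"
    "\<And>n. n \<ge> 4 \<Longrightarrow> dominates X (e n) (e ` {..<n})"
    "localized_functions S \<subseteq> fn.span (range e)"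
proof -
  define W where "W n d = bounded_degree X fst snd (\<lambda>p. line_product S p ^ n) d" for n d
  define es0 where "es0 = [m 0 0, m 2 1, m 1 2, m 1 1, m 1 0, m 0 1, m 2 0, m 0 2, m 3 0, m 0 3]"
  have X: "X = off_lines S" by (simp add: X_def)
  \<comment> \<open>The length bound guarantees that stage \<open>n\<close> has an entry at position
    \<open>n\<close>, which the diagonal sequence reads off.\<close>
  define P where "P n es \<longleftrightarrow> domination_chain X es \<and> fn.span (set es) = W n (3 + n * Suc (card S)) \<and>
     take 10 es = es0 \<and> length es \<ge> 10 + n" for n es
  define R where "R es es' \<longleftrightarrow> (\<exists>gs. es' = es @ gs)" for es es' :: "(real \<times> real \<Rightarrow> real) list"
  have "\<exists>E. \<forall>n. P n (E n) \<and> R (E n) (E (Suc n))"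
  proof (rule dependent_nat_choice)
    have m: "m = restricted_monomial X fst snd (\<lambda>_. 1)" by (simp add: X_def m_def)
    have "P 0 es0"
      using motzkin_chain[OF S X m] unfolding P_def es0_def W_def by simp
    then show "\<exists>es. P 0 es" by blast
  next
    fix es n assume P: "P n es"
    obtain gs where gs: "gs \<noteq> []" "domination_chain X (es @ gs)"
      "fn.span (set (es @ gs)) = W (Suc n) (Suc (3 + n * Suc (card S) + card S))"
      using chain_next_stage[OF S X, of es n] P unfolding P_def W_def by blast
    have "Suc (3 + n * Suc (card S) + card S) = 3 + Suc n * Suc (card S)" by simp
    moreover have "length (es @ gs) \<ge> 10 + Suc n" "take 10 (es @ gs) = es0"
      using gs(1) P by (cases gs; auto simp: P_def)+
    ultimately have "P (Suc n) (es @ gs)" using gs by (simp only: P_def simp_thms)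
    then show "\<exists>es'. P (Suc n) es' \<and> R es es'" unfolding R_def by blast
  qed
  then obtain E where P: "\<And>n. P n (E n)" and R: "\<And>n. R (E n) (E (Suc n))" by blast
  have len: "length (E n) \<ge> 10 + n" for n using P[of n] by (simp add: P_def)
  \<comment> \<open>Each stage prolongs the previous one, so the diagonal agrees with every stage on
    the whole length of that stage.\<close>
  define e where "e i = E i ! i" for i
  have pre: "E k ! i = E n ! i" if "n \<le> k" "i < length (E n)" for i n k
    using that
  proof (induction k rule: dec_induct)
    case (step k)
    obtain gs where gs: "E (Suc k) = E k @ gs" using R by (auto simp: R_def)
    have "length (E n) \<le> length (E k)"
      using step.hyps(1)
    proof (induction k rule: dec_induct)
      case (step k)
      then show ?case using R[of k] by (auto simp: R_def)
    qed simp
    then show ?case using step by (simp add: gs nth_append)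
  qed simp
  have e: "e i = E n ! i" if "i < length (E n)" for i n
    using pre[of n i i] pre[of i n i] len[of i] that by (cases "n \<le> i") (auto simp: e_def)
  have e0: "e i = es0 ! i" if "i < 10" for i
  proof -
    have "take 10 (E 0) = es0" using P[of 0] by (simp add: P_def)
    then have "E 0 ! i = es0 ! i" using that by (metis nth_take)
    then show ?thesis using e[of i 0] len[of 0] that by simp
  qed
  show thesis
  proof (rule that[of e])
    show "e 0 = m 0 0" "e 1 = m 2 1" "e 2 = m 1 2" "e 3 = m 1 1"
      using e0[of 0] e0[of 1] e0[of 2] e0[of 3] by (simp_all add: es0_def numeral_eq_Suc)
  next
    fix n :: nat assume n: "n \<ge> 4"
    have "dominates X (E n ! n) (set (take n (E n)))"
      using P[of n] n len[of n] by (simp add: P_def domination_chain_def)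
    moreover have "set (take n (E n)) = e ` {..<n}"
    proof -
      have "E n ! i = e i" if "i < n" for i using e[of i n] len[of n] that by simp
      then have "take n (E n) = map e [0..<n]"
        using len[of n] by (intro nth_equalityI) auto
      then show ?thesis by (simp add: atLeast0LessThan)
    qed
    ultimately show "dominates X (e n) (e ` {..<n})" by (simp add: e_def)
  next
    have W_step: "W n d \<subseteq> W (Suc n) (d + card S)" for n d
    proof -
      have "(\<lambda>p. line_product S p ^ n * (\<Prod>l\<in>S. affine_form l p)) = (\<lambda>p. line_product S p ^ Suc n)"
        by (simp add: line_product_def fun_eq_iff mult_ac)
      then show ?thesis
        using bounded_degree_next_power[OF S(1) subset_refl X, of "\<lambda>p. line_product S p ^ n" d]
        by (simp only: W_def)
    qed
    have W_steps: "W n d \<subseteq> W (n + r) (d + r * card S)" for n d r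
    proof (induction r)
      case (Suc r)
      have "W (n + r) (d + r * card S) \<subseteq> W (n + Suc r) (d + Suc r * card S)"
        using W_step[of "n + r" "d + r * card S"] by (simp add: algebra_simps)
      with Suc show ?case by blast
    qed simp
    have "restricted_monomial X fst snd (\<lambda>p. line_product S p ^ n) i j \<in> fn.span (range e)" for n i j
    proof -
      \<comment> \<open>After \<open>i + j\<close> further stages the degree bound has gained
        \<open>i + j\<close> beyond what the additional denominators consume.\<close>
      let ?d = "i + j" and ?N = "n + (i + j)"
      have "restricted_monomial X fst snd (\<lambda>p. line_product S p ^ n) i j \<in> W n ?d"
        unfolding W_def by (rule restricted_monomial_in_bounded_degree) simp
      also have "\<dots> \<subseteq> W ?N (?d + ?d * card S)" by (rule W_steps)
      also have "\<dots> \<subseteq> W ?N (3 + ?N * Suc (card S))"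
        unfolding W_def by (rule bounded_degree_mono) (simp add: algebra_simps)
      also have "\<dots> = fn.span (set (E ?N))" using P[of ?N] by (simp add: P_def)
      finally show ?thesis by (rule span_range_prefixes) (rule e)
    qed
    then have "{restricted_monomial X fst snd (\<lambda>p. line_product S p ^ n) i j | n i j. True} \<subseteq> fn.span (range e)"
      by blast
    then show "localized_functions S \<subseteq> fn.span (range e)"
      unfolding localized_functions_def X_def[symmetric] by (rule fn.span_minimal) (rule fn.subspace_span)
  qed
qed

section \<open>Separating the Motzkin polynomial\<close>

text \<open>The Motzkin polynomial vanishes at the four corners and is \<open>1\<close> at the origin, so it gets a
  negative value; on squares of combinations of \<open>1\<close>, \<open>x\<^sup>2 y\<close>, \<open>x y\<^sup>2\<close>, \<open>x y\<close>, which are orthogonal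
  on the corners, the functional is nevertheless positive definite.\<close>

definition square_functional :: "(real \<times> real \<Rightarrow> 'k::real_vector) \<Rightarrow> 'k" where
  "square_functional g = (g (1, 1) + g (1, -1) + g (-1, 1) + g (-1, -1)) /\<^sub>R 2 - g (0, 0)"

definition motzkin :: "'k::comm_ring_1 \<Rightarrow> 'k \<Rightarrow> 'k" where
  "motzkin x y = x^4 * y^2 + x^2 * y^4 + 1 - 3 * (x^2 * y^2)"

text \<open>Multiplied by \<open>(x^2 + y^2)^2\<close> the polynomial becomes a sum of squares. In
  \<open>a = x^2\<close> and \<open>b = y^2\<close> the certificate is a single identity whose terms
  are visibly nonnegative.\<close>

lemma motzkin_nonneg: "motzkin x y \<ge> (0::real)"
proof -
  define a b where "a = x\<^sup>2" and "b = y\<^sup>2"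
  have ab: "a \<ge> 0" "b \<ge> 0" by (auto simp: a_def b_def)
  have eq: "motzkin x y = a\<^sup>2 * b + a * b\<^sup>2 + 1 - 3 * (a * b)"
    by (simp add: motzkin_def a_def b_def flip: power_mult)
  have "(a + b)\<^sup>2 * motzkin x y = a * b * (a + b + 1) * (a + b - 2)\<^sup>2 + (a - b)\<^sup>2"
    unfolding eq by algebra
  also have "\<dots> \<ge> 0" using ab by (intro add_nonneg_nonneg mult_nonneg_nonneg) auto
  finally have *: "(a + b)\<^sup>2 * motzkin x y \<ge> 0" .
  show ?thesis
  proof (cases "a + b = 0")
    case True
    then have "a = 0" "b = 0" using ab by auto
    then show ?thesis by (simp add: eq)
  next
    case False
    then have "(a + b)\<^sup>2 > 0" by simp
    with * show ?thesis by (simp add: zero_le_mult_iff)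
  qed
qed

section \<open>The localized functions as an algebra\<close>

lemma localized_functions_add: "f \<in> localized_functions S \<Longrightarrow> g \<in> localized_functions S \<Longrightarrow> f + g \<in> localized_functions S"
  unfolding localized_functions_def by (rule fn.span_add)

lemma localized_functions_scale: "f \<in> localized_functions S \<Longrightarrow> (\<lambda>p. c * f p) \<in> localized_functions S"
  unfolding localized_functions_def by (rule fn.span_scale)

lemma localized_functions_mult:
  assumes "f \<in> localized_functions S" "g \<in> localized_functions S"
  shows "f * g \<in> localized_functions S"
  using assms unfolding localized_functions_def
proof (rule span_mult_closed)
  let ?m = "\<lambda>n. restricted_monomial (off_lines S) fst snd (\<lambda>p. line_product S p ^ n)"
  fix s t
  assume "s \<in> {?m n i j | n i j. True}" "t \<in> {?m n i j | n i j. True}"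
  then obtain n i j n' i' j' where st: "s = ?m n i j" "t = ?m n' i' j'" by blast
  have "s * t = ?m (n + n') (i + i') (j + j')"
    unfolding st by (auto simp: restricted_monomial_def fun_eq_iff power_add)
  then show "s * t \<in> fn.span {?m n i j | n i j. True}"
    by (intro fn.span_base) blast
qed

definition restrict_off :: "(real \<times> real) set \<Rightarrow> (real \<times> real \<Rightarrow> real) \<Rightarrow> real \<times> real \<Rightarrow> real" where
  "restrict_off S g p = (if p \<in> off_lines S then g p else 0)"

lemma restrict_off_monomial: "restrict_off S (\<lambda>p. fst p ^ i * snd p ^ j) \<in> localized_functions S"
proof -
  have "restrict_off S (\<lambda>p. fst p ^ i * snd p ^ j) = restricted_monomial (off_lines S) fst snd (\<lambda>p. line_product S p ^ 0) i j"
    by (auto simp: restrict_off_def restricted_monomial_def fun_eq_iff)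
  then show ?thesis unfolding localized_functions_def by (intro fn.span_base) blast
qed

lemma restrict_off_affine: "restrict_off S (\<lambda>p. a + b * fst p + c * snd p) \<in> localized_functions S"
proof -
  have "restrict_off S (\<lambda>p. a + b * fst p + c * snd p) =
    (\<lambda>p. a * restrict_off S (\<lambda>p. fst p ^ 0 * snd p ^ 0) p) + (\<lambda>p. b * restrict_off S (\<lambda>p. fst p ^ 1 * snd p ^ 0) p)
     + (\<lambda>p. c * restrict_off S (\<lambda>p. fst p ^ 0 * snd p ^ 1) p)"
    by (auto simp: restrict_off_def fun_eq_iff)
  then show ?thesis
    by (simp only:) (intro restrict_off_monomial localized_functions_add localized_functions_scale)
qed

text \<open>The inverse of one form is the product of the others divided by the common
  denominator.\<close>

lemma restrict_off_inverse:
  assumes "finite S" "l \<in> S"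
  shows "restrict_off S (\<lambda>p. inverse (affine_form l p)) \<in> localized_functions S"
proof -
  let ?h = "restricted_monomial (off_lines S) fst snd (\<lambda>p. line_product S p ^ 1) 0 0"
  have prod: "restrict_off S (\<lambda>p. \<Prod>k\<in>T. affine_form k p) \<in> localized_functions S" if "finite T" for T
    using that
  proof (induction T rule: finite_induct)
    case empty
    then show ?case using restrict_off_monomial[of S 0 0] by simp
  next
    case (insert k T)
    have "restrict_off S (\<lambda>p. \<Prod>k\<in>insert k T. affine_form k p) =
      restrict_off S (\<lambda>p. 1 + fst k * fst p + snd k * snd p) * restrict_off S (\<lambda>p. \<Prod>k\<in>T. affine_form k p)"
      using insert.hyps by (auto simp: restrict_off_def fun_eq_iff affine_form_def)
    then show ?case
      using localized_functions_mult[OF restrict_off_affine insert.IH] by (simp only:)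
  qed
  have h: "?h \<in> localized_functions S"
    unfolding localized_functions_def by (intro fn.span_base) blast
  have "restrict_off S (\<lambda>p. inverse (affine_form l p)) = restrict_off S (\<lambda>p. \<Prod>k\<in>S - {l}. affine_form k p) * ?h"
  proof
    fix p
    show "restrict_off S (\<lambda>p. inverse (affine_form l p)) p = (restrict_off S (\<lambda>p. \<Prod>k\<in>S - {l}. affine_form k p) * ?h) p"
    proof (cases "p \<in> off_lines S")
      case True
      then have "\<And>k. k \<in> S \<Longrightarrow> affine_form k p \<noteq> 0" by (simp add: off_lines_def)
      moreover have "line_product S p = affine_form l p * (\<Prod>k\<in>S - {l}. affine_form k p)"
        unfolding line_product_def using assms by (rule prod.remove)
      ultimately show ?thesis
        using True assms by (simp add: restrict_off_def restricted_monomial_def field_simps)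
    qed (simp add: restrict_off_def restricted_monomial_def)
  qed
  then show ?thesis using localized_functions_mult[OF prod h] assms(1) by simp
qed

text \<open>The weights control only the squares of the \<open>e i\<close>. Since \<open>e 0\<close>
  is \<open>1\<close> at the points, \<open>\<bar>e i\<bar>\<close> is at most half of
  \<open>(e i)^2 + (e 0)^2\<close>, so the functions themselves are summable too.\<close>

lemma summable_weighted:
  fixes e :: "nat \<Rightarrow> 'p \<Rightarrow> real"
  assumes w: "\<And>n. w n \<ge> 0" and small: "\<And>n i. i < m + n \<Longrightarrow> w n * (e i (p n))\<^sup>2 \<le> \<epsilon> / 2 ^ n"
    and e0: "\<And>n. e 0 (p n) = 1" and g: "g \<in> fn.span (range e)"
  shows "summable (\<lambda>n. w n * \<bar>g (p n)\<bar>)"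
proof -
  have basis: "summable (\<lambda>n. w n * \<bar>e i (p n)\<bar>)" for i
  proof (rule summable_comparison_test_ev)
    show "summable (\<lambda>n. \<epsilon> * (1/2) ^ n)" by (intro summable_mult summable_geometric) simp
    show "\<forall>\<^sub>F n in sequentially. norm (w n * \<bar>e i (p n)\<bar>) \<le> \<epsilon> * (1/2) ^ n"
      using eventually_gt_at_top[of i]
    proof eventually_elim
      case (elim n)
      have "\<bar>t\<bar> \<le> (t\<^sup>2 + 1) / 2" for t :: real
        using zero_le_power2[of "\<bar>t\<bar> - 1"] by (simp add: power2_eq_square algebra_simps)
      then have "w n * \<bar>e i (p n)\<bar> \<le> w n * (((e i (p n))\<^sup>2 + 1) / 2)"
        using w by (intro mult_left_mono)
      also have "\<dots> = (w n * (e i (p n))\<^sup>2 + w n * (e 0 (p n))\<^sup>2) / 2"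
        by (simp add: e0 distrib_left)
      also have "\<dots> \<le> (\<epsilon> / 2 ^ n + \<epsilon> / 2 ^ n) / 2"
        using small[of i n] small[of 0 n] elim by (intro divide_right_mono add_mono) auto
      finally show ?case using w[of n] by (simp add: power_one_over)
    qed
  qed
  obtain N c where "\<forall>n\<ge>N. \<forall>p. g p = (\<Sum>i<n. c i * e i p)"
    using span_range_sum[OF g] by blast
  then have gN: "g q = (\<Sum>i<N. c i * e i q)" for q by blast
  show ?thesis
  proof (rule summable_comparison_test)
    show "summable (\<lambda>n. \<Sum>i<N. \<bar>c i\<bar> * (w n * \<bar>e i (p n)\<bar>))"
      by (intro summable_sum summable_mult basis)
    have "\<bar>g (p n)\<bar> \<le> (\<Sum>i<N. \<bar>c i\<bar> * \<bar>e i (p n)\<bar>)" for n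
      unfolding gN by (rule order_trans[OF sum_abs]) (simp add: abs_mult)
    then have "w n * \<bar>g (p n)\<bar> \<le> w n * (\<Sum>i<N. \<bar>c i\<bar> * \<bar>e i (p n)\<bar>)" for n
      using w by (intro mult_left_mono)
    then show "\<exists>M. \<forall>n\<ge>M. norm (w n * \<bar>g (p n)\<bar>) \<le> (\<Sum>i<N. \<bar>c i\<bar> * (w n * \<bar>e i (p n)\<bar>))"
      using w by (simp add: sum_distrib_left mult_ac)
  qed
qed

text \<open>The least value of the form on the square is
  \<open>1 - \<bar>fst l\<bar> - \<bar>snd l\<bar>\<close>, so the hypothesis says precisely that
  the line misses the square.\<close>

lemma square_in_off_lines:
  assumes small: "\<And>l. l \<in> S \<Longrightarrow> \<bar>fst l\<bar> + \<bar>snd l\<bar> < 1" and xy: "\<bar>x\<bar> \<le> 1" "\<bar>y\<bar> \<le> 1"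
  shows "(x, y) \<in> off_lines S"
proof -
  have "affine_form l (x, y) > 0" if l: "l \<in> S" for l
  proof -
    have "\<bar>fst l * x + snd l * y\<bar> \<le> \<bar>fst l\<bar> * \<bar>x\<bar> + \<bar>snd l\<bar> * \<bar>y\<bar>"
      by (metis abs_mult abs_triangle_ineq)
    also have "\<dots> \<le> \<bar>fst l\<bar> * 1 + \<bar>snd l\<bar> * 1"
      using xy by (intro add_mono mult_left_mono) auto
    finally show ?thesis using small[OF l] by (simp add: affine_form_def)
  qed
  then show ?thesis by (force simp: off_lines_def)
qed

lemma separating_point_masses:
  assumes S: "finite S" "(0, 0) \<notin> S" and small: "\<And>l. l \<in> S \<Longrightarrow> \<bar>fst l\<bar> + \<bar>snd l\<bar> < 1"
  obtains p w where "\<And>n. p n \<in> off_lines S" "\<And>n::nat. w n \<ge> (0::real)"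
    "\<And>g. g \<in> localized_functions S \<Longrightarrow> summable (\<lambda>n. w n * \<bar>g (p n)\<bar>)"
    "\<And>g. g \<in> localized_functions S \<Longrightarrow>
       square_functional (\<lambda>x. (g x)\<^sup>2) + (suminf (\<lambda>n. w n * (g (p n))\<^sup>2)) \<ge> 0"
    "square_functional (\<lambda>x. motzkin (fst x) (snd x)) + suminf (\<lambda>n. w n * motzkin (fst (p n)) (snd (p n))) < 0"
proof -
  define X where "X = off_lines S"
  define m where "m = restricted_monomial X fst snd (\<lambda>_. 1)"
  obtain e :: "nat \<Rightarrow> real \<times> real \<Rightarrow> real" where e: "e 0 = m 0 0" "e 1 = m 2 1" "e 2 = m 1 2" "e 3 = m 1 1"
    and dom: "\<And>n. n \<ge> 4 \<Longrightarrow> dominates X (e n) (e ` {..<n})"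
    and loc: "localized_functions S \<subseteq> fn.span (range e)"
    proof (rule dominating_sequence[OF S, folded X_def, folded m_def])
    fix e' :: "nat \<Rightarrow> real \<times> real \<Rightarrow> real"
    assume "e' 0 = m 0 0" "e' 1 = m 2 1" "e' 2 = m 1 2" "e' 3 = m 1 1"
      "\<And>n. n \<ge> 4 \<Longrightarrow> dominates X (e' n) (e' ` {..<n})"
      "localized_functions S \<subseteq> fn.span (range e')"
    then show thesis by (rule that)
  qed
  have corner: "(x, y) \<in> X" if "\<bar>x\<bar> \<le> 1" "\<bar>y\<bar> \<le> 1" for x y
    unfolding X_def using small that by (rule square_in_off_lines)
  have m: "m i j p = (if p \<in> X then fst p ^ i * snd p ^ j else 0)" for i j p
    by (simp add: m_def restricted_monomial_def)
  have lin: "fn_linear (square_functional :: _ \<Rightarrow> real)"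
    by (auto simp: fn_linear_def square_functional_def algebra_simps)
  have pos: "square_functional (\<lambda>p. (\<Sum>i<4. c i * e i p)\<^sup>2) \<ge> 1 * (\<Sum>i<4. (c i)\<^sup>2)" for c
  proof -
    have sum4: "(\<Sum>i<4. f i) = f 0 + f 1 + f 2 + f 3" for f :: "nat \<Rightarrow> real"
      by (simp add: eval_nat_numeral)
    \<comment> \<open>At the corners the four functions form an orthogonal system, each with value
      \<open>2\<close> on its square under half the sum; at the origin only \<open>e 0\<close> is
      nonzero.\<close>
    have "square_functional (\<lambda>p. (\<Sum>i<4. c i * e i p)\<^sup>2) = 2 * (\<Sum>i<4. (c i)\<^sup>2) - (c 0)\<^sup>2"
      by (simp add: square_functional_def sum4 e[unfolded One_nat_def] e m corner power2_eq_square algebra_simps)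
    also have "\<dots> \<ge> (\<Sum>i<4. (c i)\<^sup>2)" by (simp add: sum4)
    finally show ?thesis by simp
  qed
  \<comment> \<open>Three functions bound the Motzkin polynomial, and the powers of
    \<open>1/2\<close> sum to \<open>2\<close>; with \<open>1/12\<close> the masses add at most
    \<open>3 * 2 / 12 = 1/2\<close>, less than the available \<open>1\<close>.\<close>
  obtain p w where pw: "\<And>n. p n \<in> X" "\<And>n. w n \<ge> 0"
    "\<And>n i. i < 4 + n \<Longrightarrow> w n * (e i (p n))\<^sup>2 \<le> (1/12) / 2 ^ n"
    "\<And>N c. square_functional (\<lambda>x. (\<Sum>i<4+N. c i * e i x)\<^sup>2) + (\<Sum>k<N. w k * (\<Sum>i<4+N. c i * e i (p k))\<^sup>2) \<ge> 0"
  proof (rule positive_point_masses[OF lin pos zero_less_one dom])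
    show "(1/12 :: real) > 0" by simp
    fix p' :: "nat \<Rightarrow> real \<times> real" and w' :: "nat \<Rightarrow> real"
    assume "\<And>n. p' n \<in> X" "\<And>n. w' n \<ge> 0"
      "\<And>n i. i < 4 + n \<Longrightarrow> w' n * (e i (p' n))\<^sup>2 \<le> (1/12) / 2 ^ n"
      "\<And>N c. square_functional (\<lambda>x. (\<Sum>i<4+N. c i * e i x)\<^sup>2) + (\<Sum>k<N. w' k * (\<Sum>i<4+N. c i * e i (p' k))\<^sup>2) \<ge> 0"
    then show thesis by (rule that)
  qed
  have e0: "e 0 (p n) = 1" for n by (simp add: e m pw)
  have summ: "summable (\<lambda>n. w n * \<bar>g (p n)\<bar>)" if "g \<in> localized_functions S" for g
    using summable_weighted[of w 4 e p, OF pw(2,3) e0] loc that by blast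
  show thesis
  proof (rule that[of p w])
    fix g assume g: "g \<in> localized_functions S"
    have "g * g \<in> localized_functions S" by (rule localized_functions_mult[OF g g])
    from summ[OF this] have sum2: "summable (\<lambda>n. w n * (g (p n))\<^sup>2)"
      by (simp add: power2_eq_square)
    obtain N c where Nc: "\<And>n q. n \<ge> N \<Longrightarrow> g q = (\<Sum>i<n. c i * e i q)"
      using span_range_sum[of g e] loc g by blast
    \<comment> \<open>The first \<open>N\<close> masses already make the functional nonnegative on
      squares from the span of the first \<open>4 + N\<close> functions; all later masses only add
      nonnegative terms.\<close>
    have "0 \<le> square_functional (\<lambda>x. (g x)\<^sup>2) + (\<Sum>k<N. w k * (g (p k))\<^sup>2)"
      using pw(4)[of c N] Nc[of "4 + N"] by simp
    also have "(\<Sum>k<N. w k * (g (p k))\<^sup>2) \<le> (suminf (\<lambda>n. w n * (g (p n))\<^sup>2))"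
      using sum2 pw(2) by (intro sum_le_suminf) auto
    finally show "square_functional (\<lambda>x. (g x)\<^sup>2) + (suminf (\<lambda>n. w n * (g (p n))\<^sup>2)) \<ge> 0" by simp
  next
    have bound: "w n * motzkin (fst (p n)) (snd (p n)) \<le> (1/4) * (1/2) ^ n" for n
    proof -
      \<comment> \<open>Drops the nonpositive term \<open>- 3 * x^2 * y^2\<close>; what is left is
        the sum of the squares of the first three functions.\<close>
      have "motzkin (fst (p n)) (snd (p n)) \<le> (e 0 (p n))\<^sup>2 + (e 1 (p n))\<^sup>2 + (e 2 (p n))\<^sup>2"
        by (simp add: e[unfolded One_nat_def] e m pw motzkin_def power_mult_distrib flip: power_mult)
      then have "w n * motzkin (fst (p n)) (snd (p n)) \<le> w n * ((e 0 (p n))\<^sup>2 + (e 1 (p n))\<^sup>2 + (e 2 (p n))\<^sup>2)"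
        using pw(2) by (intro mult_left_mono)
      also have "\<dots> \<le> (1/12) / 2 ^ n + (1/12) / 2 ^ n + (1/12) / 2 ^ n"
        unfolding distrib_left by (intro add_mono pw(3)) auto
      finally show ?thesis by (simp add: power_one_over)
    qed
    have geo: "summable (\<lambda>n. (1/4) * (1/2 :: real) ^ n)" by (intro summable_mult summable_geometric) simp
    have nn: "w n * motzkin (fst (p n)) (snd (p n)) \<ge> 0" for n
      using pw(2) motzkin_nonneg by simp
    have "suminf (\<lambda>n. w n * motzkin (fst (p n)) (snd (p n))) \<le> suminf (\<lambda>n. (1/4) * (1/2) ^ n)"
      using bound nn geo by (intro suminf_le summable_comparison_test[OF _ geo]) auto
    also have "\<dots> = (1/4) * suminf (\<lambda>n. (1/2) ^ n)" by (rule suminf_mult) (intro summable_geometric, simp)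
    also have "\<dots> = 1/2" by (subst suminf_geometric) auto
    finally show "square_functional (\<lambda>x. motzkin (fst x) (snd x)) + suminf (\<lambda>n. w n * motzkin (fst (p n)) (snd (p n))) < 0"
      by (simp add: square_functional_def motzkin_def)
  qed (use pw summ X_def in auto)
qed

section \<open>Evaluation of rational functions\<close>

text \<open>\<open>\<sigma>\<close> gives the four variables independent values. Compatibility with
  the involution is a separate hypothesis wherever it matters.\<close>

definition mono_eval :: "(var \<Rightarrow> complex) \<Rightarrow> mono \<Rightarrow> complex" where
  "mono_eval \<sigma> m = \<sigma> Z1 ^ Poly_Mapping.lookup m Z1 * \<sigma> Z2 ^ Poly_Mapping.lookup m Z2 *
     (\<sigma> Z1_bar ^ Poly_Mapping.lookup m Z1_bar * \<sigma> Z2_bar ^ Poly_Mapping.lookup m Z2_bar)"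

definition poly_eval :: "(var \<Rightarrow> complex) \<Rightarrow> cpoly \<Rightarrow> complex" where
  "poly_eval \<sigma> p = (\<Sum>m\<in>Poly_Mapping.keys p. Poly_Mapping.lookup p m * mono_eval \<sigma> m)"

lemma mono_eval_zero [simp]: "mono_eval \<sigma> 0 = 1"
  by (simp add: mono_eval_def)

lemma mono_eval_add: "mono_eval \<sigma> (m + n) = mono_eval \<sigma> m * mono_eval \<sigma> n"
  by (simp add: mono_eval_def lookup_add power_add)

lemma mono_eval_single [simp]: "mono_eval \<sigma> (Poly_Mapping.single v k) = \<sigma> v ^ k"
  by (cases v) (simp_all add: mono_eval_def lookup_single when_def)

lemma poly_eval_superset:
  assumes "finite S" "Poly_Mapping.keys p \<subseteq> S"
  shows "poly_eval \<sigma> p = (\<Sum>m\<in>S. Poly_Mapping.lookup p m * mono_eval \<sigma> m)"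
  unfolding poly_eval_def using assms by (intro sum.mono_neutral_left) (auto simp: in_keys_iff)

lemma poly_eval_zero [simp]: "poly_eval \<sigma> 0 = 0"
  by (simp add: poly_eval_def)

lemma poly_eval_add [simp]: "poly_eval \<sigma> (p + q) = poly_eval \<sigma> p + poly_eval \<sigma> q"
proof -
  let ?S = "Poly_Mapping.keys p \<union> Poly_Mapping.keys q"
  have "Poly_Mapping.keys (p + q) \<subseteq> ?S" by (rule Poly_Mapping.keys_add)
  then show ?thesis
    by (simp add: poly_eval_superset[of ?S] lookup_add sum.distrib distrib_right)
qed

lemma poly_eval_single [simp]: "poly_eval \<sigma> (Poly_Mapping.single m c) = c * mono_eval \<sigma> m"
  by (simp add: poly_eval_superset[of "{m}"])

lemma poly_eval_mult [simp]: "poly_eval \<sigma> (p * q) = poly_eval \<sigma> p * poly_eval \<sigma> q"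
proof (induction p rule: cpoly_induct)
  case zero
  show ?case by simp
next
  case (add_single m c p)
  have "poly_eval \<sigma> (Poly_Mapping.single m c * q) = c * mono_eval \<sigma> m * poly_eval \<sigma> q"
  proof (induction q rule: cpoly_induct)
    case zero
    show ?case by simp
  next
    case (add_single n d q)
    then show ?case by (simp add: distrib_left mult_single mono_eval_add)
  qed
  with add_single show ?case by (simp add: distrib_right)
qed

lemma poly_eval_one [simp]: "poly_eval \<sigma> 1 = 1"
  using poly_eval_single[of \<sigma> 0 1] by (simp del: poly_eval_single)

lemma poly_eval_pconst [simp]: "poly_eval \<sigma> (pconst c) = c"
  by (simp add: pconst_def)

lemma poly_eval_pvar [simp]: "poly_eval \<sigma> (pvar v) = \<sigma> v"
  by (simp add: pvar_def)

lemma poly_eval_pstar: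
  assumes "\<And>v. \<sigma> (conj_var v) = cnj (\<sigma> v)"
  shows "poly_eval \<sigma> (pstar p) = cnj (poly_eval \<sigma> p)"
proof (induction p rule: cpoly_induct)
  case zero
  show ?case by simp
next
  case (add_single m c p)
  have "mono_eval \<sigma> (mono_star m) = cnj (mono_eval \<sigma> m)"
    using assms[of Z1] assms[of Z2]
    by (simp add: mono_eval_def mono_star_def map_key.rep_eq mult_ac)
  with add_single show ?case by (simp add: pstar_add pstar_single)
qed

text \<open>A fraction has no distinguished reduced form here, so it counts as defined if some
  representation has a nonvanishing denominator; cross-multiplication shows that the value does not
  depend on which.\<close>

definition rat_defined :: "(var \<Rightarrow> complex) \<Rightarrow> crat \<Rightarrow> bool" where
  "rat_defined \<sigma> a \<longleftrightarrow> (\<exists>p q. a = Fract p q \<and> poly_eval \<sigma> q \<noteq> 0)"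

definition rat_eval :: "(var \<Rightarrow> complex) \<Rightarrow> crat \<Rightarrow> complex" where
  "rat_eval \<sigma> a = (THE c. \<exists>p q. a = Fract p q \<and> poly_eval \<sigma> q \<noteq> 0 \<and> c = poly_eval \<sigma> p / poly_eval \<sigma> q)"

lemma rat_defined_Fract: "poly_eval \<sigma> q \<noteq> 0 \<Longrightarrow> rat_defined \<sigma> (Fract p q)"
  by (auto simp: rat_defined_def)

lemma rat_eval_Fract:
  assumes "poly_eval \<sigma> q \<noteq> 0"
  shows "rat_eval \<sigma> (Fract p q) = poly_eval \<sigma> p / poly_eval \<sigma> q"
  unfolding rat_eval_def
proof (rule the_equality)
  show "\<exists>p' q'. Fract p q = Fract p' q' \<and> poly_eval \<sigma> q' \<noteq> 0 \<and>
    poly_eval \<sigma> p / poly_eval \<sigma> q = poly_eval \<sigma> p' / poly_eval \<sigma> q'"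
    using assms by blast
next
  fix c
  assume "\<exists>p' q'. Fract p q = Fract p' q' \<and> poly_eval \<sigma> q' \<noteq> 0 \<and> c = poly_eval \<sigma> p' / poly_eval \<sigma> q'"
  then obtain p' q' where *: "Fract p q = Fract p' q'" "poly_eval \<sigma> q' \<noteq> 0"
    "c = poly_eval \<sigma> p' / poly_eval \<sigma> q'" by blast
  have "q \<noteq> 0" "q' \<noteq> 0" using assms *(2) by auto
  then have "p * q' = p' * q" using *(1) by (simp add: eq_fract)
  then have "poly_eval \<sigma> p * poly_eval \<sigma> q' = poly_eval \<sigma> p' * poly_eval \<sigma> q"
    by (metis poly_eval_mult)
  then show "c = poly_eval \<sigma> p / poly_eval \<sigma> q"
    using * assms by (simp add: frac_eq_eq)
qed

lemma rat_defined_cases: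
  assumes "rat_defined \<sigma> a"
  obtains p q where "a = Fract p q" "poly_eval \<sigma> q \<noteq> 0" "q \<noteq> 0"
    "rat_eval \<sigma> a = poly_eval \<sigma> p / poly_eval \<sigma> q"
  using assms unfolding rat_defined_def by (metis poly_eval_zero rat_eval_Fract)

lemma rat_eval_add:
  assumes "rat_defined \<sigma> a" "rat_defined \<sigma> b"
  shows "rat_defined \<sigma> (a + b)" "rat_eval \<sigma> (a + b) = rat_eval \<sigma> a + rat_eval \<sigma> b"
proof -
  obtain p q where a: "a = Fract p q" "poly_eval \<sigma> q \<noteq> 0" "q \<noteq> 0"
    "rat_eval \<sigma> a = poly_eval \<sigma> p / poly_eval \<sigma> q" using assms(1) by (rule rat_defined_cases)
  obtain r s where b: "b = Fract r s" "poly_eval \<sigma> s \<noteq> 0" "s \<noteq> 0"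
    "rat_eval \<sigma> b = poly_eval \<sigma> r / poly_eval \<sigma> s" using assms(2) by (rule rat_defined_cases)
  have *: "a + b = Fract (p * s + r * q) (q * s)" using a b by simp
  have "poly_eval \<sigma> (q * s) \<noteq> 0" using a b by simp
  then show "rat_defined \<sigma> (a + b)" "rat_eval \<sigma> (a + b) = rat_eval \<sigma> a + rat_eval \<sigma> b"
    unfolding * using a(2,4) b(2,4) by (simp_all add: rat_defined_Fract rat_eval_Fract add_frac_eq)
qed

lemma rat_eval_mult:
  assumes "rat_defined \<sigma> a" "rat_defined \<sigma> b"
  shows "rat_defined \<sigma> (a * b)" "rat_eval \<sigma> (a * b) = rat_eval \<sigma> a * rat_eval \<sigma> b"
proof -
  obtain p q where a: "a = Fract p q" "poly_eval \<sigma> q \<noteq> 0" "q \<noteq> 0"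
    "rat_eval \<sigma> a = poly_eval \<sigma> p / poly_eval \<sigma> q" using assms(1) by (rule rat_defined_cases)
  obtain r s where b: "b = Fract r s" "poly_eval \<sigma> s \<noteq> 0" "s \<noteq> 0"
    "rat_eval \<sigma> b = poly_eval \<sigma> r / poly_eval \<sigma> s" using assms(2) by (rule rat_defined_cases)
  have *: "a * b = Fract (p * r) (q * s)" using a b by simp
  have "poly_eval \<sigma> (q * s) \<noteq> 0" using a b by simp
  then show "rat_defined \<sigma> (a * b)" "rat_eval \<sigma> (a * b) = rat_eval \<sigma> a * rat_eval \<sigma> b"
    unfolding * using a(2,4) b(2,4) by (simp_all add: rat_defined_Fract rat_eval_Fract)
qed

lemma rat_eval_of_poly [simp]:
  "rat_defined \<sigma> (rat_of_poly p)" "rat_eval \<sigma> (rat_of_poly p) = poly_eval \<sigma> p"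
  by (simp_all add: rat_of_poly_def rat_defined_Fract rat_eval_Fract)

lemma rat_eval_one [simp]: "rat_defined \<sigma> 1" "rat_eval \<sigma> 1 = 1"
  by (simp_all add: One_fract_def rat_defined_Fract rat_eval_Fract)

lemma rat_eval_scale:
  assumes "rat_defined \<sigma> a"
  shows "rat_defined \<sigma> (crat_scale c a)" "rat_eval \<sigma> (crat_scale c a) = c * rat_eval \<sigma> a"
  using assms by (simp_all add: crat_scale_def rat_eval_mult)

lemma rat_eval_inverse_of_poly:
  assumes "poly_eval \<sigma> p \<noteq> 0"
  shows "rat_defined \<sigma> (inverse (rat_of_poly p))"
    "rat_eval \<sigma> (inverse (rat_of_poly p)) = inverse (poly_eval \<sigma> p)"
proof -
  have "inverse (rat_of_poly p) = Fract 1 p" by (simp add: rat_of_poly_def)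
  then show "rat_defined \<sigma> (inverse (rat_of_poly p))"
    "rat_eval \<sigma> (inverse (rat_of_poly p)) = inverse (poly_eval \<sigma> p)"
    using assms by (simp_all add: rat_defined_Fract rat_eval_Fract inverse_eq_divide)
qed

lemma rat_eval_star:
  assumes "\<And>v. \<sigma> (conj_var v) = cnj (\<sigma> v)" "rat_defined \<sigma> a"
  shows "rat_eval \<sigma> (crat_star a) = cnj (rat_eval \<sigma> a)"
  using assms(2)
proof (rule rat_defined_cases)
  fix p q assume "a = Fract p q" "poly_eval \<sigma> q \<noteq> 0" "rat_eval \<sigma> a = poly_eval \<sigma> p / poly_eval \<sigma> q"
  then show ?thesis
    by (simp add: crat_star_Fract rat_eval_Fract poly_eval_pstar[of \<sigma>, OF assms(1)])
qed

lemma linear_poly_eval: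
  assumes "linear_poly f"
  obtains a b c where "\<And>\<sigma>. poly_eval \<sigma> f = a * \<sigma> Z1 + b * \<sigma> Z2 + c" "a \<noteq> 0 \<or> b \<noteq> 0"
proof -
  define deg where "deg m = (\<Sum>v\<in>Poly_Mapping.keys m. Poly_Mapping.lookup m v)" for m :: mono
  let ?s1 = "Poly_Mapping.single Z1 1 :: mono" and ?s2 = "Poly_Mapping.single Z2 1 :: mono"
  have max: "Max (insert 0 (deg ` Poly_Mapping.keys f)) = 1"
    using assms by (simp add: linear_poly_def total_degree_def deg_def)
  have le: "deg m \<le> 1" if "m \<in> Poly_Mapping.keys f" for m
  proof -
    have "deg m \<le> Max (insert 0 (deg ` Poly_Mapping.keys f))"
      using that by (intro Max_ge) auto
    then show ?thesis by (simp only: max)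
  qed
  have "Max (insert 0 (deg ` Poly_Mapping.keys f)) \<in> insert 0 (deg ` Poly_Mapping.keys f)"
    by (rule Max_in) auto
  \<comment> \<open>The maximum is \<open>1\<close>, hence not the inserted default
    \<open>0\<close>, so a monomial of \<open>f\<close> attains it.\<close>
  then obtain m1 where m1: "m1 \<in> Poly_Mapping.keys f" "deg m1 = 1"
    unfolding max by force
  have mono: "m = 0 \<or> m = ?s1 \<or> m = ?s2" if "m \<in> Poly_Mapping.keys f" for m
  proof -
    have sub: "Poly_Mapping.keys m \<subseteq> {Z1, Z2}"
      using assms that by (auto simp: linear_poly_def poly_vars_def)
    then have "deg m = (\<Sum>v\<in>{Z1, Z2}. Poly_Mapping.lookup m v)"
      unfolding deg_def by (intro sum.mono_neutral_left) (auto simp: in_keys_iff)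
    then have d: "Poly_Mapping.lookup m Z1 + Poly_Mapping.lookup m Z2 \<le> 1"
      using le[OF that] by simp
    have z: "Poly_Mapping.lookup m Z1_bar = 0" "Poly_Mapping.lookup m Z2_bar = 0"
      using sub by (auto simp: in_keys_iff)
    consider "Poly_Mapping.lookup m Z1 = 0" "Poly_Mapping.lookup m Z2 = 0"
      | "Poly_Mapping.lookup m Z1 = 1" "Poly_Mapping.lookup m Z2 = 0"
      | "Poly_Mapping.lookup m Z1 = 0" "Poly_Mapping.lookup m Z2 = 1" using d by linarith
    then show ?thesis
    proof cases
      case 1
      then have "m = 0"
        by (intro poly_mapping_eqI) (metis z lookup_zero var.exhaust)
      then show ?thesis by simp
    next
      case 2
      have "m = ?s1"
      proof (rule poly_mapping_eqI)
        fix v show "Poly_Mapping.lookup m v = Poly_Mapping.lookup ?s1 v"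
          using 2 z by (cases v) (simp_all add: lookup_single when_def)
      qed
      then show ?thesis by simp
    next
      case 3
      have "m = ?s2"
      proof (rule poly_mapping_eqI)
        fix v show "Poly_Mapping.lookup m v = Poly_Mapping.lookup ?s2 v"
          using 3 z by (cases v) (simp_all add: lookup_single when_def)
      qed
      then show ?thesis by simp
    qed
  qed
  have ne: "?s1 \<noteq> ?s2" "?s1 \<noteq> 0" "?s2 \<noteq> 0"
    by (metis lookup_single_eq lookup_single_not_eq var.distinct(1) zero_neq_one,
        metis lookup_single_eq lookup_zero zero_neq_one,
        metis lookup_single_eq lookup_zero zero_neq_one)
  have "poly_eval \<sigma> f = (\<Sum>m\<in>{0, ?s1, ?s2}. Poly_Mapping.lookup f m * mono_eval \<sigma> m)" for \<sigma>
    using mono by (intro poly_eval_superset) auto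
  then have "poly_eval \<sigma> f = Poly_Mapping.lookup f ?s1 * \<sigma> Z1 + Poly_Mapping.lookup f ?s2 * \<sigma> Z2
      + Poly_Mapping.lookup f 0" for \<sigma>
    using ne by (simp add: ne[symmetric] add_ac)
  moreover have "m1 \<noteq> 0" using m1(2) by (auto simp: deg_def)
  then have "Poly_Mapping.lookup f ?s1 \<noteq> 0 \<or> Poly_Mapping.lookup f ?s2 \<noteq> 0"
    using m1(1) mono by (auto simp: in_keys_iff)
  ultimately show thesis using that by blast
qed

section \<open>Complex functions with localized real and imaginary parts\<close>

definition complex_localized :: "(real \<times> real) set \<Rightarrow> (real \<times> real \<Rightarrow> complex) \<Rightarrow> bool" where
  "complex_localized S F \<longleftrightarrow> restrict_off S (\<lambda>p. Re (F p)) \<in> localized_functions S \<and>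
     restrict_off S (\<lambda>p. Im (F p)) \<in> localized_functions S"

lemma restrict_off_cong:
  "(\<And>p. p \<in> off_lines S \<Longrightarrow> f p = g p) \<Longrightarrow> restrict_off S f = restrict_off S g"
  by (auto simp: restrict_off_def fun_eq_iff)

lemma complex_localized_cong:
  assumes "complex_localized S F" "\<And>p. p \<in> off_lines S \<Longrightarrow> F p = G p"
  shows "complex_localized S G"
proof -
  have "restrict_off S (\<lambda>p. Re (G p)) = restrict_off S (\<lambda>p. Re (F p))"
    "restrict_off S (\<lambda>p. Im (G p)) = restrict_off S (\<lambda>p. Im (F p))"
    by (rule restrict_off_cong, simp add: assms(2))+
  then show ?thesis using assms(1) by (simp add: complex_localized_def)
qed

lemma complex_localized_add:
  assumes "complex_localized S F" "complex_localized S G"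
  shows "complex_localized S (\<lambda>p. F p + G p)"
proof -
  have "restrict_off S (\<lambda>p. Re (F p + G p)) = restrict_off S (\<lambda>p. Re (F p)) + restrict_off S (\<lambda>p. Re (G p))"
    "restrict_off S (\<lambda>p. Im (F p + G p)) = restrict_off S (\<lambda>p. Im (F p)) + restrict_off S (\<lambda>p. Im (G p))"
    by (auto simp: restrict_off_def fun_eq_iff)
  then show ?thesis
    using assms localized_functions_add by (simp only: complex_localized_def)
qed

lemma complex_localized_mult:
  assumes "complex_localized S F" "complex_localized S G"
  shows "complex_localized S (\<lambda>p. F p * G p)"
proof -
  let ?r = "\<lambda>H. restrict_off S (\<lambda>p. Re (H p))" and ?i = "\<lambda>H. restrict_off S (\<lambda>p. Im (H p))"
  have "restrict_off S (\<lambda>p. Re (F p * G p)) = ?r F * ?r G + (\<lambda>p. (-1) * (?i F * ?i G) p)"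
    "restrict_off S (\<lambda>p. Im (F p * G p)) = ?r F * ?i G + ?i F * ?r G"
    by (auto simp: restrict_off_def fun_eq_iff)
  then show ?thesis
    using assms unfolding complex_localized_def
    by (simp only:) (intro conjI localized_functions_add localized_functions_mult localized_functions_scale; simp)
qed

lemma complex_localized_affine:
  "complex_localized S (\<lambda>p. a + b * complex_of_real (fst p) + c * complex_of_real (snd p))"
  using restrict_off_affine[of S "Re a" "Re b" "Re c"] restrict_off_affine[of S "Im a" "Im b" "Im c"]
  by (simp add: complex_localized_def)

lemma complex_localized_const: "complex_localized S (\<lambda>p. c)"
  using complex_localized_affine[of S c 0 0] by simp

lemma complex_localized_cnj:
  assumes "complex_localized S F"
  shows "complex_localized S (\<lambda>p. cnj (F p))"
proof -
  have "restrict_off S (\<lambda>p. Im (cnj (F p))) = (\<lambda>p. (-1) * restrict_off S (\<lambda>p. Im (F p)) p)"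
    by (auto simp: restrict_off_def fun_eq_iff)
  moreover have "(\<lambda>p. (-1) * restrict_off S (\<lambda>p. Im (F p)) p) \<in> localized_functions S"
    using assms by (intro localized_functions_scale) (simp add: complex_localized_def)
  ultimately show ?thesis using assms by (simp add: complex_localized_def)
qed

lemma complex_localized_inverse:
  assumes "finite S" "l \<in> S"
  shows "complex_localized S (\<lambda>p. inverse (complex_of_real (affine_form l p)))"
proof -
  have "restrict_off S (\<lambda>p. Im (complex_of_real (inverse (affine_form l p)))) = (\<lambda>p. 0 * restrict_off S (\<lambda>p. inverse (affine_form l p)) p)"
    by (auto simp: restrict_off_def fun_eq_iff)
  then have "complex_localized S (\<lambda>p. complex_of_real (inverse (affine_form l p)))"
    using restrict_off_inverse[OF assms] localized_functions_scale[OF restrict_off_inverse[OF assms], of 0]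
    by (simp only: complex_localized_def Re_complex_of_real)
  then show ?thesis by simp
qed

section \<open>Polynomials inside \<open>A\<close>, and characters on the Motzkin expression\<close>

lemma localized_algebra_closed:
  "1 \<in> localized_algebra f1 f2 f3"
  "a \<in> localized_algebra f1 f2 f3 \<Longrightarrow> b \<in> localized_algebra f1 f2 f3 \<Longrightarrow> a + b \<in> localized_algebra f1 f2 f3"
  "a \<in> localized_algebra f1 f2 f3 \<Longrightarrow> b \<in> localized_algebra f1 f2 f3 \<Longrightarrow> a * b \<in> localized_algebra f1 f2 f3"
  "a \<in> localized_algebra f1 f2 f3 \<Longrightarrow> crat_scale c a \<in> localized_algebra f1 f2 f3"
  unfolding localized_algebra_def
  by (auto intro: generated_algebra.one generated_algebra.add generated_algebra.mult generated_algebra.scale)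

lemma rat_of_poly_add: "rat_of_poly (p + q) = rat_of_poly p + rat_of_poly q"
  by (simp add: rat_of_poly_def)

lemma rat_of_poly_mult: "rat_of_poly (p * q) = rat_of_poly p * rat_of_poly q"
  by (simp add: rat_of_poly_def)

lemma monomial_in_localized_algebra:
  fixes m :: mono
  shows "rat_of_poly (Poly_Mapping.single m 1) \<in> localized_algebra f1 f2 f3"
proof (induction m rule: update_induct)
  case const
  have "rat_of_poly (Poly_Mapping.single 0 1) = 1" by (simp add: rat_of_poly_def One_fract_def)
  then show ?case by (simp add: localized_algebra_closed)
next
  case (update m v k)
  have var: "rat_of_poly (pvar v) \<in> localized_algebra f1 f2 f3"
    unfolding localized_algebra_def by (cases v) (auto intro: generated_algebra.gen)
  have pow: "rat_of_poly (Poly_Mapping.single (Poly_Mapping.single v k) 1) \<in> localized_algebra f1 f2 f3" for k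
  proof (induction k)
    case 0
    have "rat_of_poly (Poly_Mapping.single 0 1) = 1" by (simp add: rat_of_poly_def One_fract_def)
    then show ?case by (simp add: localized_algebra_closed)
  next
    case (Suc k)
    have "Poly_Mapping.single (Poly_Mapping.single v (Suc k)) 1 = pvar v * Poly_Mapping.single (Poly_Mapping.single v k) 1"
      by (simp add: pvar_def mult_single flip: single_add)
    then show ?case using Suc var by (simp add: rat_of_poly_mult localized_algebra_closed)
  qed
  have "Poly_Mapping.update v k m = Poly_Mapping.single v k + m"
    using update.hyps
    by (intro poly_mapping_eqI)
       (auto simp add: lookup_update lookup_add lookup_single when_def in_keys_iff split: if_splits)
  then have "Poly_Mapping.single (Poly_Mapping.update v k m) (1 :: complex)
    = Poly_Mapping.single (Poly_Mapping.single v k) 1 * Poly_Mapping.single m 1"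
    by (simp add: mult_single)
  then show ?case using pow update.IH by (simp add: rat_of_poly_mult localized_algebra_closed)
qed

lemma rat_of_poly_in_localized_algebra: "rat_of_poly p \<in> localized_algebra f1 f2 f3"
proof (induction p rule: cpoly_induct)
  case zero
  have "rat_of_poly 0 = crat_scale 0 1" by (simp add: rat_of_poly_def crat_scale_def pconst_def)
  then show ?case by (simp add: localized_algebra_closed)
next
  case (add_single m c p)
  have "Poly_Mapping.single m c = pconst c * Poly_Mapping.single m 1"
    by (simp add: pconst_def mult_single)
  then have "rat_of_poly (Poly_Mapping.single m c) = crat_scale c (rat_of_poly (Poly_Mapping.single m 1))"
    by (simp add: rat_of_poly_mult crat_scale_def)
  then show ?case
    using add_single by (simp add: rat_of_poly_add localized_algebra_closed monomial_in_localized_algebra)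
qed

lemma character_power:
  assumes \<phi>: "\<phi> \<in> characters s C" and C: "1 \<in> C" "\<And>a b. a \<in> C \<Longrightarrow> b \<in> C \<Longrightarrow> a * b \<in> C" and x: "x \<in> C"
  shows "x ^ n \<in> C \<and> \<phi> (x ^ n) = \<phi> x ^ n"
  by (induction n) (use assms in \<open>auto simp: characters_def\<close>)

text \<open>Stated for any scalar field, so that it applies to \<open>A\<close> over the complex
  numbers and to its hermitean part over the reals.\<close>

lemma character_motzkin:
  assumes \<phi>: "\<phi> \<in> characters s C" and C: "1 \<in> C" "\<And>a b. a \<in> C \<Longrightarrow> b \<in> C \<Longrightarrow> a * b \<in> C"
    "\<And>a b. a \<in> C \<Longrightarrow> b \<in> C \<Longrightarrow> a + b \<in> C" "\<And>a. a \<in> C \<Longrightarrow> s (- 3) a \<in> C"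
    and x: "x \<in> C" and y: "y \<in> C"
  shows "\<phi> (x^4 * y^2 + x^2 * y^4 + 1 + s (- 3) (x^2 * y^2)) = motzkin (\<phi> x) (\<phi> y)"
proof -
  note px = character_power[OF \<phi> C(1,2) x] and py = character_power[OF \<phi> C(1,2) y]
  have add: "\<phi> (a + b) = \<phi> a + \<phi> b" and mult: "\<phi> (a * b) = \<phi> a * \<phi> b" if "a \<in> C" "b \<in> C" for a b
    using \<phi> that by (auto simp: characters_def linear_functional_def)
  have scale: "\<phi> (s c a) = c * \<phi> a" if "a \<in> C" for a c
    using \<phi> that by (auto simp: characters_def linear_functional_def)
  have one: "\<phi> 1 = 1" using \<phi> by (auto simp: characters_def)
  show ?thesis
    using px py C by (simp add: add mult scale one motzkin_def)
qed

lemma point_mass_summable: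
  assumes w: "\<And>n. w n \<ge> (0::real)"
    and summ: "\<And>g. g \<in> localized_functions S \<Longrightarrow> summable (\<lambda>n. w n * \<bar>g (p n)\<bar>)"
    and p: "\<And>n. p n \<in> off_lines S" and F: "complex_localized S F"
  shows "summable (\<lambda>n. complex_of_real (w n) * F (p n))"
proof (rule summable_norm_cancel, rule summable_comparison_test)
  show "summable (\<lambda>n. w n * \<bar>restrict_off S (\<lambda>p. Re (F p)) (p n)\<bar> + w n * \<bar>restrict_off S (\<lambda>p. Im (F p)) (p n)\<bar>)"
    using F by (intro summable_add summ) (auto simp: complex_localized_def)
  have "norm (complex_of_real (w n) * F (p n)) \<le> w n * (\<bar>Re (F (p n))\<bar> + \<bar>Im (F (p n))\<bar>)" for n
    using w[of n] by (auto simp: norm_mult intro!: mult_left_mono cmod_le)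
  then show "\<exists>N. \<forall>n\<ge>N. norm (norm (complex_of_real (w n) * F (p n))) \<le>
      w n * \<bar>restrict_off S (\<lambda>p. Re (F p)) (p n)\<bar> + w n * \<bar>restrict_off S (\<lambda>p. Im (F p)) (p n)\<bar>"
    by (simp add: restrict_off_def p distrib_left)
qed

section \<open>Real planes in complex two-space\<close>

text \<open>\<open>\<sigma> p\<close> is the point with real parameters \<open>p\<close>, together
  with its conjugate coordinates. An \<open>f\<close> may be constant on the plane, which happens
  for parallel forms. \<open>X\<close> and \<open>Y\<close> are polynomials, not just functions on
  the plane, because the Motzkin element has to lie in \<open>A\<close> and be hermitean.\<close>

locale real_plane =
  fixes S :: "(real \<times> real) set" and \<sigma> :: "real \<times> real \<Rightarrow> var \<Rightarrow> complex" and f1 f2 f3 X Y :: cpoly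
  assumes finite_lines: "finite S" and lines_nonconst: "(0, 0) \<notin> S"
    and lines_far: "\<And>l. l \<in> S \<Longrightarrow> \<bar>fst l\<bar> + \<bar>snd l\<bar> < 1"
    and conj: "\<And>p v. \<sigma> p (conj_var v) = cnj (\<sigma> p v)"
    and affine_Z1: "\<exists>a b c. \<forall>p. \<sigma> p Z1 = a + b * complex_of_real (fst p) + c * complex_of_real (snd p)"
    and affine_Z2: "\<exists>a b c. \<forall>p. \<sigma> p Z2 = a + b * complex_of_real (fst p) + c * complex_of_real (snd p)"
    and linear: "\<And>f. f \<in> {f1, f2, f3} \<Longrightarrow> \<exists>\<nu>. \<nu> \<noteq> 0 \<and> ((\<forall>p. poly_eval (\<sigma> p) f = \<nu>) \<or>
      (\<exists>l\<in>S. \<forall>p. poly_eval (\<sigma> p) f = \<nu> * complex_of_real (affine_form l p)))"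
    and hermitean: "pstar X = X" "pstar Y = Y"
    and coordinates: "\<And>p. poly_eval (\<sigma> p) X = complex_of_real (fst p)"
      "\<And>p. poly_eval (\<sigma> p) Y = complex_of_real (snd p)"
begin

abbreviation "A \<equiv> localized_algebra f1 f2 f3"
abbreviation "x \<equiv> rat_of_poly X"
abbreviation "y \<equiv> rat_of_poly Y"
abbreviation "eval a p \<equiv> rat_eval (\<sigma> p) a"

definition motzkin_element :: crat where
  "motzkin_element = x^4 * y^2 + x^2 * y^4 + 1 + crat_scale (- 3) (x^2 * y^2)"

lemma linear_nonzero:
  assumes "f \<in> {f1, f2, f3}" "p \<in> off_lines S"
  shows "poly_eval (\<sigma> p) f \<noteq> 0"
proof -
  from linear[OF assms(1)] obtain \<nu> where nu: "\<nu> \<noteq> 0" "poly_eval (\<sigma> p) f = \<nu> \<or>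
      (\<exists>l\<in>S. poly_eval (\<sigma> p) f = \<nu> * complex_of_real (affine_form l p))" by blast
  then show ?thesis using assms(2) by (auto simp: off_lines_def)
qed

lemma linear_inverse_localized:
  assumes "f \<in> {f1, f2, f3}"
  shows "complex_localized S (\<lambda>p. inverse (poly_eval (\<sigma> p) f))"
proof -
  from linear[OF assms] obtain \<nu> where nu: "\<nu> \<noteq> 0" "(\<forall>p. poly_eval (\<sigma> p) f = \<nu>) \<or>
      (\<exists>l\<in>S. \<forall>p. poly_eval (\<sigma> p) f = \<nu> * complex_of_real (affine_form l p))" by blast
  from nu(2) show ?thesis
  proof
    assume "\<forall>p. poly_eval (\<sigma> p) f = \<nu>"
    then have "\<And>p. poly_eval (\<sigma> p) f = \<nu>" by blast
    then show ?thesis by (simp add: complex_localized_const)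
  next
    assume "\<exists>l\<in>S. \<forall>p. poly_eval (\<sigma> p) f = \<nu> * complex_of_real (affine_form l p)"
    then obtain l where l: "l \<in> S" "\<And>p. poly_eval (\<sigma> p) f = \<nu> * complex_of_real (affine_form l p)" by blast
    show ?thesis
      using complex_localized_mult[OF complex_localized_const[of S "inverse \<nu>"]
          complex_localized_inverse[OF finite_lines l(1)]]
      by (simp add: l(2) mult.commute)
  qed
qed

lemma variable_localized: "complex_localized S (\<lambda>p. \<sigma> p v)"
proof -
  obtain a b c where "\<And>p. \<sigma> p Z1 = a + b * complex_of_real (fst p) + c * complex_of_real (snd p)"
    using affine_Z1 by blast
  then have 1: "complex_localized S (\<lambda>p. \<sigma> p Z1)" by (simp add: complex_localized_affine)
  obtain a b c where "\<And>p. \<sigma> p Z2 = a + b * complex_of_real (fst p) + c * complex_of_real (snd p)"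
    using affine_Z2 by blast
  then have 2: "complex_localized S (\<lambda>p. \<sigma> p Z2)" by (simp add: complex_localized_affine)
  have "\<sigma> p Z1_bar = cnj (\<sigma> p Z1)" "\<sigma> p Z2_bar = cnj (\<sigma> p Z2)" for p
    using conj[of p Z1] conj[of p Z2] by simp_all
  then show ?thesis
    using 1 2 complex_localized_cnj by (cases v) auto
qed

text \<open>Definedness and localization are proved together because evaluation is additive and
  multiplicative only where both arguments are defined.\<close>

lemma eval_localized:
  assumes "a \<in> A"
  shows "(\<forall>p\<in>off_lines S. rat_defined (\<sigma> p) a) \<and> complex_localized S (eval a)"
  using assms unfolding localized_algebra_def
proof (induction rule: generated_algebra.induct)
  case one
  show ?case by (simp add: complex_localized_const)
next
  case (gen g)
  then consider v where "g = rat_of_poly (pvar v)"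
    | f where "f \<in> {f1, f2, f3}" "g = inverse (rat_of_poly f) \<or> g = inverse (rat_of_poly (pstar f))"
    by auto
  then show ?case
  proof cases
    case 1
    then show ?thesis by (simp add: variable_localized)
  next
    case 2
    have star: "poly_eval (\<sigma> p) (pstar f) = cnj (poly_eval (\<sigma> p) f)" for p
      by (rule poly_eval_pstar) (rule conj)
    have nz: "poly_eval (\<sigma> p) f \<noteq> 0" if "p \<in> off_lines S" for p
      by (rule linear_nonzero[OF 2(1) that])
    note inv = linear_inverse_localized[OF 2(1)]
    from 2(2) show ?thesis
    proof
      assume g: "g = inverse (rat_of_poly f)"
      have "complex_localized S (eval g)"
        by (rule complex_localized_cong[OF inv]) (simp add: g rat_eval_inverse_of_poly nz)
      then show ?thesis using nz by (simp add: g rat_eval_inverse_of_poly)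
    next
      assume g: "g = inverse (rat_of_poly (pstar f))"
      have "complex_localized S (eval g)"
        by (rule complex_localized_cong[OF complex_localized_cnj[OF inv]])
           (simp add: g rat_eval_inverse_of_poly nz star)
      then show ?thesis using nz by (simp add: g rat_eval_inverse_of_poly star)
    qed
  qed
next
  case (add a b)
  have "complex_localized S (eval (a + b))"
    by (rule complex_localized_cong[OF complex_localized_add[of S "eval a" "eval b"]])
       (use add in \<open>auto simp: rat_eval_add\<close>)
  then show ?case using add by (simp add: rat_eval_add)
next
  case (mult a b)
  have "complex_localized S (eval (a * b))"
    by (rule complex_localized_cong[OF complex_localized_mult[of S "eval a" "eval b"]])
       (use mult in \<open>auto simp: rat_eval_mult\<close>)
  then show ?case using mult by (simp add: rat_eval_mult)
next
  case (scale a c)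
  have "complex_localized S (eval (crat_scale c a))"
    by (rule complex_localized_cong[OF complex_localized_mult[of S "\<lambda>_. c" "eval a"]])
       (use scale in \<open>auto simp: rat_eval_scale complex_localized_const\<close>)
  then show ?case using scale by (simp add: rat_eval_scale)
qed

lemma coordinates_in_A: "x \<in> A" "y \<in> A"
  by (rule rat_of_poly_in_localized_algebra)+

lemma power_in_A: "a \<in> A \<Longrightarrow> a ^ n \<in> A"
  by (induction n) (auto intro: localized_algebra_closed)

lemma motzkin_element_in_A: "motzkin_element \<in> A"
  unfolding motzkin_element_def by (intro localized_algebra_closed power_in_A coordinates_in_A)

lemma star_power: "crat_star (a ^ n) = crat_star a ^ n"
proof (induction n)
  case 0
  show ?case by (simp add: One_fract_def crat_star_Fract)
qed (simp add: crat_star_mult)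

lemma star_motzkin_element: "crat_star motzkin_element = motzkin_element"
  \<comment> \<open>The zeroth power supplies \<open>crat_star 1 = 1\<close>.\<close>
  using star_power[of 1 0]
  by (simp add: motzkin_element_def crat_star_add crat_star_mult crat_star_scale star_power hermitean)

lemma eval_power: "rat_defined (\<sigma> p) a \<Longrightarrow> rat_defined (\<sigma> p) (a ^ n) \<and> eval (a ^ n) p = eval a p ^ n"
  by (induction n) (auto simp: rat_eval_mult)

lemma eval_motzkin_element: "eval motzkin_element p = complex_of_real (motzkin (fst p) (snd p))"
  using eval_power[of p x] eval_power[of p y]
  by (simp add: motzkin_element_def motzkin_def rat_eval_add rat_eval_mult rat_eval_scale coordinates)

text \<open>On the plane \<open>crat_star a * a\<close> is the sum of the squares of the real and
  the imaginary part of \<open>a\<close>, both localized functions, so positivity on real squares is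
  enough.\<close>

lemma exists_functional:
  obtains L where "linear_functional crat_scale A L"
    "\<And>a. a \<in> A \<Longrightarrow> L (crat_star a * a) \<in> \<real>\<^sub>\<ge>\<^sub>0" "Re (L motzkin_element) < 0"
proof -
  obtain p w where p: "\<And>n. p n \<in> off_lines S" and w: "\<And>n::nat. w n \<ge> (0::real)"
    and summ: "\<And>g. g \<in> localized_functions S \<Longrightarrow> summable (\<lambda>n. w n * \<bar>g (p n)\<bar>)"
    and pos: "\<And>g. g \<in> localized_functions S \<Longrightarrow>
       square_functional (\<lambda>x. (g x)\<^sup>2) + suminf (\<lambda>n. w n * (g (p n))\<^sup>2) \<ge> 0"
    and neg: "square_functional (\<lambda>x. motzkin (fst x) (snd x)) + suminf (\<lambda>n. w n * motzkin (fst (p n)) (snd (p n))) < 0"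
  proof (rule separating_point_masses[OF finite_lines lines_nonconst lines_far])
    fix p' :: "nat \<Rightarrow> real \<times> real" and w' :: "nat \<Rightarrow> real"
    assume "\<And>n. p' n \<in> off_lines S" "\<And>n. w' n \<ge> 0"
      "\<And>g. g \<in> localized_functions S \<Longrightarrow> summable (\<lambda>n. w' n * \<bar>g (p' n)\<bar>)"
      "\<And>g. g \<in> localized_functions S \<Longrightarrow>
         square_functional (\<lambda>x. (g x)\<^sup>2) + suminf (\<lambda>n. w' n * (g (p' n))\<^sup>2) \<ge> 0"
      "square_functional (\<lambda>x. motzkin (fst x) (snd x)) + suminf (\<lambda>n. w' n * motzkin (fst (p' n)) (snd (p' n))) < 0"
    then show thesis by (rule that)
  qed
  have corner: "(u, v) \<in> off_lines S" if "\<bar>u\<bar> \<le> 1" "\<bar>v\<bar> \<le> 1" for u v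
    using lines_far that by (rule square_in_off_lines)
  define L where "L a = square_functional (eval a) + suminf (\<lambda>n. complex_of_real (w n) * eval a (p n))" for a
  have def: "rat_defined (\<sigma> q) a" if "a \<in> A" "q \<in> off_lines S" for a q
    using eval_localized that by blast
  have sA: "summable (\<lambda>n. complex_of_real (w n) * eval a (p n))" if "a \<in> A" for a
    using point_mass_summable[of w S p "eval a"] w summ p eval_localized[OF that] by blast
  have "linear_functional crat_scale A L"
    unfolding linear_functional_def
  proof (intro conjI ballI allI)
    fix a b assume ab: "a \<in> A" "b \<in> A"
    have v: "eval (a + b) q = eval a q + eval b q" if "q \<in> off_lines S" for q
      using ab def that by (simp add: rat_eval_add)
    have "square_functional (eval (a + b)) = square_functional (eval a) + square_functional (eval b)"
      by (simp add: square_functional_def v corner scaleR_add_right)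
    moreover have "suminf (\<lambda>n. complex_of_real (w n) * eval (a + b) (p n))
      = suminf (\<lambda>n. complex_of_real (w n) * eval a (p n)) + suminf (\<lambda>n. complex_of_real (w n) * eval b (p n))"
      using suminf_add[OF sA[OF ab(1)] sA[OF ab(2)]] by (simp add: v p distrib_left)
    ultimately show "L (a + b) = L a + L b" by (simp add: L_def)
  next
    fix c a assume a: "a \<in> A"
    have v: "eval (crat_scale c a) q = c * eval a q" if "q \<in> off_lines S" for q
      using a def that by (simp add: rat_eval_scale)
    have "square_functional (eval (crat_scale c a)) = c * square_functional (eval a)"
      by (simp add: square_functional_def v corner algebra_simps)
    moreover have "suminf (\<lambda>n. complex_of_real (w n) * eval (crat_scale c a) (p n))
      = c * suminf (\<lambda>n. complex_of_real (w n) * eval a (p n))"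
      using suminf_mult[OF sA[OF a], of c] by (simp add: v p mult_ac)
    ultimately show "L (crat_scale c a) = c * L a" by (simp add: L_def distrib_left)
  qed
  moreover have "L (crat_star a * a) \<in> \<real>\<^sub>\<ge>\<^sub>0" if a: "a \<in> A" for a
  proof -
    define g where "g = restrict_off S (\<lambda>q. Re (eval a q))"
    define h where "h = restrict_off S (\<lambda>q. Im (eval a q))"
    have gh: "g \<in> localized_functions S" "h \<in> localized_functions S"
      using eval_localized[OF a] by (auto simp: g_def h_def complex_localized_def)
    have v: "eval (crat_star a * a) q = complex_of_real ((g q)\<^sup>2 + (h q)\<^sup>2)" if q: "q \<in> off_lines S" for q
    proof -
      have "eval (crat_star a * a) q = eval (crat_star a) q * eval a q"
        using def[OF crat_star_localized_algebra[OF a] q] def[OF a q] by (rule rat_eval_mult(2))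
      also have "eval (crat_star a) q = cnj (eval a q)"
        by (rule rat_eval_star[OF conj def[OF a q]])
      also have "\<dots> * eval a q = complex_of_real ((g q)\<^sup>2 + (h q)\<^sup>2)"
        using q by (simp add: complex_eq_iff g_def h_def restrict_off_def power2_eq_square)
      finally show ?thesis .
    qed
    have sq: "summable (\<lambda>n. w n * (g (p n))\<^sup>2)" "summable (\<lambda>n. w n * (h (p n))\<^sup>2)"
      using summ[OF localized_functions_mult[OF gh(1) gh(1)]] summ[OF localized_functions_mult[OF gh(2) gh(2)]]
      by (simp_all add: power2_eq_square)
    have "suminf (\<lambda>n. complex_of_real (w n) * eval (crat_star a * a) (p n))
      = suminf (\<lambda>n. complex_of_real (w n * (g (p n))\<^sup>2 + w n * (h (p n))\<^sup>2))"
      by (simp add: v p distrib_left)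
    also have "\<dots> = complex_of_real (suminf (\<lambda>n. w n * (g (p n))\<^sup>2 + w n * (h (p n))\<^sup>2))"
      by (rule suminf_of_real[symmetric]) (intro summable_add sq)
    also have "\<dots> = complex_of_real (suminf (\<lambda>n. w n * (g (p n))\<^sup>2) + suminf (\<lambda>n. w n * (h (p n))\<^sup>2))"
      by (simp only: suminf_add[OF sq])
    finally have 1: "suminf (\<lambda>n. complex_of_real (w n) * eval (crat_star a * a) (p n))
      = complex_of_real (suminf (\<lambda>n. w n * (g (p n))\<^sup>2) + suminf (\<lambda>n. w n * (h (p n))\<^sup>2))" .
    have 2: "square_functional (eval (crat_star a * a))
      = complex_of_real (square_functional (\<lambda>x. (g x)\<^sup>2) + square_functional (\<lambda>x. (h x)\<^sup>2))"
      by (simp add: square_functional_def v corner) (simp add: scaleR_conv_of_real add_divide_distrib algebra_simps)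
    have "L (crat_star a * a) = complex_of_real ((square_functional (\<lambda>x. (g x)\<^sup>2) + suminf (\<lambda>n. w n * (g (p n))\<^sup>2))
        + (square_functional (\<lambda>x. (h x)\<^sup>2) + suminf (\<lambda>n. w n * (h (p n))\<^sup>2)))"
      by (simp only: L_def 1 2 flip: of_real_add) (simp only: add_ac)
    moreover have "(square_functional (\<lambda>x. (g x)\<^sup>2) + suminf (\<lambda>n. w n * (g (p n))\<^sup>2))
        + (square_functional (\<lambda>x. (h x)\<^sup>2) + suminf (\<lambda>n. w n * (h (p n))\<^sup>2)) \<ge> 0"
      using pos[OF gh(1)] pos[OF gh(2)] by (rule add_nonneg_nonneg)
    ultimately show ?thesis by (simp only: nonneg_Reals_of_real_iff)
  qed
  moreover have "Re (L motzkin_element) < 0"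
  proof -
    have "Re (suminf (\<lambda>n. complex_of_real (w n) * eval motzkin_element (p n)))
      = suminf (\<lambda>n. Re (complex_of_real (w n) * eval motzkin_element (p n)))"
      by (rule bounded_linear.suminf[OF bounded_linear_Re sA[OF motzkin_element_in_A]])
    moreover have "Re (square_functional (eval motzkin_element)) = square_functional (\<lambda>x. motzkin (fst x) (snd x))"
      by (simp add: square_functional_def eval_motzkin_element)
    ultimately show ?thesis using neg by (simp add: L_def eval_motzkin_element)
  qed
  ultimately show thesis by (rule that)
qed

lemma not_complex_moment_property: "\<not> complex_moment_property crat_scale crat_star A"
proof
  assume mp: "complex_moment_property crat_scale crat_star A"
  obtain L where L: "linear_functional crat_scale A L"
    "\<And>a. a \<in> A \<Longrightarrow> L (crat_star a * a) \<in> \<real>\<^sub>\<ge>\<^sub>0" "Re (L motzkin_element) < 0" by (rule exists_functional) (rule that)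
  then have "moment_functional A (star_characters crat_scale crat_star A) L"
    using mp by (simp add: complex_moment_property_def)
  then obtain M where M: "radon_measure (character_topology A (star_characters crat_scale crat_star A)) M"
    "\<And>a. a \<in> A \<Longrightarrow> integrable M (\<lambda>\<phi>. \<phi> a) \<and> L a = (\<integral>\<phi>. \<phi> a \<partial>M)"
    unfolding moment_functional_def by blast
  have sp: "\<phi> \<in> star_characters crat_scale crat_star A" if "\<phi> \<in> space M" for \<phi>
    using M(1) that by (simp add: radon_measure_def character_topology_def)
  have nonneg: "Re (\<phi> motzkin_element) \<ge> 0" if "\<phi> \<in> space M" for \<phi>
  proof -
    have \<phi>: "\<phi> \<in> characters crat_scale A" "\<And>a. a \<in> A \<Longrightarrow> \<phi> (crat_star a) = cnj (\<phi> a)"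
      using sp[OF that] by (auto simp: star_characters_def)
    \<comment> \<open>A $*$-character is real on hermitean elements, so the Motzkin element is
      evaluated at a real point, wherever the character lies.\<close>
    have "\<phi> x \<in> \<real>" "\<phi> y \<in> \<real>"
      using \<phi>(2)[OF coordinates_in_A(1)] \<phi>(2)[OF coordinates_in_A(2)] by (simp_all add: hermitean Reals_cnj_iff)
    then obtain r t where rt: "\<phi> x = complex_of_real r" "\<phi> y = complex_of_real t" by (auto elim!: Reals_cases)
    have "\<phi> motzkin_element = motzkin (\<phi> x) (\<phi> y)"
      unfolding motzkin_element_def by (rule character_motzkin[OF \<phi>(1)]) (auto intro: localized_algebra_closed coordinates_in_A)
    also have "\<dots> = complex_of_real (motzkin r t)" by (simp add: rt motzkin_def)
    finally show ?thesis using motzkin_nonneg[of r t] by simp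
  qed
  have "Re (L motzkin_element) = (\<integral>\<phi>. Re (\<phi> motzkin_element) \<partial>M)" using M(2)[OF motzkin_element_in_A] by simp
  also have "\<dots> \<ge> 0" using nonneg by (intro Bochner_Integration.integral_nonneg_AE AE_I2)
  finally show False using L(3) by simp
qed

lemma not_real_moment_property:
  "\<not> real_moment_property (\<lambda>r. crat_scale (complex_of_real r)) (hermitean_part A)"
proof
  let ?B = "hermitean_part A" and ?s = "\<lambda>r. crat_scale (complex_of_real r)"
  assume mp: "real_moment_property ?s ?B"
  obtain L where L: "linear_functional crat_scale A L"
    "\<And>a. a \<in> A \<Longrightarrow> L (crat_star a * a) \<in> \<real>\<^sub>\<ge>\<^sub>0" "Re (L motzkin_element) < 0" by (rule exists_functional) (rule that)
  \<comment> \<open>The real part of \<open>L\<close> is real-linear, and on hermitean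
    \<open>b\<close> the square of \<open>b\<close> equals \<open>crat_star b * b\<close>, so
    positivity carries over.\<close>
  have "linear_functional ?s ?B (\<lambda>b. Re (L b))"
    using L(1) by (auto simp: linear_functional_def hermitean_part_def)
  moreover have "Re (L (b\<^sup>2)) \<ge> 0" if "b \<in> ?B" for b
    using L(2)[of b] that by (auto simp: hermitean_part_def power2_eq_square complex_nonneg_Reals_iff)
  ultimately have "moment_functional ?B (characters ?s ?B) (\<lambda>b. Re (L b))"
    using mp by (simp add: real_moment_property_def)
  then obtain M where M: "radon_measure (character_topology ?B (characters ?s ?B)) M"
    "\<And>a. a \<in> ?B \<Longrightarrow> Re (L a) = (\<integral>\<phi>. \<phi> a \<partial>M)"
    unfolding moment_functional_def by blast
  have sp: "\<phi> \<in> characters ?s ?B" if "\<phi> \<in> space M" for \<phi>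
    using M(1) that by (simp add: radon_measure_def character_topology_def)
  have B1: "1 \<in> ?B" using star_power[of 1 0] by (simp add: hermitean_part_def localized_algebra_closed)
  have B: "a + b \<in> ?B" "a * b \<in> ?B" "?s r a \<in> ?B" if "a \<in> ?B" "b \<in> ?B" for a b r
    using that by (auto simp: hermitean_part_def localized_algebra_closed crat_star_add crat_star_mult crat_star_scale)
  have xy: "x \<in> ?B" "y \<in> ?B" using coordinates_in_A by (auto simp: hermitean_part_def hermitean)
  have nonneg: "\<phi> motzkin_element \<ge> 0" if "\<phi> \<in> space M" for \<phi>
  proof -
    have "\<phi> motzkin_element = motzkin (\<phi> x) (\<phi> y)"
      using character_motzkin[OF sp[OF that] B1 B(2) B(1) B(3) xy] by (simp add: motzkin_element_def)
    then show ?thesis by (simp add: motzkin_nonneg)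
  qed
  have "Re (L motzkin_element) = (\<integral>\<phi>. \<phi> motzkin_element \<partial>M)"
    using M(2) motzkin_element_in_A star_motzkin_element by (simp add: hermitean_part_def)
  also have "\<dots> \<ge> 0" using nonneg by (intro Bochner_Integration.integral_nonneg_AE AE_I2)
  finally show False using L(3) by simp
qed

end

section \<open>Constructing the plane\<close>

lemma cnj_case_var:
  "(case conj_var v of Z1 \<Rightarrow> z | Z2 \<Rightarrow> w | Z1_bar \<Rightarrow> cnj z | Z2_bar \<Rightarrow> cnj w)
    = cnj (case v of Z1 \<Rightarrow> z | Z2 \<Rightarrow> w | Z1_bar \<Rightarrow> cnj z | Z2_bar \<Rightarrow> cnj w)"
  by (cases v) auto

text \<open>If \<open>f1\<close> and \<open>f2\<close> are independent, use them as coordinates of \<open>\<complex>\<^sup>2\<close>; the real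
  plane consists of the points where suitable complex multiples of all three are real.\<close>

lemma real_plane_independent:
  assumes f1: "\<And>\<sigma>. poly_eval \<sigma> f1 = a1 * \<sigma> Z1 + b1 * \<sigma> Z2 + c1"
    and f2: "\<And>\<sigma>. poly_eval \<sigma> f2 = a2 * \<sigma> Z1 + b2 * \<sigma> Z2 + c2"
    and f3: "\<And>\<sigma>. poly_eval \<sigma> f3 = a3 * \<sigma> Z1 + b3 * \<sigma> Z2 + c3"
    and det: "a1 * b2 - a2 * b1 \<noteq> 0" and f3_nonconst: "a3 \<noteq> 0 \<or> b3 \<noteq> 0"
  shows "\<exists>S \<sigma> X Y. real_plane S \<sigma> f1 f2 f3 X Y"
proof -
  define D where "D = a1 * b2 - a2 * b1"
  have D: "D \<noteq> 0" using det by (simp add: D_def)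
  \<comment> \<open>By Cramer's rule \<open>f3 = \<alpha> * f1 + \<beta> * f2 + \<gamma>\<close> on
    the points considered.\<close>
  define \<alpha> \<beta> \<gamma> where "\<alpha> = (a3 * b2 - b3 * a2) / D" and "\<beta> = (a1 * b3 - b1 * a3) / D"
    and "\<gamma> = c3 - \<alpha> * c1 - \<beta> * c2"
  have ab3: "a3 = \<alpha> * a1 + \<beta> * a2" "b3 = \<alpha> * b1 + \<beta> * b2"
  proof -
    have "D * a3 = (a3 * b2 - b3 * a2) * a1 + (a1 * b3 - b1 * a3) * a2"
      "D * b3 = (a3 * b2 - b3 * a2) * b1 + (a1 * b3 - b1 * a3) * b2"
      by (simp_all add: D_def algebra_simps)
    then show "a3 = \<alpha> * a1 + \<beta> * a2" "b3 = \<alpha> * b1 + \<beta> * b2"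
      using D by (simp_all add: \<alpha>_def \<beta>_def nonzero_eq_divide_eq mult.commute flip: add_divide_distrib)
  qed
  \<comment> \<open>Vanishing coefficients are replaced by the harmless scale \<open>1\<close>.
    Rescaling the forms by these nonzero numbers leaves only the flags \<open>A\<close>,
    \<open>B\<close>, \<open>C\<close>, which are \<open>0\<close> or \<open>1\<close> and hence
    real.\<close>
  define \<alpha>' \<beta>' g where "\<alpha>' = (if \<alpha> = 0 then 1 else \<alpha>)" and "\<beta>' = (if \<beta> = 0 then 1 else \<beta>)"
    and "g = (if \<gamma> = 0 then 1 else \<gamma>)"
  define A B C :: real where "A = (if \<alpha> = 0 then 0 else 1)" and "B = (if \<beta> = 0 then 0 else 1)"
    and "C = (if \<gamma> = 0 then 0 else 1)"
  have nz: "\<alpha>' \<noteq> 0" "\<beta>' \<noteq> 0" "g \<noteq> 0" by (auto simp: \<alpha>'_def \<beta>'_def g_def)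
  have flags: "\<alpha> * (g / \<alpha>') = g * complex_of_real A" "\<beta> * (g / \<beta>') = g * complex_of_real B" "\<gamma> = g * complex_of_real C"
    by (auto simp: \<alpha>'_def \<beta>'_def g_def A_def B_def C_def)
  have AB: "A \<noteq> 0 \<or> B \<noteq> 0" using ab3 f3_nonconst by (auto simp: A_def B_def)
  have bounds: "0 \<le> A" "A \<le> 1" "0 \<le> B" "B \<le> 1" "0 \<le> C" "1 \<le> A + B + C"
    using AB by (auto simp: A_def B_def C_def)
  \<comment> \<open>The prescribed values of \<open>f1\<close> and \<open>f2\<close> on the plane.
    The factor \<open>1/3\<close> keeps the lines, including that of \<open>f3\<close>, away from
    the square.\<close>
  define W1 W2 where "W1 p = g / \<alpha>' * (1 + complex_of_real (fst p) / 3)"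
    and "W2 p = g / \<beta>' * (1 + complex_of_real (snd p) / 3)" for p :: "real \<times> real"
  define z1 z2 where "z1 p = (b2 * (W1 p - c1) - b1 * (W2 p - c2)) / D"
    and "z2 p = (a1 * (W2 p - c2) - a2 * (W1 p - c1)) / D" for p
  define \<sigma> where "\<sigma> p v = (case v of Z1 \<Rightarrow> z1 p | Z2 \<Rightarrow> z2 p | Z1_bar \<Rightarrow> cnj (z1 p) | Z2_bar \<Rightarrow> cnj (z2 p))" for p v
  have cramer: "a1 * z1 p + b1 * z2 p = W1 p - c1" "a2 * z1 p + b2 * z2 p = W2 p - c2" for p
  proof -
    define U V where "U = W1 p - c1" and "V = W2 p - c2"
    have "a1 * (b2 * U - b1 * V) + b1 * (a1 * V - a2 * U) = D * U"
      "a2 * (b2 * U - b1 * V) + b2 * (a1 * V - a2 * U) = D * V"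
      by (simp_all add: D_def algebra_simps)
    moreover have "a * z1 p + b * z2 p = (a * (b2 * U - b1 * V) + b * (a1 * V - a2 * U)) / D" for a b
      by (simp add: z1_def z2_def U_def V_def add_divide_distrib)
    ultimately show "a1 * z1 p + b1 * z2 p = W1 p - c1" "a2 * z1 p + b2 * z2 p = W2 p - c2"
      using D by (simp_all add: U_def V_def)
  qed
  have v1: "poly_eval (\<sigma> p) f1 = W1 p" and v2: "poly_eval (\<sigma> p) f2 = W2 p" for p
    using cramer[of p] by (simp_all add: f1 f2 \<sigma>_def)
  have v3: "poly_eval (\<sigma> p) f3 = g * complex_of_real (A * (1 + fst p / 3) + B * (1 + snd p / 3) + C)" for p
  proof -
    have "poly_eval (\<sigma> p) f3 = \<alpha> * (a1 * z1 p + b1 * z2 p) + \<beta> * (a2 * z1 p + b2 * z2 p) + c3"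
      by (simp add: f3 \<sigma>_def ab3 algebra_simps)
    also have "\<dots> = \<alpha> * W1 p + \<beta> * W2 p + \<gamma>"
      unfolding cramer by (simp add: \<gamma>_def algebra_simps)
    also have "\<alpha> * W1 p = \<alpha> * (g / \<alpha>') * (1 + complex_of_real (fst p) / 3)"
      by (simp only: W1_def mult.assoc)
    also have "\<beta> * W2 p = \<beta> * (g / \<beta>') * (1 + complex_of_real (snd p) / 3)"
      by (simp only: W2_def mult.assoc)
    finally show ?thesis unfolding flags by (simp add: algebra_simps)
  qed
  \<comment> \<open>Dividing by \<open>c\<close> normalizes the constant term of the form for
    \<open>f3\<close>; \<open>c \<ge> 1\<close> because \<open>f3\<close> is not constant, so
    \<open>A\<close> or \<open>B\<close> is \<open>1\<close>.\<close>
  define c where "c = A + B + C"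
  define l3 where "l3 = (A / (3 * c), B / (3 * c))"
  define S where "S = {(1/3, 0), (0, 1/3), l3}"
  \<comment> \<open>\<open>P\<close> solves the prescribed value of \<open>f1\<close> for the first
    parameter. It is real on the plane without being hermitean, so its hermitean part
    \<open>X\<close> takes the same values there; likewise for \<open>Q\<close> and
    \<open>Y\<close>.\<close>
  define P where "P = pconst (3 * \<alpha>' / g) * f1 + pconst (- 3)"
  define Q where "Q = pconst (3 * \<beta>' / g) * f2 + pconst (- 3)"
  define X where "X = pconst (1/2) * (P + pstar P)"
  define Y where "Y = pconst (1/2) * (Q + pstar Q)"
  have conj: "\<sigma> p (conj_var v) = cnj (\<sigma> p v)" for p v
    unfolding \<sigma>_def by (rule cnj_case_var)
  have P: "poly_eval (\<sigma> p) P = complex_of_real (fst p)" and Q: "poly_eval (\<sigma> p) Q = complex_of_real (snd p)" for p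
    using nz by (simp_all add: P_def Q_def v1 v2 W1_def W2_def field_simps)
  have star: "poly_eval (\<sigma> p) (pstar R) = cnj (poly_eval (\<sigma> p) R)" for p R
    by (rule poly_eval_pstar) (rule conj)
  have "real_plane S \<sigma> f1 f2 f3 X Y"
  proof
    show "finite S" by (simp add: S_def)
    show "(0, 0) \<notin> S" using AB bounds by (auto simp: S_def l3_def c_def)
    show "\<bar>fst l\<bar> + \<bar>snd l\<bar> < 1" if "l \<in> S" for l
    proof -
      have c: "c \<ge> 1" using bounds by (simp add: c_def)
      have "(A + B) / (3 * c) < 1" using c bounds by (simp add: divide_less_eq)
      then have "A / (3 * c) + B / (3 * c) < 1" by (simp only: add_divide_distrib)
      moreover have "0 \<le> A / (3 * c)" "0 \<le> B / (3 * c)" using c bounds by simp_all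
      ultimately have "\<bar>fst l3\<bar> + \<bar>snd l3\<bar> < 1" by (simp add: l3_def)
      then show ?thesis using that by (auto simp: S_def)
    qed
    \<comment> \<open>Rewriting with this form exposes the three coefficients, which then serve as
      witnesses by unification.\<close>
    have affine: "(r * (G * (1 + u / 3) - c) - t * (H * (1 + v / 3) - c')) / D
      = (r * (G - c) - t * (H - c')) / D + r * (G / 3) / D * u + - t * (H / 3) / D * v"
      for r G u c t H v c' :: complex
      by (simp add: add_divide_distrib diff_divide_distrib algebra_simps)
    have Z: "\<sigma> p Z1 = z1 p" "\<sigma> p Z2 = z2 p" for p by (simp_all add: \<sigma>_def)
    show "\<exists>a b c. \<forall>p. \<sigma> p Z1 = a + b * complex_of_real (fst p) + c * complex_of_real (snd p)"
      unfolding Z z1_def W1_def W2_def affine by blast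
    show "\<exists>a b c. \<forall>p. \<sigma> p Z2 = a + b * complex_of_real (fst p) + c * complex_of_real (snd p)"
      unfolding Z z2_def W1_def W2_def affine by (metis add.assoc add.commute)
    show "pstar X = X" "pstar Y = Y" by (simp_all add: X_def Y_def pstar_mult pstar_add add.commute)
    show "poly_eval (\<sigma> p) X = complex_of_real (fst p)" "poly_eval (\<sigma> p) Y = complex_of_real (snd p)" for p
      by (simp_all add: X_def Y_def star P Q)
    have "\<forall>p. poly_eval (\<sigma> p) f1 = g / \<alpha>' * complex_of_real (affine_form (1/3, 0) p)"
      "\<forall>p. poly_eval (\<sigma> p) f2 = g / \<beta>' * complex_of_real (affine_form (0, 1/3) p)"
      by (simp_all add: v1 v2 W1_def W2_def affine_form_def)
    moreover have "\<forall>p. poly_eval (\<sigma> p) f3 = (g * complex_of_real c) * complex_of_real (affine_form l3 p)"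
    proof
      fix p
      have "A * (1 + fst p / 3) + B * (1 + snd p / 3) + C = c * affine_form l3 p"
      proof -
        have "c \<noteq> 0" using bounds by (simp add: c_def)
        then have "c * (r / (3 * c) * u) = r * u / 3" for r u by simp
        then have "c * affine_form l3 p = c + A * fst p / 3 + B * snd p / 3"
          by (simp only: affine_form_def l3_def fst_conv snd_conv distrib_left mult_1_right)
        then show ?thesis by (simp add: c_def distrib_left)
      qed
      then show "poly_eval (\<sigma> p) f3 = (g * complex_of_real c) * complex_of_real (affine_form l3 p)"
        by (simp add: v3 mult.assoc flip: of_real_mult)
    qed
    moreover have "g / \<alpha>' \<noteq> 0" "g / \<beta>' \<noteq> 0" "g * complex_of_real c \<noteq> 0"
      using nz bounds by (auto simp: c_def simp flip: of_real_add)
    moreover have "(1/3, 0) \<in> S" "(0, 1/3) \<in> S" "l3 \<in> S" by (auto simp: S_def)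
    ultimately show "\<exists>\<nu>. \<nu> \<noteq> 0 \<and> ((\<forall>p. poly_eval (\<sigma> p) f = \<nu>) \<or>
      (\<exists>l\<in>S. \<forall>p. poly_eval (\<sigma> p) f = \<nu> * complex_of_real (affine_form l p)))" if "f \<in> {f1, f2, f3}" for f
      using that by (elim insertE emptyE) (simp_all only:, blast+)
  qed (rule conj)
  then show ?thesis by blast
qed

text \<open>If all three are parallel, a complex line on which they are constant and non-zero will do.\<close>

lemma real_plane_parallel:
  assumes f1: "\<And>\<sigma>. poly_eval \<sigma> f1 = a1 * \<sigma> Z1 + b1 * \<sigma> Z2 + c1"
    and f2: "\<And>\<sigma>. poly_eval \<sigma> f2 = a2 * \<sigma> Z1 + b2 * \<sigma> Z2 + c2"
    and f3: "\<And>\<sigma>. poly_eval \<sigma> f3 = a3 * \<sigma> Z1 + b3 * \<sigma> Z2 + c3"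
    and nonconst: "a1 \<noteq> 0 \<or> b1 \<noteq> 0" "a2 \<noteq> 0 \<or> b2 \<noteq> 0" "a3 \<noteq> 0 \<or> b3 \<noteq> 0"
    and det: "a1 * b2 - a2 * b1 = 0" "a1 * b3 - a3 * b1 = 0"
  shows "\<exists>S \<sigma> X Y. real_plane S \<sigma> f1 f2 f3 X Y"
proof -
  define N where "N = a1 * cnj a1 + b1 * cnj b1"
  have N: "N \<noteq> 0"
  proof -
    have "N = complex_of_real ((cmod a1)\<^sup>2 + (cmod b1)\<^sup>2)"
      by (simp only: N_def of_real_add complex_norm_square)
    moreover have "(cmod a1)\<^sup>2 + (cmod b1)\<^sup>2 \<noteq> 0"
      using nonconst(1) by (simp add: sum_power2_eq_zero_iff)
    ultimately show ?thesis by (metis of_real_eq_0_iff)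
  qed
  \<comment> \<open>A nonzero vector parallel to \<open>(a1, b1)\<close> has nonzero hermitean
    product with it.\<close>
  have slope: "a * cnj a1 + b * cnj b1 \<noteq> 0" if "a1 * b - a * b1 = 0" "a \<noteq> 0 \<or> b \<noteq> 0" for a b
  proof
    assume 0: "a * cnj a1 + b * cnj b1 = 0"
    have ab: "a1 * b = a * b1" using that(1) by simp
    have "a * N = a1 * (a * cnj a1) + (a * b1) * cnj b1" by (simp add: N_def algebra_simps)
    also have "\<dots> = a1 * (a * cnj a1 + b * cnj b1)" unfolding ab[symmetric] by (simp add: algebra_simps)
    finally have "a = 0" using 0 N by simp
    have "b * N = (a1 * b) * cnj a1 + b1 * (b * cnj b1)" by (simp add: N_def algebra_simps)
    also have "\<dots> = b1 * (a * cnj a1 + b * cnj b1)" unfolding ab by (simp add: algebra_simps)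
    finally have "b = 0" using 0 N by simp
    with \<open>a = 0\<close> that(2) show False by simp
  qed
  define k where "k a b = a * cnj a1 + b * cnj b1" for a b
  have k: "k a1 b1 \<noteq> 0" "k a2 b2 \<noteq> 0" "k a3 b3 \<noteq> 0"
    unfolding k_def using slope nonconst det by auto
  \<comment> \<open>On the complex line below, each form has the constant value
    \<open>t * k a b + c\<close>; \<open>t\<close> avoids the three values where one of these
    vanishes.\<close>
  obtain t where t: "t \<notin> {- c1 / k a1 b1, - c2 / k a2 b2, - c3 / k a3 b3}"
    using ex_new_if_finite[OF infinite_UNIV_char_0[where 'a = complex]] by (metis finite.emptyI finite.insertI)
  have const: "t * k a b + c \<noteq> 0" if "k a b \<noteq> 0" "t \<noteq> - c / k a b" for a b c
  proof
    assume "t * k a b + c = 0"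
    then have "t * k a b = - c" by (simp add: eq_neg_iff_add_eq_0)
    then have "t = - c / k a b" using that(1) by (metis nonzero_mult_div_cancel_right)
    then show False using that(2) by simp
  qed
  \<comment> \<open>The real plane is a whole complex line in the direction
    \<open>(- b1, a1)\<close>, with real and imaginary part of its complex parameter
    \<open>\<zeta>\<close> as coordinates.\<close>
  define \<zeta> where "\<zeta> p = complex_of_real (fst p) + \<i> * complex_of_real (snd p)" for p :: "real \<times> real"
  define z1 z2 where "z1 p = t * cnj a1 - b1 * \<zeta> p" and "z2 p = t * cnj b1 + a1 * \<zeta> p" for p
  define \<sigma> where "\<sigma> p v = (case v of Z1 \<Rightarrow> z1 p | Z2 \<Rightarrow> z2 p | Z1_bar \<Rightarrow> cnj (z1 p) | Z2_bar \<Rightarrow> cnj (z2 p))" for p v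
  have conj: "\<sigma> p (conj_var v) = cnj (\<sigma> p v)" for p v
    unfolding \<sigma>_def by (rule cnj_case_var)
  have v: "a * \<sigma> p Z1 + b * \<sigma> p Z2 + c = t * k a b + c" if "a1 * b - a * b1 = 0" for a b c p
  proof -
    have "a * \<sigma> p Z1 + b * \<sigma> p Z2 + c = t * k a b + c + (a1 * b - a * b1) * \<zeta> p"
      by (simp add: \<sigma>_def z1_def z2_def k_def algebra_simps)
    then show ?thesis by (simp add: that)
  qed
  \<comment> \<open>The hermitean product with the direction \<open>(- b1, a1)\<close>, normalized
    by \<open>N\<close>: it recovers \<open>\<zeta>\<close> and vanishes on the offset
    \<open>t * (cnj a1, cnj b1)\<close>.\<close>
  define P where "P = pconst (- cnj b1 / N) * pvar Z1 + pconst (cnj a1 / N) * pvar Z2"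
  have P: "poly_eval (\<sigma> p) P = \<zeta> p" for p
  proof -
    have "poly_eval (\<sigma> p) P = (- cnj b1 * z1 p + cnj a1 * z2 p) / N"
      by (simp add: P_def \<sigma>_def add_divide_distrib diff_divide_distrib)
    also have "- cnj b1 * z1 p + cnj a1 * z2 p = N * \<zeta> p"
      by (simp add: z1_def z2_def N_def algebra_simps)
    finally show ?thesis using N by simp
  qed
  have star: "poly_eval (\<sigma> p) (pstar R) = cnj (poly_eval (\<sigma> p) R)" for p R
    by (rule poly_eval_pstar) (rule conj)
  \<comment> \<open>Real and imaginary part of \<open>\<zeta>\<close>, written as hermitean
    polynomials; \<open>- \<i> / 2\<close> is \<open>1 / (2 * \<i>)\<close>.\<close>
  define X where "X = pconst (1/2) * (P + pstar P)"
  define Y where "Y = pconst (- \<i> / 2) * P + pconst (\<i> / 2) * pstar P"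
  have "real_plane {} \<sigma> f1 f2 f3 X Y"
  proof
    show "\<exists>a b c. \<forall>p. \<sigma> p Z1 = a + b * complex_of_real (fst p) + c * complex_of_real (snd p)"
      by (intro exI[of _ "t * cnj a1"] exI[of _ "- b1"] exI[of _ "- b1 * \<i>"]) (simp add: \<sigma>_def z1_def \<zeta>_def algebra_simps)
    show "\<exists>a b c. \<forall>p. \<sigma> p Z2 = a + b * complex_of_real (fst p) + c * complex_of_real (snd p)"
      by (intro exI[of _ "t * cnj b1"] exI[of _ a1] exI[of _ "a1 * \<i>"]) (simp add: \<sigma>_def z2_def \<zeta>_def algebra_simps)
    show "pstar X = X" "pstar Y = Y" by (simp_all add: X_def Y_def pstar_mult pstar_add add.commute)
    show "poly_eval (\<sigma> p) X = complex_of_real (fst p)" "poly_eval (\<sigma> p) Y = complex_of_real (snd p)" for p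
      by (simp_all add: X_def Y_def star P \<zeta>_def complex_eq_iff)
    have "\<forall>p. poly_eval (\<sigma> p) f1 = t * k a1 b1 + c1" "\<forall>p. poly_eval (\<sigma> p) f2 = t * k a2 b2 + c2"
      "\<forall>p. poly_eval (\<sigma> p) f3 = t * k a3 b3 + c3"
      using v det by (auto simp: f1 f2 f3)
    moreover have "t * k a1 b1 + c1 \<noteq> 0" "t * k a2 b2 + c2 \<noteq> 0" "t * k a3 b3 + c3 \<noteq> 0"
      using const[OF k(1), of c1] const[OF k(2), of c2] const[OF k(3), of c3] t by simp_all
    ultimately show "\<exists>\<nu>. \<nu> \<noteq> 0 \<and> ((\<forall>p. poly_eval (\<sigma> p) f = \<nu>) \<or>
      (\<exists>l\<in>{}. \<forall>p. poly_eval (\<sigma> p) f = \<nu> * complex_of_real (affine_form l p)))" if "f \<in> {f1, f2, f3}" for f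
      using that by blast
  qed (auto simp: conj)
  then show ?thesis by blast
qed

lemma real_plane_swap: "real_plane S \<sigma> f1 f3 f2 X Y \<Longrightarrow> real_plane S \<sigma> f1 f2 f3 X Y"
  by (simp add: real_plane_def insert_commute)

theorem theorem13:
  fixes f1 f2 f3 :: cpoly
  assumes "linear_poly f1" and "linear_poly f2" and "linear_poly f3"
  shows "\<not> real_moment_property (\<lambda>r. crat_scale (complex_of_real r))
             (hermitean_part (localized_algebra f1 f2 f3)) \<and>
         \<not> complex_moment_property crat_scale crat_star (localized_algebra f1 f2 f3)"
proof -
  obtain a1 b1 c1 where f1: "\<And>\<sigma>. poly_eval \<sigma> f1 = a1 * \<sigma> Z1 + b1 * \<sigma> Z2 + c1" "a1 \<noteq> 0 \<or> b1 \<noteq> 0"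
    using linear_poly_eval[OF assms(1)] by blast
  obtain a2 b2 c2 where f2: "\<And>\<sigma>. poly_eval \<sigma> f2 = a2 * \<sigma> Z1 + b2 * \<sigma> Z2 + c2" "a2 \<noteq> 0 \<or> b2 \<noteq> 0"
    using linear_poly_eval[OF assms(2)] by blast
  obtain a3 b3 c3 where f3: "\<And>\<sigma>. poly_eval \<sigma> f3 = a3 * \<sigma> Z1 + b3 * \<sigma> Z2 + c3" "a3 \<noteq> 0 \<or> b3 \<noteq> 0"
    using linear_poly_eval[OF assms(3)] by blast
  have "\<exists>S \<sigma> X Y. real_plane S \<sigma> f1 f2 f3 X Y"
  proof (cases "a1 * b2 - a2 * b1 = 0")
    case False
    then show ?thesis by (rule real_plane_independent[OF f1(1) f2(1) f3(1) _ f3(2)])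
  next
    \<comment> \<open>If \<open>f3\<close> too is parallel to \<open>f1\<close>, all three are
      parallel, since \<open>f1\<close> is not constant; otherwise \<open>f1\<close> and
      \<open>f3\<close> serve as coordinates.\<close>
    case 12: True
    show ?thesis
    proof (cases "a1 * b3 - a3 * b1 = 0")
      case False
      then have "\<exists>S \<sigma> X Y. real_plane S \<sigma> f1 f3 f2 X Y"
        by (rule real_plane_independent[OF f1(1) f3(1) f2(1) _ f2(2)])
      then show ?thesis using real_plane_swap by blast
    next
      case True
      show ?thesis
        by (rule real_plane_parallel[OF f1(1) f2(1) f3(1) f1(2) f2(2) f3(2) 12 True])
    qed
  qed
  then obtain S \<sigma> X Y where "real_plane S \<sigma> f1 f2 f3 X Y" by blast
  then show ?thesis
    using real_plane.not_real_moment_property real_plane.not_complex_moment_property by blast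
qed

end
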